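(* Assume $SRP(\omega_2)$ and the Tree Property at $\omega_2$. Then there is no ideal which concentrates on $GIS_{\omega_1}$ and bounds its own completeness.
   Context: The base theory is ZFC. $[X]^\omega$ is the set of countable subsets of $X$; a club in $[X]^\omega$ is a $\subseteq$-cofinal subset closed under unions of countable increasing chains, and stationary means meeting every club. For $X\supseteq\omega_1$, a set $P\subset[X]^\omega$ is projective stationary iff for every stationary $T\subset\omega_1$, $\{Y\in P: Y\cap\omega_1\in T\}$ is stationary in $[X]^\omega$. $SRP(\omega_2)$: for every projective stationary $P\subset[H_{\omega_2}]^\omega$ there is a continuous elementary chain $\langle N_\xi:\xi<\omega_1\rangle$ of countable elementary submodels of $H_{\omega_2}$ (i.e. $N_\xi\in N_{\xi+1}$, $N_\xi\subset N_{\xi+1}$, and $N_\xi=\bigcup_{\zeta<\xi}N_\zeta$ for limit $\xi$) with $N_\xi\in P$ for every $\xi<\omega_1$. Tree Property at $\omega_2$: every tree of height $\omega_2$ all of whose levels have size $<\omega_2$ has a cofinal branch. $GIS_{\omega_1}$. $ZF^-$ is ZF without Power Set. A transitive $ZF^-$ model $H$ with $\omega_1\in H$ has the $\omega_1$-approximation property iff for every $\eta\in H$ and $A\subseteq\eta$: if $z\cap A\in H$ for every $z\in H$ which is countable in $H$, then $A\in H$. A set $M$ with $\omega_1\subset M\prec H_\theta$ for some regular uncountable $\theta$ is $\omega_1$-guessing iff its transitive collapse has the $\omega_1$-approximation property. $G_{\omega_1}$ is the class of $\omega_1$-guessing $M$ with $|M|=\omega_1\subset M$. $IS_{\omega_1}$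 (internally stationary sets) is the class of $M$ with $(M,\in)\models ZF^-$, $\omega_1\subseteq M$, $|M|=\omega_1$, such that $M\cap[M]^\omega$ is stationary in $[M]^\omega$. $GIS_{\omega_1}=G_{\omega_1}\cap IS_{\omega_1}$. Ideals. Here an ideal is an ideal $I\subset\wp(Z)$ with $Z=\wp_{\omega_2}(H_\theta)$ for some regular $\theta\ge\omega_2$, which is proper, countably complete, fine (for every $b\in H_\theta$, $\{M\in Z: b\notin M\}\in I$) and normal (if $S\notin I$ and $g$ is a function on $S$ with $g(M)\in M$ for all $M\in S$, then $g$ is constant on some $S'\subseteq S$ with $S'\notin I$). $\breve I$ is the dual filter. $I$ concentrates on a class $\Gamma$ iff some $A\subseteq\Gamma$ belongs to $\breve I$. The completeness of $I$ is the cardinal $\mu$ such that $I$ is closed under unions of fewer than $\mu$ of its members but not under unions of $\mu$ of its members. $I$, with completeness $\mu\subseteq H_\theta$, bounds its completeness iff for every $f:\mu\to\mu$ the set of $M\in Z$ with $otp(M\cap ORD)>f(M\cap\mu)$ belongs to $\breve I$ (note $M\cap\mu\in\mu$ for $\breve I$-almost all $M$). *)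

theory Defs
  imports Main "HOL-Library.Countable_Set" "HOL-Library.Equipollence"
begin

section \<open>The universe of sets\<close>

text \<open>
  A type in this class carries a membership relation satisfying the axioms of second-order ZFC,
  except that Power Set is not required: Separation and Replacement hold for arbitrary HOL
  predicates and functions, and Choice is that of HOL. Universes satisfying Power Set are included,
  and so is every \<open>H\<^sub>\<lambda>\<close> with \<open>\<lambda>\<close> regular uncountable. As \<open>\<lambda>\<close> may be chosen arbitrarily large,
  every regular \<open>\<theta>\<close>, and every \<open>\<theta>'\<close> needed to witness \<open>M \<prec> H\<^bsub>\<theta>'\<^esub>\<close> for sets \<open>M \<subseteq> H\<^sub>\<theta>\<close>, occurs in
  some universe; no inaccessible cardinals are presupposed. Collections of subsets of a universe
  (clubs, stationary sets, ideals) are HOL sets, so powersets inside the universe are not needed.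
\<close>

class set_universe =
  fixes mem :: "'a \<Rightarrow> 'a \<Rightarrow> bool"
  assumes extensionality: "(\<And>z. mem z x \<longleftrightarrow> mem z y) \<Longrightarrow> x = y"
    and foundation: "wfp mem"
    and pairing: "\<exists>z. \<forall>w. mem w z \<longleftrightarrow> w = x \<or> w = y"
    and union: "\<exists>u. \<forall>w. mem w u \<longleftrightarrow> (\<exists>y. mem y x \<and> mem w y)"
    and infinity: "\<exists>x. (\<exists>e. mem e x \<and> (\<forall>w. \<not> mem w e)) \<and>
                     (\<forall>y. mem y x \<longrightarrow> (\<exists>z. mem z x \<and> (\<forall>w. mem w z \<longleftrightarrow> mem w y \<or> w = y)))"
    and separation: "\<exists>y. \<forall>w. mem w y \<longleftrightarrow> mem w x \<and> P w"
    and replacement: "\<exists>y. \<forall>z. mem z y \<longleftrightarrow> (\<exists>w. mem w x \<and> z = F w)"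

definition elts :: "'v::set_universe \<Rightarrow> 'v set" where
  "elts x = {y. mem y x}"

definition trcl :: "'v::set_universe \<Rightarrow> 'v set" where
  "trcl x = {y. mem\<^sup>+\<^sup>+ y x}"


section \<open>Ordinals, cardinals and hereditary cardinality\<close>

definition Ord :: "'v::set_universe \<Rightarrow> bool" where
  "Ord x \<longleftrightarrow> (\<forall>y\<in>elts x. elts y \<subseteq> elts x) \<and> (\<forall>y\<in>elts x. \<forall>z\<in>elts y. elts z \<subseteq> elts y)"

text \<open>
  The first infinite cardinals are given as sets of ordinals rather than as elements of the
  universe, since a universe without Power Set need not contain \<open>\<omega>\<^sub>1\<close> or \<open>\<omega>\<^sub>2\<close> as elements.
\<close>

definition omega0 :: "'v::set_universe set" where
  "omega0 = {\<alpha>. Ord \<alpha> \<and> finite (elts \<alpha>)}"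

definition omega1 :: "'v::set_universe set" where
  "omega1 = {\<alpha>. Ord \<alpha> \<and> countable (elts \<alpha>)}"

definition omega2 :: "'v::set_universe set" where
  "omega2 = {\<alpha>. Ord \<alpha> \<and> elts \<alpha> \<lesssim> (omega1 :: 'v set)}"

definition Card :: "'v::set_universe \<Rightarrow> bool" where
  "Card \<kappa> \<longleftrightarrow> Ord \<kappa> \<and> (\<forall>\<alpha>\<in>elts \<kappa>. elts \<alpha> \<prec> elts \<kappa>)"

definition regular_cardinal :: "'v::set_universe \<Rightarrow> bool" where
  "regular_cardinal \<kappa> \<longleftrightarrow> Card \<kappa> \<and> infinite (elts \<kappa>) \<and>
     (\<forall>A. A \<subseteq> elts \<kappa> \<and> (\<forall>\<alpha>\<in>elts \<kappa>. \<exists>\<beta>\<in>A. \<alpha> = \<beta> \<or> \<alpha> \<in> elts \<beta>) \<longrightarrow> \<not> A \<prec> elts \<kappa>)"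

text \<open>\<open>hered K\<close> is \<open>H\<^sub>\<kappa>\<close>, where \<open>K\<close> is the set of ordinals below \<open>\<kappa>\<close>.\<close>

definition hered :: "'v::set_universe set \<Rightarrow> 'v set" where
  "hered K = {x. trcl x \<prec> K}"

text \<open>
  \<open>(A, r)\<close> is isomorphic to \<open>(S, \<in>)\<close>. This says that \<open>r\<close> well-orders \<open>A\<close> with order type \<open>S\<close>
  when \<open>S\<close> is \<open>elts \<alpha>\<close> for an ordinal \<open>\<alpha>\<close>, or \<open>omega2\<close>.
\<close>

definition has_order_type :: "'a set \<Rightarrow> ('a \<Rightarrow> 'a \<Rightarrow> bool) \<Rightarrow> 'v::set_universe set \<Rightarrow> bool" where
  "has_order_type A r S \<longleftrightarrow>
     (\<exists>f. bij_betw f A S \<and> (\<forall>x\<in>A. \<forall>y\<in>A. r x y \<longleftrightarrow> f x \<in> elts (f y)))"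


section \<open>Clubs and stationary sets\<close>

definition ctbl_subsets :: "'a set \<Rightarrow> 'a set set" where
  "ctbl_subsets X = {Y. Y \<subseteq> X \<and> countable Y}"

definition club_in :: "'a set \<Rightarrow> 'a set set \<Rightarrow> bool" where
  "club_in X C \<longleftrightarrow> C \<subseteq> ctbl_subsets X \<and> (\<forall>Y\<in>ctbl_subsets X. \<exists>D\<in>C. Y \<subseteq> D) \<and>
     (\<forall>K. K \<noteq> {} \<and> countable K \<and> subset.chain C K \<longrightarrow> \<Union>K \<in> C)"

definition stationary_in :: "'a set \<Rightarrow> 'a set set \<Rightarrow> bool" where
  "stationary_in X P \<longleftrightarrow> P \<subseteq> ctbl_subsets X \<and> (\<forall>C. club_in X C \<longrightarrow> P \<inter> C \<noteq> {})"

text \<open>In the closure clause the hypotheses force \<open>\<delta>\<close> to be a limit in which \<open>C\<close> is unbounded.\<close>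

definition club_omega1 :: "'v::set_universe set \<Rightarrow> bool" where
  "club_omega1 C \<longleftrightarrow> C \<subseteq> omega1 \<and> (\<forall>\<alpha>\<in>omega1. \<exists>\<beta>\<in>C. \<alpha> \<in> elts \<beta>) \<and>
     (\<forall>\<delta>\<in>omega1. elts \<delta> \<noteq> {} \<and> (\<forall>\<alpha>\<in>elts \<delta>. \<exists>\<beta>\<in>C \<inter> elts \<delta>. \<alpha> \<in> elts \<beta>) \<longrightarrow> \<delta> \<in> C)"

definition stationary_omega1 :: "'v::set_universe set \<Rightarrow> bool" where
  "stationary_omega1 T \<longleftrightarrow> T \<subseteq> omega1 \<and> (\<forall>C. club_omega1 C \<longrightarrow> T \<inter> C \<noteq> {})"

definition projective_stationary :: "'v::set_universe set \<Rightarrow> 'v set set \<Rightarrow> bool" where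
  "projective_stationary X P \<longleftrightarrow> omega1 \<subseteq> X \<and> P \<subseteq> ctbl_subsets X \<and>
     (\<forall>T. stationary_omega1 T \<longrightarrow>
        stationary_in X {Y \<in> P. \<exists>\<alpha>\<in>T. elts \<alpha> = Y \<inter> omega1})"


section \<open>Formulas of set theory, elementarity and ZF without Power Set\<close>

datatype fm =
    EqF nat nat
  | MemF nat nat
  | NotF fm
  | AndF fm fm
  | ExF nat fm

primrec sat :: "'v::set_universe set \<Rightarrow> fm \<Rightarrow> (nat \<Rightarrow> 'v) \<Rightarrow> bool" where
  "sat M (EqF i j) s \<longleftrightarrow> s i = s j"
| "sat M (MemF i j) s \<longleftrightarrow> s i \<in> elts (s j)"
| "sat M (NotF p) s \<longleftrightarrow> \<not> sat M p s"
| "sat M (AndF p q) s \<longleftrightarrow> sat M p s \<and> sat M q s"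
| "sat M (ExF i p) s \<longleftrightarrow> (\<exists>x\<in>M. sat M p (s(i := x)))"

definition elementary_sub :: "'v::set_universe set \<Rightarrow> 'v set \<Rightarrow> bool" where
  "elementary_sub N M \<longleftrightarrow> N \<noteq> {} \<and> N \<subseteq> M \<and>
     (\<forall>p s. range s \<subseteq> N \<longrightarrow> sat N p s = sat M p s)"

text \<open>
  In the two schemes the distinguished variables are 0 and 1; the values of \<open>s\<close> at the other
  indices are the parameters.
\<close>

definition models_ZF_minus :: "'v::set_universe set \<Rightarrow> bool" where
  "models_ZF_minus M \<longleftrightarrow> M \<noteq> {} \<and>
     \<comment> \<open>Extensionality\<close>
     (\<forall>x\<in>M. \<forall>y\<in>M. (\<forall>z\<in>M. z \<in> elts x \<longleftrightarrow> z \<in> elts y) \<longrightarrow> x = y) \<and>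
     \<comment> \<open>Foundation\<close>
     (\<forall>x\<in>M. (\<exists>y\<in>M. y \<in> elts x) \<longrightarrow>
        (\<exists>y\<in>M. y \<in> elts x \<and> \<not> (\<exists>z\<in>M. z \<in> elts x \<and> z \<in> elts y))) \<and>
     \<comment> \<open>Pairing\<close>
     (\<forall>x\<in>M. \<forall>y\<in>M. \<exists>z\<in>M. \<forall>w\<in>M. w \<in> elts z \<longleftrightarrow> w = x \<or> w = y) \<and>
     \<comment> \<open>Union\<close>
     (\<forall>x\<in>M. \<exists>u\<in>M. \<forall>w\<in>M. w \<in> elts u \<longleftrightarrow> (\<exists>y\<in>M. y \<in> elts x \<and> w \<in> elts y)) \<and>
     \<comment> \<open>Infinity\<close>
     (\<exists>x\<in>M. (\<exists>e\<in>M. e \<in> elts x \<and> (\<forall>w\<in>M. w \<notin> elts e)) \<and>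
        (\<forall>y\<in>M. y \<in> elts x \<longrightarrow>
           (\<exists>z\<in>M. z \<in> elts x \<and> (\<forall>w\<in>M. w \<in> elts z \<longleftrightarrow> w \<in> elts y \<or> w = y)))) \<and>
     \<comment> \<open>Separation\<close>
     (\<forall>p s. range s \<subseteq> M \<longrightarrow>
        (\<forall>x\<in>M. \<exists>y\<in>M. \<forall>w\<in>M. w \<in> elts y \<longleftrightarrow> w \<in> elts x \<and> sat M p (s(0 := w)))) \<and>
     \<comment> \<open>Replacement\<close>
     (\<forall>p s. range s \<subseteq> M \<longrightarrow>
        (\<forall>a\<in>M. (\<forall>x\<in>M. x \<in> elts a \<longrightarrow> (\<exists>!y. y \<in> M \<and> sat M p (s(0 := x, 1 := y)))) \<longrightarrow>
           (\<exists>b\<in>M. \<forall>y\<in>M. y \<in> elts b \<longleftrightarrow>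
              (\<exists>x\<in>M. x \<in> elts a \<and> sat M p (s(0 := x, 1 := y))))))"


section \<open>The hypotheses\<close>

definition SRP_omega2 :: "'v::set_universe itself \<Rightarrow> bool" where
  "SRP_omega2 (U :: 'v itself) \<longleftrightarrow>
     (\<forall>P. projective_stationary (hered (omega2 :: 'v set)) P \<longrightarrow>
        (\<exists>N :: 'v \<Rightarrow> 'v set.
           (\<forall>\<xi>\<in>omega1. countable (N \<xi>) \<and> elementary_sub (N \<xi>) (hered omega2) \<and> N \<xi> \<in> P) \<and>
           (\<forall>\<xi>\<in>omega1. \<forall>\<eta>\<in>omega1. elts \<eta> = insert \<xi> (elts \<xi>) \<longrightarrow>
              (\<exists>x\<in>N \<eta>. elts x = N \<xi>) \<and> N \<xi> \<subseteq> N \<eta>) \<and>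
           (\<forall>\<xi>\<in>omega1. elts \<xi> \<noteq> {} \<and> (\<forall>\<alpha>\<in>elts \<xi>. \<exists>\<beta>\<in>elts \<xi>. \<alpha> \<in> elts \<beta>) \<longrightarrow>
              N \<xi> = (\<Union>\<zeta>\<in>elts \<xi>. N \<zeta>))))"

definition preds :: "'a set \<Rightarrow> ('a \<Rightarrow> 'a \<Rightarrow> bool) \<Rightarrow> 'a \<Rightarrow> 'a set" where
  "preds T r x = {y \<in> T. r y x}"

definition is_tree :: "'a set \<Rightarrow> ('a \<Rightarrow> 'a \<Rightarrow> bool) \<Rightarrow> bool" where
  "is_tree T r \<longleftrightarrow> (\<forall>x\<in>T. \<not> r x x) \<and>
     (\<forall>x\<in>T. \<forall>y\<in>T. \<forall>z\<in>T. r x y \<and> r y z \<longrightarrow> r x z) \<and>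
     (\<forall>x\<in>T. \<forall>B. B \<subseteq> preds T r x \<and> B \<noteq> {} \<longrightarrow> (\<exists>m\<in>B. \<forall>y\<in>B. y = m \<or> r m y))"

definition level :: "'a set \<Rightarrow> ('a \<Rightarrow> 'a \<Rightarrow> bool) \<Rightarrow> 'v::set_universe set \<Rightarrow> 'a set" where
  "level T r S = {x \<in> T. has_order_type (preds T r x) r S}"

text \<open>
  Trees of height \<open>\<omega>\<^sub>2\<close> with levels of size less than \<open>\<omega>\<^sub>2\<close> have at most \<open>\<omega>\<^sub>2\<close> nodes, so it is no
  restriction that their nodes are elements of the universe.
\<close>

definition tree_property_omega2 :: "'v::set_universe itself \<Rightarrow> bool" where
  "tree_property_omega2 (U :: 'v itself) \<longleftrightarrow>
     (\<forall>(T :: 'v set) r.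
        is_tree T r \<and>
        (\<forall>\<alpha>\<in>(omega2 :: 'v set). level T r (elts \<alpha>) \<noteq> {}) \<and> level T r (omega2 :: 'v set) = {} \<and>
        (\<forall>\<alpha>\<in>(omega2 :: 'v set). level T r (elts \<alpha>) \<prec> (omega2 :: 'v set)) \<longrightarrow>
        (\<exists>B \<subseteq> T. (\<forall>x\<in>B. \<forall>y\<in>B. x = y \<or> r x y \<or> r y x) \<and> (\<forall>x\<in>B. preds T r x \<subseteq> B) \<and>
           (\<forall>\<alpha>\<in>(omega2 :: 'v set). B \<inter> level T r (elts \<alpha>) \<noteq> {})))"


section \<open>Guessing and internally stationary sets\<close>

text \<open>\<open>p\<close> is the Kuratowski pair of \<open>a\<close> and \<open>b\<close>.\<close>

definition is_pair :: "'v::set_universe \<Rightarrow> 'v \<Rightarrow> 'v \<Rightarrow> bool" where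
  "is_pair p a b \<longleftrightarrow> (\<exists>u v. elts u = {a} \<and> elts v = {a, b} \<and> elts p = {u, v})"

text \<open>Some \<open>f \<in> H\<close> is the graph of an injection from \<open>z\<close> into \<open>\<omega>\<close>.\<close>

definition countable_in :: "'v::set_universe set \<Rightarrow> 'v \<Rightarrow> bool" where
  "countable_in H z \<longleftrightarrow>
     (\<exists>f\<in>H. \<exists>g. inj_on g (elts z) \<and> g ` elts z \<subseteq> omega0 \<and>
        (\<forall>p. p \<in> elts f \<longleftrightarrow> (\<exists>x\<in>elts z. is_pair p x (g x))))"

definition omega1_approximation_property :: "'v::set_universe set \<Rightarrow> bool" where
  "omega1_approximation_property H \<longleftrightarrow>
     (\<forall>x\<in>H. elts x \<subseteq> H) \<and> models_ZF_minus H \<and> (\<exists>w\<in>H. elts w = omega1) \<and>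
     (\<forall>\<eta>\<in>H. \<forall>A \<subseteq> elts \<eta>.
        (\<forall>z\<in>H. countable_in H z \<longrightarrow> (\<exists>w\<in>H. elts w = elts z \<inter> A)) \<longrightarrow>
        (\<exists>w\<in>H. elts w = A))"

definition transitive_collapse :: "'v::set_universe set \<Rightarrow> 'v set \<Rightarrow> bool" where
  "transitive_collapse M H \<longleftrightarrow>
     (\<exists>\<pi>. (\<forall>x\<in>M. elts (\<pi> x) = \<pi> ` (elts x \<inter> M)) \<and> H = \<pi> ` M)"

definition omega1_guessing :: "'v::set_universe set \<Rightarrow> bool" where
  "omega1_guessing M \<longleftrightarrow> omega1 \<subseteq> M \<and>
     (\<exists>\<theta>. regular_cardinal \<theta> \<and> uncountable (elts \<theta>) \<and> elementary_sub M (hered (elts \<theta>))) \<and>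
     (\<exists>H. transitive_collapse M H \<and> omega1_approximation_property H)"

definition G_omega1 :: "'v::set_universe set set" where
  "G_omega1 = {M. omega1_guessing M \<and> M \<approx> (omega1 :: 'v set) \<and> omega1 \<subseteq> M}"

definition IS_omega1 :: "'v::set_universe set set" where
  "IS_omega1 = {M. models_ZF_minus M \<and> omega1 \<subseteq> M \<and> M \<approx> (omega1 :: 'v set) \<and>
     stationary_in M {Y \<in> ctbl_subsets M. \<exists>x\<in>M. elts x = Y}}"

definition GIS_omega1 :: "'v::set_universe set set" where
  "GIS_omega1 = G_omega1 \<inter> IS_omega1"


section \<open>Ideals\<close>

definition small_subsets :: "'v::set_universe \<Rightarrow> 'v set set" where
  "small_subsets \<theta> = {M. M \<subseteq> hered (elts \<theta>) \<and> M \<prec> (omega2 :: 'v set)}"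

definition normal_fine_ideal :: "'v::set_universe \<Rightarrow> 'v set set set \<Rightarrow> bool" where
  "normal_fine_ideal \<theta> I \<longleftrightarrow>
     I \<subseteq> Pow (small_subsets \<theta>) \<and>
     {} \<in> I \<and> (\<forall>S\<in>I. \<forall>S'\<subseteq>S. S' \<in> I) \<and>
     small_subsets \<theta> \<notin> I \<and>
     (\<forall>J \<subseteq> I. countable J \<longrightarrow> \<Union>J \<in> I) \<and>
     (\<forall>b\<in>hered (elts \<theta>). {M \<in> small_subsets \<theta>. b \<notin> M} \<in> I) \<and>
     (\<forall>S g. S \<subseteq> small_subsets \<theta> \<and> S \<notin> I \<and> (\<forall>M\<in>S. g M \<in> M) \<longrightarrow>
        (\<exists>S'\<subseteq>S. S' \<notin> I \<and> (\<exists>c. \<forall>M\<in>S'. g M = c)))"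

definition dual_filter :: "'v::set_universe \<Rightarrow> 'v set set set \<Rightarrow> 'v set set set" where
  "dual_filter \<theta> I = {A. A \<subseteq> small_subsets \<theta> \<and> small_subsets \<theta> - A \<in> I}"

definition concentrates_on ::
    "'v::set_universe \<Rightarrow> 'v set set set \<Rightarrow> 'v set set \<Rightarrow> bool" where
  "concentrates_on \<theta> I \<Gamma> \<longleftrightarrow> (\<exists>A \<subseteq> \<Gamma>. A \<in> dual_filter \<theta> I)"

definition has_completeness :: "'v::set_universe set set set \<Rightarrow> 'v \<Rightarrow> bool" where
  "has_completeness I \<mu> \<longleftrightarrow> Card \<mu> \<and>
     (\<forall>J \<subseteq> I. J \<prec> elts \<mu> \<longrightarrow> \<Union>J \<in> I) \<and>
     (\<exists>J \<subseteq> I. J \<approx> elts \<mu> \<and> \<Union>J \<notin> I)"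

text \<open>
  \<open>\<delta>\<close> is the ordinal \<open>M \<inter> \<mu>\<close> and \<open>\<tau>\<close> is \<open>otp(M \<inter> ORD)\<close>. Sets \<open>M\<close> for which
  \<open>M \<inter> \<mu>\<close> is not an element of \<open>\<mu>\<close> do not count as members.
\<close>

definition bounds_completeness :: "'v::set_universe \<Rightarrow> 'v set set set \<Rightarrow> bool" where
  "bounds_completeness \<theta> I \<longleftrightarrow>
     (\<exists>\<mu>. has_completeness I \<mu> \<and> elts \<mu> \<subseteq> hered (elts \<theta>) \<and>
        (\<forall>f. f ` elts \<mu> \<subseteq> elts \<mu> \<longrightarrow>
           {M \<in> small_subsets \<theta>. \<exists>\<delta>\<in>elts \<mu>. \<exists>\<tau>. elts \<delta> = M \<inter> elts \<mu> \<and>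
              Ord \<tau> \<and> has_order_type (M \<inter> Collect Ord) mem (elts \<tau>) \<and> f \<delta> \<in> elts \<tau>}
           \<in> dual_filter \<theta> I))"

end

theory Submission
  imports Defs
begin

text \<open>
  Normality makes almost every \<open>M\<close> closed under any given finitary operation, which replaces all
  appeals to elementarity. The completeness of the ideal is \<open>\<omega>\<^sub>2\<close>, and if the ideal bounds it, then
  for some \<open>\<alpha> < \<omega>\<^sub>2\<close> the collapses \<open>H\<close> of the models \<open>M\<close> with \<open>M \<inter> \<omega>\<^sub>2 = \<alpha>\<close> have heights unbounded
  in \<open>\<omega>\<^sub>2\<close>. Since SRP gives \<open>2\<^sup>\<omega> \<le> \<omega>\<^sub>2\<close>, all these \<open>H\<close> have the same set \<open>R\<close> of reals, and guessing
  makes \<open>R\<close> miss some real. The traces \<open>H \<inter> [\<beta>]\<^sup>\<omega>\<close> form a tree of height \<open>\<omega>\<^sub>2\<close>. Distinct traces at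
  \<open>\<beta>\<close> yield almost disjoint stationary subsets of \<open>\<omega>\<^sub>1\<close>, so the levels have size at most \<open>\<omega>\<^sub>1\<close> because
  SRP makes the nonstationary ideal saturated. A cofinal branch is a family \<open>F\<close> of countable subsets of
  \<open>\<omega>\<^sub>2\<close> that is stationary in \<open>[\<beta>]\<^sup>\<omega>\<close> for every uncountable \<open>\<beta> < \<omega>\<^sub>2\<close>, and every real decoded from three
  members of \<open>F\<close> is in \<open>R\<close>. By an argument of Gitik, for every real \<open>r\<close> and stationary \<open>S \<subseteq> \<omega>\<^sub>1\<close>, every
  club contains three sets whose common trace on \<open>\<omega>\<^sub>1\<close> is in \<open>S\<close> and which decode to \<open>r\<close>. Taking
  \<open>r \<notin> R\<close>, the sets whose trace on \<open>\<omega>\<^sub>2\<close> is not in \<open>F\<close> are projective stationary, and an SRP chain of such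
  sets contradicts the stationarity of \<open>F\<close>.
\<close>

text \<open>The continuum bound makes \<open>R\<close> common to all models: each \<open>M\<close>
  is closed under one fixed enumeration of the reals by omega2 and under its inverse, so its reals
  are those with index in M \<inter> omega2. Countable sets in different collapses can then be
  compared, because relative to a common covering set they are coded by reals. The ordinal \<alpha>
  comes from diagonalization: if for every \<alpha> the heights were bounded below omega2, the
  function choosing such bounds would contradict the bounding hypothesis. The decoding argument is
  used twice: for the family of all images of countable ordinals under fixed surjections of omega1,
  which gives the continuum bound, and for the branch. Its obstacle is that a new ordinal put into a
  countable hull may add countable ordinals, whereas the three sets must keep a common trace on
  omega1; a game isolates the positions that can be prolonged arbitrarily high without this.\<close>

lemma UN_lepoll_infinite:
  assumes "infinite B" "A \<lesssim> B" "\<And>a. a \<in> A \<Longrightarrow> f a \<lesssim> B"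
  shows "(\<Union>a\<in>A. f a) \<lesssim> B"
  using card_of_UNION_ordLeq_infinite[of B A f] assms
  unfolding lepoll_def card_of_ordLeq by blast

lemma countable_lepoll_infinite:
  assumes "countable A" "infinite B"
  shows "A \<lesssim> B"
proof -
  have "A \<lesssim> (UNIV :: nat set)"
    using assms(1) unfolding countable_def lepoll_def by blast
  then show ?thesis using assms(2) infinite_le_lepoll lepoll_trans by blast
qed

subsection \<open>Sets closed under finitary operations\<close>

text \<open>Operations take finite subsets to sets rather than tuples to points: a single
  \<open>G\<close> can then combine several operations, and it can return a whole member of a club,
  as in \<open>club_in_imp_closed_under\<close>.\<close>

definition closed_under :: "('q set \<Rightarrow> 'q set) \<Rightarrow> 'q set \<Rightarrow> bool" where
  "closed_under G X \<longleftrightarrow> (\<forall>s. finite s \<and> s \<subseteq> X \<longrightarrow> G s \<subseteq> X)"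

definition hull_under :: "('q set \<Rightarrow> 'q set) \<Rightarrow> 'q set \<Rightarrow> 'q set" where
  "hull_under G A = \<Inter>{X. A \<subseteq> X \<and> closed_under G X}"

lemma subset_hull_under: "A \<subseteq> hull_under G A"
  unfolding hull_under_def by blast

lemma closed_hull_under: "closed_under G (hull_under G A)"
  unfolding hull_under_def closed_under_def by blast

lemma hull_under_least: "A \<subseteq> X \<Longrightarrow> closed_under G X \<Longrightarrow> hull_under G A \<subseteq> X"
  unfolding hull_under_def by blast

lemma hull_under_mono: "A \<subseteq> B \<Longrightarrow> hull_under G A \<subseteq> hull_under G B"
  unfolding hull_under_def by blast

lemma closed_under_Union_chain:
  assumes "\<And>X. X \<in> K \<Longrightarrow> closed_under G X" "K \<noteq> {}" "subset.chain C K"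
  shows "closed_under G (\<Union>K)"
  unfolding closed_under_def
proof (intro allI impI)
  fix s assume s: "finite s \<and> s \<subseteq> \<Union>K"
  then obtain X where "X \<in> K" "s \<subseteq> X"
    using finite_subset_Union_chain[OF _ _ assms(2,3)] by blast
  then show "G s \<subseteq> \<Union>K"
    using assms(1) s unfolding closed_under_def by blast
qed

lemma closed_under_UN_mono:
  fixes F :: "'i::linorder \<Rightarrow> 'q set"
  assumes "\<And>i. i \<in> I \<Longrightarrow> closed_under G (F i)" "I \<noteq> {}" "mono_on I F"
  shows "closed_under G (\<Union>i\<in>I. F i)"
proof (rule closed_under_Union_chain)
  have "F i \<subseteq> F j \<or> F j \<subseteq> F i" if "i \<in> I" "j \<in> I" for i j
    using that mono_onD[OF assms(3)] linear[of i j] by blast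
  then show "subset.chain UNIV (F ` I)"
    unfolding subset_chain_def by blast
qed (use assms in auto)

lemma countable_hull_under:
  assumes "countable A" "\<And>s. finite s \<Longrightarrow> countable (G s)"
  shows "countable (hull_under G A)"
proof -
  define step where "step B = B \<union> (\<Union>s\<in>{s. finite s \<and> s \<subseteq> B}. G s)" for B
  define X where "X n = (step ^^ n) A" for n
  have Suc_eq: "X (Suc n) = step (X n)" for n unfolding X_def by simp
  have "countable (X n)" for n
  proof (induction n)
    case 0 then show ?case using assms by (simp add: X_def)
  next
    case (Suc n)
    then have "countable {s. finite s \<and> s \<subseteq> X n}" by (rule countable_Collect_finite_subset)
    then show ?case using Suc assms(2) unfolding Suc_eq step_def by auto
  qed
  moreover have mono: "mono X"
    by (rule monoI[OF lift_Suc_mono_le]) (auto simp: Suc_eq step_def)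
  have "closed_under G (\<Union>n. X n)"
    unfolding closed_under_def
  proof (intro allI impI)
    fix s assume s: "finite s \<and> s \<subseteq> (\<Union>n. X n)"
    have "X m \<subseteq> X n \<or> X n \<subseteq> X m" for m n
      using monoD[OF mono] linear[of m n] by blast
    then have "subset.chain UNIV (range X)"
      unfolding subset_chain_def by blast
    then obtain n where "s \<subseteq> X n"
      using s finite_subset_Union_chain[of s "range X"] by blast
    then have "G s \<subseteq> X (Suc n)" using s by (auto simp: Suc_eq step_def)
    then show "G s \<subseteq> (\<Union>n. X n)" by blast
  qed
  then have "hull_under G A \<subseteq> (\<Union>n. X n)"
    using UN_upper[of 0 UNIV X] by (intro hull_under_least) (simp_all add: X_def)
  ultimately show ?thesis using countable_subset[OF _ countable_UN[of UNIV X]] by simp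
qed

lemma club_in_closed_under:
  assumes G: "\<And>s. finite s \<Longrightarrow> countable (G s)" "closed_under G Q"
  shows "club_in Q {X \<in> ctbl_subsets Q. closed_under G X}"
  unfolding club_in_def
proof (intro conjI ballI allI impI)
  fix Y assume Y: "Y \<in> ctbl_subsets Q"
  then have "hull_under G Y \<in> {X \<in> ctbl_subsets Q. closed_under G X}"
    using countable_hull_under[OF _ G(1), of Y] hull_under_least[OF _ G(2)]
    by (auto simp: ctbl_subsets_def closed_hull_under)
  then show "\<exists>D\<in>{X \<in> ctbl_subsets Q. closed_under G X}. Y \<subseteq> D" by (intro bexI[of _ "hull_under G Y"] subset_hull_under)
next
  fix K assume "K \<noteq> {} \<and> countable K \<and> subset.chain {X \<in> ctbl_subsets Q. closed_under G X} K"
  then have K: "K \<noteq> {}" "countable K" "subset.chain {X \<in> ctbl_subsets Q. closed_under G X} K"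
    "\<And>X. X \<in> K \<Longrightarrow> X \<subseteq> Q \<and> countable X \<and> closed_under G X"
    unfolding subset_chain_def ctbl_subsets_def by blast+
  have "closed_under G (\<Union>K)" using closed_under_Union_chain[OF _ K(1,3)] K(4) by blast
  moreover have "countable (\<Union>K)" using countable_UN[of K "\<lambda>X. X"] K by simp
  moreover have "\<Union>K \<subseteq> Q" using K(4) by blast
  ultimately show "\<Union>K \<in> {X \<in> ctbl_subsets Q. closed_under G X}"
    unfolding ctbl_subsets_def by blast
qed auto

text \<open>Kueker's characterization of clubs. Choose monotonically for each finite
  \<open>s\<close> a member \<open>f s\<close> of the club containing \<open>s\<close>. A countable
  set closed under these choices is the union of the chain of the values \<open>f s\<close> along an
  increasing sequence of finite sets exhausting it.\<close>

lemma club_in_imp_closed_under: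
  assumes "club_in Q C"
  obtains G where "\<And>s. finite s \<Longrightarrow> countable (G s)" "\<And>s. G s \<subseteq> Q"
    "\<And>X. X \<in> ctbl_subsets Q \<Longrightarrow> closed_under G X \<Longrightarrow> X \<in> C"
proof -
  have C: "C \<subseteq> ctbl_subsets Q" "\<And>Y. Y \<in> ctbl_subsets Q \<Longrightarrow> \<exists>D\<in>C. Y \<subseteq> D"
    and Un: "\<And>K. K \<noteq> {} \<Longrightarrow> countable K \<Longrightarrow> subset.chain C K \<Longrightarrow> \<Union>K \<in> C"
    using assms unfolding club_in_def by auto
  \<comment> \<open>Containing all \<open>f t\<close> for proper subsets \<open>t\<close> makes
    \<open>f\<close> monotone; this is what turns increasing finite sets into a chain in
    \<open>C\<close>.\<close>
  define P where "P f s R \<longleftrightarrow> finite s \<and> s \<subseteq> Q \<longrightarrow> R \<in> C \<and> s \<subseteq> R \<and> (\<forall>t. t \<subset> s \<longrightarrow> f t \<subseteq> R)"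
    for f and s R :: "'a set"
  have "\<exists>f. \<forall>s. P f s (f s)"
  proof (rule dependent_wf_choice[OF wf_finite_psubset])
    fix f g :: "'a set \<Rightarrow> 'a set" and s R
    assume "\<And>z. (z, s) \<in> finite_psubset \<Longrightarrow> f z = g z"
    then show "P f s R = P g s R" unfolding P_def finite_psubset_def by auto
  next
    fix s and f :: "'a set \<Rightarrow> 'a set"
    assume IH: "\<And>t. (t, s) \<in> finite_psubset \<Longrightarrow> P f t (f t)"
    show "\<exists>R. P f s R"
    proof (cases "finite s \<and> s \<subseteq> Q")
      case True
      then have "f t \<in> C" if "t \<subset> s" for t
        using IH[of t] that unfolding P_def finite_psubset_def by (auto dest: finite_subset)
      then have "s \<union> (\<Union>t\<in>{t. t \<subset> s}. f t) \<in> ctbl_subsets Q"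
      proof -
        have "finite {t. t \<subset> s}" using True by (auto intro: finite_subset[OF _ finite_Pow_iff[THEN iffD2]])
        then have "countable (\<Union>t\<in>{t. t \<subset> s}. f t)"
          using \<open>\<And>t. t \<subset> s \<Longrightarrow> f t \<in> C\<close> C(1) unfolding ctbl_subsets_def
          by (intro countable_UN) (auto intro: countable_finite)
        moreover have "(\<Union>t\<in>{t. t \<subset> s}. f t) \<subseteq> Q"
          using \<open>\<And>t. t \<subset> s \<Longrightarrow> f t \<in> C\<close> C(1) unfolding ctbl_subsets_def by blast
        ultimately show ?thesis using True unfolding ctbl_subsets_def by (simp add: countable_finite)
      qed
      then obtain R where "R \<in> C" "s \<union> (\<Union>t\<in>{t. t \<subset> s}. f t) \<subseteq> R" using C(2) by blast
      then show ?thesis unfolding P_def by blast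
    qed (auto simp: P_def)
  qed
  then obtain f where f: "\<And>s. P f s (f s)" by blast
  define G where "G s = (if finite s \<and> s \<subseteq> Q then f s else {})" for s
  have fC: "f s \<in> C" "s \<subseteq> f s" if "finite s" "s \<subseteq> Q" for s using f[of s] that unfolding P_def by auto
  have fmono: "f t \<subseteq> f s" if "finite s" "s \<subseteq> Q" "t \<subseteq> s" for s t
    using f[of s] that unfolding P_def by (cases "t = s") auto
  show ?thesis
  proof (rule that[of G])
    show "countable (G s)" for s using fC(1)[of s] C(1) unfolding G_def ctbl_subsets_def by auto
    show "G s \<subseteq> Q" for s using fC(1)[of s] C(1) unfolding G_def ctbl_subsets_def by auto
    fix X assume X: "X \<in> ctbl_subsets Q" "closed_under G X"
    define s where "s n = {x \<in> X. to_nat_on X x < n}" for n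
    have cX: "countable X" "X \<subseteq> Q" using X unfolding ctbl_subsets_def by auto
    have fin: "finite (s n)" for n
    proof -
      have "finite (to_nat_on X ` s n)" by (rule finite_subset[of _ "{..<n}"]) (auto simp: s_def)
      moreover have "inj_on (to_nat_on X) (s n)"
        by (rule inj_on_subset[OF inj_on_to_nat_on[OF cX(1)]]) (auto simp: s_def)
      ultimately show ?thesis by (rule finite_imageD)
    qed
    have sQ: "s n \<subseteq> Q" for n using cX by (auto simp: s_def)
    have "f (s n) \<subseteq> X" for n
    proof -
      have "s n \<subseteq> X" unfolding s_def by blast
      then have "G (s n) \<subseteq> X" using X(2) fin[of n] unfolding closed_under_def by blast
      then show ?thesis using fin[of n] sQ[of n] unfolding G_def by simp
    qed
    moreover have "x \<in> f (s (Suc (to_nat_on X x)))" if "x \<in> X" for x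
      using fC(2)[OF fin sQ] that by (auto simp: s_def)
    ultimately have "X = \<Union>(range (\<lambda>n. f (s n)))" by blast
    moreover have "subset.chain C (range (\<lambda>n. f (s n)))"
      unfolding subset_chain_def
    proof (intro conjI ballI)
      show "range (\<lambda>n. f (s n)) \<subseteq> C" using fC(1)[OF fin sQ] by auto
      fix A B assume "A \<in> range (\<lambda>n. f (s n))" "B \<in> range (\<lambda>n. f (s n))"
      then obtain m n where "A = f (s m)" "B = f (s n)" by blast
      moreover have "s m \<subseteq> s n \<or> s n \<subseteq> s m" unfolding s_def by (cases "m \<le> n") auto
      ultimately show "A \<subseteq> B \<or> B \<subseteq> A" using fmono[OF fin sQ] by blast
    qed
    ultimately show "X \<in> C" using Un[of "range (\<lambda>n. f (s n))"] by simp
  qed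
qed

lemma club_in_Int:
  assumes "club_in Q C" "club_in Q D"
  shows "\<exists>E\<subseteq>C \<inter> D. club_in Q E"
proof -
  obtain G where G: "\<And>s. finite s \<Longrightarrow> countable (G s)" "\<And>s. G s \<subseteq> Q"
    "\<And>X. X \<in> ctbl_subsets Q \<Longrightarrow> closed_under G X \<Longrightarrow> X \<in> C"
    using club_in_imp_closed_under[OF assms(1)] by metis
  obtain G' where G': "\<And>s. finite s \<Longrightarrow> countable (G' s)" "\<And>s. G' s \<subseteq> Q"
    "\<And>X. X \<in> ctbl_subsets Q \<Longrightarrow> closed_under G' X \<Longrightarrow> X \<in> D"
    using club_in_imp_closed_under[OF assms(2)] by metis
  let ?H = "\<lambda>s. G s \<union> G' s"
  have "club_in Q {X \<in> ctbl_subsets Q. closed_under ?H X}"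
    by (rule club_in_closed_under) (use G G' in \<open>auto simp: closed_under_def\<close>)
  moreover have "{X \<in> ctbl_subsets Q. closed_under ?H X} \<subseteq> C \<inter> D"
    using G(3) G'(3) by (auto simp: closed_under_def)
  ultimately show ?thesis by blast
qed

subsection \<open>The first uncountable ordinals inside a well-ordered type\<close>

text \<open>The combinatorics is carried out in an arbitrary well-ordered type. The two assumptions
  say that the initial segments below \<open>w1\<close> and \<open>w2\<close> have order types
  omega1 and omega2.\<close>

locale omega_1_2 =
  fixes w1 w2 :: "'o::wellorder"
  assumes less_w1: "a < w1 \<longleftrightarrow> countable {..<a}"
    and less_w2: "a < w2 \<longleftrightarrow> {..<a} \<lesssim> {..<w1}"
begin

lemma uncountable_w1: "uncountable {..<w1}"
  using less_w1[of w1] by simp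

lemma infinite_w1: "infinite {..<w1}"
  using uncountable_w1 countable_finite by blast

lemma w1_less_w2: "w1 < w2"
  using less_w2[of w1] by simp

lemma not_lepoll_w2: "\<not> {..<w2} \<lesssim> {..<w1}"
  using less_w2[of w2] by simp

lemma countable_atMost: "a < w1 \<Longrightarrow> countable {..a}"
  using less_w1[of a] by (simp add: ivl_disj_un_singleton(2)[symmetric])

lemma atMost_lepoll: "a < w2 \<Longrightarrow> {..a} \<lesssim> {..<w1}"
proof -
  assume "a < w2"
  then have *: "{..<a} \<lesssim> {..<w1}" using less_w2 by blast
  show ?thesis
  proof (cases "finite {..<a}")
    case True
    then have "countable {..a}" by (simp add: ivl_disj_un_singleton(2)[symmetric] countable_finite)
    then show ?thesis by (rule countable_lepoll_infinite[OF _ infinite_w1])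
  next
    case False
    then have "insert a {..<a} \<lesssim> {..<a}" by (meson infinite_insert_lepoll lepoll_refl)
    moreover have "{..a} = insert a {..<a}" by (simp flip: ivl_disj_un_singleton(2))
    ultimately show ?thesis using * by (metis lepoll_trans)
  qed
qed

lemma bounded_w1:
  assumes "countable A" "A \<subseteq> {..<w1}"
  shows "\<exists>b<w1. \<forall>a\<in>A. a < b"
proof -
  have "\<not> {..<w1} \<subseteq> (\<Union>a\<in>A. {..a})"
    using uncountable_w1 assms countable_atMost
    by (meson countable_UN countable_subset lessThan_iff subsetD)
  then show ?thesis unfolding subset_eq Ball_def UN_iff atMost_iff lessThan_iff not_all not_imp
    by (meson not_le)
qed

lemma bounded_w2:
  assumes "A \<lesssim> {..<w1}" "A \<subseteq> {..<w2}"
  shows "\<exists>b<w2. \<forall>a\<in>A. a < b"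
proof -
  have "(\<Union>a\<in>A. {..a}) \<lesssim> {..<w1}"
    using assms atMost_lepoll by (intro UN_lepoll_infinite infinite_w1) auto
  then have "\<not> {..<w2} \<subseteq> (\<Union>a\<in>A. {..a})"
    using not_lepoll_w2 by (meson lepoll_trans subset_imp_lepoll)
  then show ?thesis unfolding subset_eq Ball_def UN_iff atMost_iff lessThan_iff not_all not_imp
    by (meson not_le)
qed

lemma bounded_w2_countable:
  assumes "countable A" "A \<subseteq> {..<w2}"
  shows "\<exists>b<w2. \<forall>a\<in>A. a < b"
  using bounded_w2[OF countable_lepoll_infinite[OF assms(1) infinite_w1] assms(2)] by blast

lemma max_less_w1: "a < w1 \<Longrightarrow> b < w1 \<Longrightarrow> \<exists>c<w1. a < c \<and> b < c"
  using bounded_w1[of "{a, b}"] by simp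

lemma ex_less_w1: "\<exists>x. x < w1"
  using infinite_w1 by (metis finite.emptyI lessThan_iff equals0I)

subsection \<open>Closure points and stationary sets\<close>

text \<open>Sets of this form generate the club filter on omega1, so a function stands for a club.
  The existence clause removes the least ordinal, which is vacuously closed; a closure point need
  not be a limit, which is why \<open>selfmap_limit\<close> is a separate fact.\<close>

definition closure_points :: "('o \<Rightarrow> 'o) \<Rightarrow> 'o set" where
  "closure_points f = {d. d < w1 \<and> (\<exists>x. x < d) \<and> (\<forall>x<d. f x < d)}"

lemma closure_pointsD:
  assumes "d \<in> closure_points f" shows "d < w1" "x < d \<Longrightarrow> f x < d"
  using assms unfolding closure_points_def by blast+

definition selfmap :: "('o \<Rightarrow> 'o) \<Rightarrow> bool" where
  "selfmap f \<longleftrightarrow> (\<forall>x<w1. f x < w1)"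

definition stat :: "'o set \<Rightarrow> bool" where
  "stat S \<longleftrightarrow> S \<subseteq> {..<w1} \<and> (\<forall>f. selfmap f \<longrightarrow> S \<inter> closure_points f \<noteq> {})"

lemma statD: "stat S \<Longrightarrow> selfmap f \<Longrightarrow> \<exists>d\<in>S. d \<in> closure_points f"
  unfolding stat_def by blast

lemma closure_points_unbounded:
  assumes "selfmap f" "a < w1"
  obtains d where "d \<in> closure_points f" "a < d"
proof -
  have "\<exists>b. \<forall>n. (b n < w1) \<and> (b n < b (Suc n) \<and> a < b (Suc n) \<and> (\<forall>x\<le>b n. f x < b (Suc n)))"
  proof (rule dependent_nat_choice)
    show "\<exists>x. x < w1" using assms by blast
    fix y :: 'o and n :: nat assume y: "y < w1"
    have "f ` {..y} \<subseteq> {..<w1}" using assms y unfolding selfmap_def by auto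
    then obtain c where c: "c < w1" "\<And>x. x \<le> y \<Longrightarrow> f x < c"
      using bounded_w1[of "f ` {..y}"] countable_atMost[OF y] by auto
    obtain c' where "c' < w1" "y < c'" "a < c'" using max_less_w1[OF y assms(2)] by blast
    then show "\<exists>z<w1. y < z \<and> a < z \<and> (\<forall>x\<le>y. f x < z)"
      using c max_less_w1[of c c'] by (meson less_trans)
  qed
  then obtain b where b: "\<And>n. b n < w1" "\<And>n. b n < b (Suc n)" "\<And>n. a < b (Suc n)"
    "\<And>n x. x \<le> b n \<Longrightarrow> f x < b (Suc n)" by blast
  obtain c where "c < w1" "\<And>n. b n < c" using bounded_w1[of "range b"] b(1) by auto
  define d where "d = (LEAST d. \<forall>n. b n < d)"
  have d: "\<And>n. b n < d" unfolding d_def using LeastI[of "\<lambda>d. \<forall>n. b n < d" c] \<open>\<And>n. b n < c\<close> by blast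
  have "d \<le> c" unfolding d_def using Least_le[of "\<lambda>d. \<forall>n. b n < d" c] \<open>\<And>n. b n < c\<close> by blast
  have "\<exists>n. x \<le> b n" if "x < d" for x
    using not_less_Least[of x "\<lambda>d. \<forall>n. b n < d"] that unfolding d_def by (auto simp: not_less)
  then have "f x < d" if "x < d" for x using that b(4) d less_trans by metis
  then have "d \<in> closure_points f"
    unfolding closure_points_def using d[of 0] \<open>d \<le> c\<close> \<open>c < w1\<close> by auto
  then show ?thesis using that[of d] b(3) d less_trans by blast
qed

lemma selfmap_combine:
  assumes "selfmap f" "selfmap g"
  shows "selfmap (\<lambda>x. max (f x) (g x))"
    "closure_points (\<lambda>x. max (f x) (g x)) = closure_points f \<inter> closure_points g"
  using assms unfolding selfmap_def closure_points_def by auto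

lemma selfmap_sup:
  assumes "\<And>x. x < w1 \<Longrightarrow> countable (A x)" "\<And>x. x < w1 \<Longrightarrow> A x \<subseteq> {..<w1}"
  obtains f where "selfmap f" "\<And>x a. x < w1 \<Longrightarrow> a \<in> A x \<Longrightarrow> a < f x"
proof -
  have "\<forall>x. \<exists>b. x < w1 \<longrightarrow> b < w1 \<and> (\<forall>a\<in>A x. a < b)" using bounded_w1 assms by metis
  then show ?thesis using that unfolding selfmap_def by metis
qed

definition limit_below :: "'o \<Rightarrow> bool" where
  "limit_below d \<longleftrightarrow> (\<exists>x. x < d) \<and> (\<forall>x<d. \<exists>y<d. x < y)"

lemma selfmap_limit:
  "\<exists>f. selfmap f \<and> (\<forall>d\<in>closure_points f. limit_below d)"
proof -
  obtain f where f: "selfmap f" "\<And>x a. x < w1 \<Longrightarrow> a \<in> {x} \<Longrightarrow> a < f x"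
    using selfmap_sup[of "\<lambda>x. {x}"] by auto
  moreover have "limit_below d" if "d \<in> closure_points f" for d
    using that f less_trans unfolding closure_points_def limit_below_def by blast
  ultimately show ?thesis by blast
qed

text \<open>A diagonal intersection: if each fibre missed the closure points of some
  \<open>F c\<close>, a function bounding all \<open>F c y\<close> with \<open>c\<close> and
  \<open>y\<close> up to x would have a closure point d in \<open>S\<close>. Since
  \<open>g d\<close> is below d, d is closed under \<open>F (g d)\<close>, although it lies in the
  fibre of \<open>g d\<close>.\<close>

lemma Fodor:
  assumes S: "stat S" and g: "\<And>x. x \<in> S \<Longrightarrow> g x < x"
  obtains c where "stat {x \<in> S. g x = c}"
proof (rule ccontr)
  assume "\<not> thesis"
  then have "\<forall>c. \<exists>f. selfmap f \<and> {x \<in> S. g x = c} \<inter> closure_points f = {}"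
    using that S unfolding stat_def by blast
  then obtain F where F: "\<And>c. selfmap (F c)" "\<And>c. {x \<in> S. g x = c} \<inter> closure_points (F c) = {}"
    by metis
  obtain f where f: "selfmap f"
    "\<And>x a. x < w1 \<Longrightarrow> a \<in> (\<lambda>(c, y). F c y) ` ({..x} \<times> {..x}) \<Longrightarrow> a < f x"
  proof (rule selfmap_sup[of "\<lambda>x. (\<lambda>(c, y). F c y) ` ({..x} \<times> {..x})"])
    show "countable ((\<lambda>(c, y). F c y) ` ({..x} \<times> {..x}))" if "x < w1" for x
      using countable_atMost[OF that] by auto
    show "(\<lambda>(c, y). F c y) ` ({..x} \<times> {..x}) \<subseteq> {..<w1}" if "x < w1" for x
      using F(1) that unfolding selfmap_def by auto
  qed blast
  obtain d where d: "d \<in> S" "d \<in> closure_points f" using statD[OF S f(1)] by blast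
  have "F (g d) y < d" if "y < d" for y
  proof -
    have "max (g d) y < d" using g[OF d(1)] that by simp
    then have "max (g d) y < w1" "f (max (g d) y) < d"
      using closure_pointsD[OF d(2)] less_trans by blast+
    then show ?thesis using f(2)[of "max (g d) y" "F (g d) y"] by force
  qed
  then have "d \<in> closure_points (F (g d))" using d(2) unfolding closure_points_def by blast
  then show False using F(2)[of "g d"] d(1) by blast
qed

definition filtration :: "('o \<Rightarrow> 'a set) \<Rightarrow> bool" where
  "filtration A \<longleftrightarrow> (\<forall>x<w1. countable (A x)) \<and> (\<forall>x y. x \<le> y \<and> y < w1 \<longrightarrow> A x \<subseteq> A y) \<and>
     (\<forall>d<w1. limit_below d \<longrightarrow> A d = (\<Union>x<d. A x))"

lemma filtration_image: "filtration (\<lambda>x. e ` {..<x})"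
  unfolding filtration_def
proof (intro conjI allI impI)
  fix d assume "d < w1" "limit_below d"
  then show "e ` {..<d} = (\<Union>x<d. e ` {..<x})"
    unfolding limit_below_def image_UN[symmetric] by (intro arg_cong[where f = "image e"]) auto
qed (use less_w1 in auto)

lemma image_filtration: "filtration A \<Longrightarrow> filtration (\<lambda>x. f ` A x)"
  unfolding filtration_def by (simp add: image_mono flip: image_UN)

lemma filtration_Int: "filtration A \<Longrightarrow> filtration (\<lambda>x. A x \<inter> S)"
  unfolding filtration_def by (auto intro: countable_Int1)

lemma initial_segments_UN: "(\<Union>x<w1. {..<x}) = {..<w1}"
proof (intro equalityI subsetI)
  fix x assume "x \<in> {..<w1}"
  then show "x \<in> (\<Union>x<w1. {..<x})" using max_less_w1[of x x] by auto
qed auto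

lemma filtration_lepoll:
  assumes "filtration A" shows "(\<Union>x<w1. A x) \<lesssim> {..<w1}"
  using assms unfolding filtration_def
  by (intro UN_lepoll_infinite infinite_w1 countable_lepoll_infinite[OF _ infinite_w1] lepoll_refl) auto

text \<open>Regularity of omega1 gives functions by which each filtration catches up with the other.
  At a limit closed under both functions, continuity makes each union absorb the other.\<close>

lemma filtration_agree:
  assumes A: "filtration A" and B: "filtration B"
    and eq: "(\<Union>x<w1. A x) = (\<Union>x<w1. B x)"
  obtains f where "selfmap f" "\<And>d. d \<in> closure_points f \<Longrightarrow> A d = B d"
proof -
  have bound: "\<exists>f. selfmap f \<and> (\<forall>x<w1. A x \<subseteq> B (f x))"
    if "filtration A" "filtration B" "(\<Union>x<w1. A x) = (\<Union>x<w1. B x)"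
    for A B :: "'o \<Rightarrow> 'b set"
  proof -
    have "\<exists>b<w1. A x \<subseteq> B b" if x: "x < w1" for x
    proof -
      have "\<forall>a\<in>A x. \<exists>y<w1. a \<in> B y" using \<open>_ = (\<Union>x<w1. B x)\<close> x by blast
      then obtain h where h: "\<And>a. a \<in> A x \<Longrightarrow> h a < w1 \<and> a \<in> B (h a)" by metis
      have "countable (h ` A x)"
        using \<open>filtration A\<close> x unfolding filtration_def by (intro countable_image) simp
      moreover have "h ` A x \<subseteq> {..<w1}" using h by auto
      ultimately obtain b where "b < w1" "\<And>a. a \<in> h ` A x \<Longrightarrow> a < b"
        using bounded_w1[of "h ` A x"] by blast
      have "a \<in> B b" if "a \<in> A x" for a
      proof -
        have "h a \<le> b" using that \<open>\<And>a. a \<in> h ` A x \<Longrightarrow> a < b\<close> by (simp add: less_imp_le)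
        then have "B (h a) \<subseteq> B b" using \<open>b < w1\<close> \<open>filtration B\<close> unfolding filtration_def by blast
        then show ?thesis using h[OF that] by blast
      qed
      then have "A x \<subseteq> B b" by blast
      then show ?thesis using \<open>b < w1\<close> by blast
    qed
    then show ?thesis unfolding selfmap_def by metis
  qed
  obtain f where f: "selfmap f" "\<And>x. x < w1 \<Longrightarrow> A x \<subseteq> B (f x)"
    using bound[OF A B eq] by auto
  obtain g where g: "selfmap g" "\<And>x. x < w1 \<Longrightarrow> B x \<subseteq> A (g x)"
    using bound[OF B A eq[symmetric]] by auto
  obtain l where l: "selfmap l" "\<And>d. d \<in> closure_points l \<Longrightarrow> limit_below d"
    using selfmap_limit by blast
  have sub: "A' d \<subseteq> B' d"
    if "filtration A'" "filtration B'" "\<And>x. x < w1 \<Longrightarrow> A' x \<subseteq> B' (f' x)"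
      and d: "d \<in> closure_points f'" "d \<in> closure_points l" for A' B' :: "'o \<Rightarrow> 'a set" and f' d
  proof -
    have "d < w1" "limit_below d" using d l(2) unfolding closure_points_def by auto
    then have "A' d = (\<Union>x<d. A' x)" "B' d = (\<Union>x<d. B' x)"
      using that(1,2) unfolding filtration_def by auto
    moreover have "A' x \<subseteq> (\<Union>x<d. B' x)" if "x < d" for x
    proof -
      have "f' x \<in> {..<d}" "x < w1" using d \<open>x < d\<close> unfolding closure_points_def by auto
      then show ?thesis using \<open>\<And>x. x < w1 \<Longrightarrow> A' x \<subseteq> B' (f' x)\<close>[of x] by fast
    qed
    ultimately show ?thesis by (metis (no_types, lifting) UN_least lessThan_iff)
  qed
  have "A d = B d" if "d \<in> closure_points f \<inter> closure_points g \<inter> closure_points l" for d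
    using sub[of A B f d] sub[of B A g d] A B f(2) g(2) that by (intro subset_antisym) simp_all
  then show ?thesis
    using that[of "\<lambda>x. max (max (f x) (g x)) (l x)"] selfmap_combine f(1) g(1) l(1) by auto
qed

lemma stat_Int_closure_points:
  assumes "stat S" "selfmap f" shows "stat (S \<inter> closure_points f)"
  unfolding stat_def
proof (intro conjI allI impI)
  show "S \<inter> closure_points f \<subseteq> {..<w1}" using assms unfolding stat_def by blast
  fix g assume "selfmap g"
  then show "S \<inter> closure_points f \<inter> closure_points g \<noteq> {}"
    using statD[OF assms(1) selfmap_combine(1)[OF assms(2)]] selfmap_combine(2)[OF assms(2)]
    by fastforce
qed

lemma stat_mono: "stat S \<Longrightarrow> S \<subseteq> T \<Longrightarrow> T \<subseteq> {..<w1} \<Longrightarrow> stat T"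
  unfolding stat_def by blast

lemma stat_unbounded:
  assumes "stat S" "a < w1" obtains d where "d \<in> S" "a < d"
proof -
  obtain d where "d \<in> S \<inter> closure_points (\<lambda>_. a)"
    using statD[OF assms(1), of "\<lambda>_. a"] assms(2) unfolding selfmap_def by blast
  then show ?thesis using that[of d] unfolding closure_points_def by blast
qed

end

text \<open>Later \<open>Q\<close> is H_omega2 and \<open>emb\<close> the inclusion of the ordinals.
  The maps \<open>e b\<close> are fixed surjections from omega1 onto b; the premise x < b excludes
  the empty b, which is no image of omega1.\<close>

locale omega_1_2_coding = omega_1_2 w1 w2 for w1 w2 :: "'o::wellorder" +
  fixes emb :: "'o \<Rightarrow> 'q" and Q :: "'q set" and e :: "'o \<Rightarrow> 'o \<Rightarrow> 'o"
  assumes inj_emb: "inj emb" and emb_subset: "emb ` {..<w2} \<subseteq> Q"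
    and e_image: "\<lbrakk>x < b; b < w2\<rbrakk> \<Longrightarrow> e b ` {..<w1} = {..<b}"
begin

definition trace :: "'q set \<Rightarrow> 'o set" where
  "trace X = {a. a < w2 \<and> emb a \<in> X}"

lemma trace_mono: "X \<subseteq> Y \<Longrightarrow> trace X \<subseteq> trace Y"
  unfolding trace_def by blast

lemma trace_UN: "trace (\<Union>i\<in>I. X i) = (\<Union>i\<in>I. trace (X i))"
  unfolding trace_def by blast

lemma countable_trace: "countable X \<Longrightarrow> countable (trace X)"
proof -
  assume "countable X"
  then have "countable (emb ` trace X)"
    by (rule countable_subset[rotated]) (auto simp: trace_def)
  then show ?thesis by (rule countable_image_inj_on) (rule inj_on_subset[OF inj_emb subset_UNIV])
qed

definition e_inv :: "'o \<Rightarrow> 'o \<Rightarrow> 'o" where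
  "e_inv b x = (SOME c. c < w1 \<and> e b c = x)"

lemma e_inv: "\<lbrakk>x < b; b < w2\<rbrakk> \<Longrightarrow> e_inv b x < w1 \<and> e b (e_inv b x) = x"
proof -
  assume *: "x < b" "b < w2"
  then have "x \<in> e b ` {..<w1}" unfolding e_image[OF *] by simp
  then have "\<exists>c. c < w1 \<and> e b c = x" by auto
  then show ?thesis unfolding e_inv_def by (rule someI_ex)
qed

lemma e_less: "\<lbrakk>x < b; b < w2; c < w1\<rbrakk> \<Longrightarrow> e b c < b"
  using e_image[of x b] by blast

text \<open>Closure under all \<open>e b\<close> and under chosen preimages, as an elementary
  submodel containing \<open>e\<close> would have it.\<close>

definition e_op :: "'q set \<Rightarrow> 'q set" where
  "e_op s = (\<lambda>(b, c). emb (e b c)) ` {(b, c). (\<exists>x. x < b) \<and> b < w2 \<and> c < w1 \<and> emb b \<in> s \<and> emb c \<in> s} \<union>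
     (\<lambda>(b, x). emb (e_inv b x)) ` {(b, x). x < b \<and> b < w2 \<and> emb b \<in> s \<and> emb x \<in> s}"

lemma countable_e_op: "finite s \<Longrightarrow> countable (e_op s)"
proof -
  assume "finite s"
  then have "finite (emb -` s \<times> emb -` s)" using finite_vimageI[OF _ inj_emb] by blast
  moreover have "{(b, c). (\<exists>x. x < b) \<and> b < w2 \<and> c < w1 \<and> emb b \<in> s \<and> emb c \<in> s} \<subseteq> emb -` s \<times> emb -` s"
    "{(b, x). x < b \<and> b < w2 \<and> emb b \<in> s \<and> emb x \<in> s} \<subseteq> emb -` s \<times> emb -` s" by auto
  ultimately have "finite (e_op s)" unfolding e_op_def by (meson finite_UnI finite_imageI finite_subset)
  then show ?thesis by (rule countable_finite)
qed

lemma e_op_subset: "e_op s \<subseteq> Q"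
proof -
  have "emb (e b c) \<in> Q" if "x < b" "b < w2" "c < w1" for b c x
    using emb_subset e_less[OF that] that(2) by (auto intro: less_trans)
  moreover have "emb (e_inv b x) \<in> Q" if "x < b" "b < w2" for b x
    using emb_subset e_inv[OF that] w1_less_w2 by (auto intro: less_trans)
  ultimately show ?thesis unfolding e_op_def by auto
qed

lemma closed_e_op:
  assumes "closed_under e_op X" "b \<in> trace X"
  shows "\<lbrakk>x < b; c < w1; c \<in> trace X\<rbrakk> \<Longrightarrow> e b c \<in> trace X"
    and "\<lbrakk>x < b; x \<in> trace X\<rbrakk> \<Longrightarrow> e_inv b x \<in> trace X"
proof -
  have *: "e_op {emb b, emb y} \<subseteq> X" if "y \<in> trace X" for y
    using assms that assms(1)[unfolded closed_under_def, rule_format, of "{emb b, emb y}"]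
    unfolding trace_def by simp
  have "b < w2" using assms(2) unfolding trace_def by blast
  { assume h: "x < b" "c < w1" "c \<in> trace X"
    have "emb (e b c) \<in> e_op {emb b, emb c}"
      unfolding e_op_def using h \<open>b < w2\<close> by force
    then show "e b c \<in> trace X"
      using *[OF h(3)] e_less[OF h(1) \<open>b < w2\<close> h(2)] \<open>b < w2\<close> unfolding trace_def by auto }
  { assume h: "x < b" "x \<in> trace X"
    have "emb (e_inv b x) \<in> e_op {emb b, emb x}"
      unfolding e_op_def using h \<open>b < w2\<close> by force
    then show "e_inv b x \<in> trace X"
      using *[OF h(2)] e_inv[OF h(1) \<open>b < w2\<close>] w1_less_w2 unfolding trace_def by auto }
qed

text \<open>Closure under \<open>e\<close> and its inverse lets a set containing b be recovered
  below b from its trace on omega1 alone. This is why hulls with the same trace on omega1 end-extend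
  each other below common members.\<close>

lemma trace_below_iff:
  assumes "closed_under e_op X" "trace X \<inter> {..<w1} = {..<d}" "b \<in> trace X" "x < b"
  shows "x \<in> trace X \<longleftrightarrow> x \<in> e b ` {..<d}"
proof
  have b: "b < w2" using assms(3) unfolding trace_def by blast
  { assume "x \<in> trace X"
    then have "e_inv b x \<in> trace X \<inter> {..<w1}"
      using closed_e_op(2)[OF assms(1,3,4)] e_inv[OF assms(4) b] by blast
    then show "x \<in> e b ` {..<d}" using e_inv[OF assms(4) b] assms(2) by force }
  { assume "x \<in> e b ` {..<d}"
    then show "x \<in> trace X" using closed_e_op(1)[OF assms(1,3,4)] assms(2) by blast }
qed

text \<open>The hulls over \<open>{..x}\<close> and \<open>B\<close> grow with x, and each has a
  countable, hence bounded, trace on omega1. At a closure point d of the bounding function no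
  countable ordinal from d on has entered.\<close>

lemma hull_trace_closure_points:
  assumes G: "\<And>s. finite s \<Longrightarrow> countable (G s)" and B: "countable B"
  obtains f where "selfmap f"
    "\<And>d. d \<in> closure_points f \<Longrightarrow> trace (hull_under G (emb ` {..<d} \<union> B)) \<inter> {..<w1} = {..<d}"
proof -
  define H where "H x = hull_under G (emb ` {..x} \<union> B)" for x
  have "countable (trace (H x) \<inter> {..<w1})" if "x < w1" for x
    unfolding H_def using countable_atMost[OF that] B G
    by (intro countable_Int1 countable_trace countable_hull_under) auto
  then obtain f where f: "selfmap f" "\<And>x a. x < w1 \<Longrightarrow> a \<in> trace (H x) \<inter> {..<w1} \<Longrightarrow> a < f x"
    using selfmap_sup[of "\<lambda>x. trace (H x) \<inter> {..<w1}"] by (metis Int_lower2)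
  have sub: "emb ` {..x} \<union> B \<subseteq> H x" for x unfolding H_def by (rule subset_hull_under)
  have "trace (hull_under G (emb ` {..<d} \<union> B)) \<inter> {..<w1} = {..<d}" if d: "d \<in> closure_points f" for d
  proof
    have "d < w1" "\<exists>x. x < d" using d unfolding closure_points_def by auto
    have "mono_on {..<d} H"
      unfolding H_def by (intro mono_onI hull_under_mono) auto
    moreover have "closed_under G (H x)" for x unfolding H_def by (rule closed_hull_under)
    ultimately have "closed_under G (\<Union>x<d. H x)"
      using \<open>\<exists>x. x < d\<close> by (intro closed_under_UN_mono) auto
    moreover have "emb ` {..<d} \<union> B \<subseteq> (\<Union>x<d. H x)"
      using sub \<open>\<exists>x. x < d\<close> by fastforce
    ultimately have "hull_under G (emb ` {..<d} \<union> B) \<subseteq> (\<Union>x<d. H x)" by (rule hull_under_least[rotated])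
    then have "trace (hull_under G (emb ` {..<d} \<union> B)) \<subseteq> (\<Union>x<d. trace (H x))"
      using trace_mono trace_UN by metis
    moreover have "a < d" if "x < d" "a \<in> trace (H x)" "a < w1" for a x
      using f(2)[of x a] closure_pointsD[OF d] that \<open>d < w1\<close> by (meson IntI less_trans lessThan_iff)
    ultimately show "trace (hull_under G (emb ` {..<d} \<union> B)) \<inter> {..<w1} \<subseteq> {..<d}" by blast
    show "{..<d} \<subseteq> trace (hull_under G (emb ` {..<d} \<union> B)) \<inter> {..<w1}"
      using subset_hull_under[of "emb ` {..<d} \<union> B" G] \<open>d < w1\<close> w1_less_w2
      unfolding trace_def by fastforce
  qed
  then show ?thesis using that f(1) by blast
qed

end

subsection \<open>A game on countable hulls\<close>

locale hull_game = omega_1_2_coding w1 w2 emb Q e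
  for w1 w2 :: "'o::wellorder" and emb :: "'o \<Rightarrow> 'q" and Q e +
  fixes G :: "'q set \<Rightarrow> 'q set"
  assumes countable_G: "finite s \<Longrightarrow> countable (G s)" and G_subset: "G s \<subseteq> Q"
    and e_op_le_G: "e_op s \<subseteq> G s"
begin

lemma closed_G_imp_e_op: "closed_under G X \<Longrightarrow> closed_under e_op X"
  using e_op_le_G unfolding closed_under_def by blast

definition hull :: "'o \<Rightarrow> 'o list \<Rightarrow> 'q set" where
  "hull d s = hull_under G (emb ` {..<d} \<union> emb ` set s)"

definition stable :: "'o \<Rightarrow> 'o list \<Rightarrow> bool" where
  "stable d s \<longleftrightarrow> trace (hull d s) \<inter> {..<w1} = {..<d}"

lemma closed_hull: "closed_under G (hull d s)"
  unfolding hull_def by (rule closed_hull_under)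

lemma hull_mono: "set s \<subseteq> set t \<Longrightarrow> hull d s \<subseteq> hull d t"
  unfolding hull_def by (intro hull_under_mono) auto

lemma countable_hull: "d < w1 \<Longrightarrow> countable (hull d s)"
  unfolding hull_def using less_w1 countable_G by (intro countable_hull_under) (auto intro: countable_finite)

lemma hull_subset: "d < w1 \<Longrightarrow> set s \<subseteq> {..<w2} \<Longrightarrow> hull d s \<subseteq> Q"
  unfolding hull_def using emb_subset w1_less_w2 G_subset
  by (intro hull_under_least) (force simp: closed_under_def)+

lemma mem_trace_hull: "b \<in> set s \<Longrightarrow> b < w2 \<Longrightarrow> b \<in> trace (hull d s)"
  unfolding trace_def hull_def using subset_hull_under[of "emb ` {..<d} \<union> emb ` set s" G] by blast

text \<open>Player I tries to destroy stability by forcing the moves of player II to be large; a position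
  is good when I has no winning strategy.\<close>

definition beats :: "('o list \<Rightarrow> 'o) \<Rightarrow> 'o list \<Rightarrow> (nat \<Rightarrow> 'o) \<Rightarrow> bool" where
  "beats \<sigma> s b \<longleftrightarrow> map b [0..<length s] = s \<and> (\<forall>n\<ge>length s. b n < w2 \<and> \<sigma> (map b [0..<n]) < b n)"

definition good :: "'o \<Rightarrow> 'o list \<Rightarrow> bool" where
  "good d s \<longleftrightarrow> (\<forall>\<sigma>. (\<forall>t. \<sigma> t < w2) \<longrightarrow>
     (\<exists>b. beats \<sigma> s b \<and> (\<forall>n\<ge>length s. stable d (map b [0..<n]))))"

lemma good_imp_stable: "good d s \<Longrightarrow> stable d s"
proof -
  assume "good d s"
  then have "\<exists>b. beats (\<lambda>_. w1) s b \<and> (\<forall>n\<ge>length s. stable d (map b [0..<n]))"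
    using w1_less_w2 unfolding good_def by simp
  then show ?thesis unfolding beats_def by (metis order_refl)
qed

text \<open>If every high move led to a position won by player I, player I could win from
  \<open>s\<close> itself by first demanding a move above \<open>z\<close> and then following the
  strategy belonging to the move made.\<close>

lemma good_extend:
  assumes "good d s" "z < w2"
  shows "\<exists>b. z < b \<and> b < w2 \<and> good d (s @ [b])"
proof (rule ccontr)
  assume "\<not> ?thesis"
  then have "\<forall>b. \<exists>\<sigma>. z < b \<and> b < w2 \<longrightarrow> (\<forall>t. \<sigma> t < w2) \<and>
      (\<forall>c. beats \<sigma> (s @ [b]) c \<longrightarrow> (\<exists>n\<ge>length (s @ [b]). \<not> stable d (map c [0..<n])))"
    unfolding good_def by meson
  then obtain F where F: "\<And>b t. z < b \<Longrightarrow> b < w2 \<Longrightarrow> F b t < w2"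
    "\<And>b c. z < b \<Longrightarrow> b < w2 \<Longrightarrow> beats (F b) (s @ [b]) c \<Longrightarrow>
       \<exists>n\<ge>length (s @ [b]). \<not> stable d (map c [0..<n])"
    by metis
  \<comment> \<open>At \<open>s\<close> the demand is \<open>z\<close>; after a move above
    \<open>z\<close> the strategy \<open>F\<close> for that move takes over. Everywhere else
    \<open>z\<close> is a default value below \<open>w2\<close>.\<close>
  define \<sigma> where "\<sigma> t = (if length s < length t \<and> z < t ! length s \<and> t ! length s < w2
    then F (t ! length s) t else z)" for t
  have "\<sigma> t < w2" for t using F(1) assms(2) unfolding \<sigma>_def by auto
  then obtain c where c: "beats \<sigma> s c" "\<And>n. n \<ge> length s \<Longrightarrow> stable d (map c [0..<n])"
    using assms(1) unfolding good_def by blast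
  define b where "b = c (length s)"
  have "\<sigma> (map c [0..<length s]) = z" unfolding \<sigma>_def by simp
  then have b: "z < b" "b < w2" using c(1) unfolding beats_def b_def by (metis order_refl)+
  have "beats (F b) (s @ [b]) c"
    unfolding beats_def
  proof (intro conjI allI impI)
    show "map c [0..<length (s @ [b])] = s @ [b]" using c(1) unfolding beats_def b_def by simp
    fix n assume n: "length (s @ [b]) \<le> n"
    then show "c n < w2" using c(1) unfolding beats_def by simp
    have "\<sigma> (map c [0..<n]) = F b (map c [0..<n])"
      using n b unfolding \<sigma>_def b_def by simp
    then show "F b (map c [0..<n]) < c n" using c(1) n unfolding beats_def by (metis Suc_leD length_append_singleton)
  qed
  then show False using F(2)[OF b] c(2) by fastforce
qed

text \<open>Suppose player I wins for every d in \<open>S\<close>. As there are at most omega1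
  strategies, their demands at each position have an upper bound below \<open>w2\<close>, so one
  sequence of moves beats all of them at once. The hull over d and this sequence has trace d for
  club many d, hence for some d in \<open>S\<close>, and then player I has lost.\<close>

lemma good_Nil:
  assumes S: "stat S" shows "\<exists>d\<in>S. good d []"
proof (rule ccontr)
  assume "\<not> ?thesis"
  then have "\<forall>d\<in>S. \<exists>\<sigma>. (\<forall>t. \<sigma> t < w2) \<and> (\<forall>b. beats \<sigma> [] b \<longrightarrow> (\<exists>n. \<not> stable d (map b [0..<n])))"
    unfolding good_def by fastforce
  then obtain F where F: "\<And>d t. d \<in> S \<Longrightarrow> F d t < w2"
    "\<And>d b. d \<in> S \<Longrightarrow> beats (F d) [] b \<Longrightarrow> \<exists>n. \<not> stable d (map b [0..<n])" by metis
  have "\<exists>b<w2. \<forall>d\<in>S. F d t < b" for t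
  proof -
    have "S \<lesssim> {..<w1}" using S unfolding stat_def by (auto intro: subset_imp_lepoll)
    then have "(\<lambda>d. F d t) ` S \<lesssim> {..<w1}" using image_lepoll lepoll_trans by blast
    then show ?thesis using bounded_w2[of "(\<lambda>d. F d t) ` S"] F(1) by auto
  qed
  then obtain u where u: "\<And>t. u t < w2" "\<And>t d. d \<in> S \<Longrightarrow> F d t < u t" by metis
  define l where "l = rec_nat [] (\<lambda>_ t. t @ [u t])"
  define b where "b n = u (l n)" for n
  have l: "l n = map b [0..<n]" for n
    by (induction n) (simp_all add: l_def b_def)
  have beats: "beats (F d) [] b" if "d \<in> S" for d
    using u that unfolding beats_def by (simp add: b_def l)
  have "countable (emb ` range b)" by simp
  then obtain f where f: "selfmap f" "\<And>d. d \<in> closure_points f \<Longrightarrow>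
      trace (hull_under G (emb ` {..<d} \<union> emb ` range b)) \<inter> {..<w1} = {..<d}"
    using hull_trace_closure_points[of G] countable_G by metis
  obtain d where d: "d \<in> S" "d \<in> closure_points f" using statD[OF S f(1)] by blast
  have "stable d (map b [0..<n])" for n
  proof -
    have "hull d (map b [0..<n]) \<subseteq> hull_under G (emb ` {..<d} \<union> emb ` range b)"
      unfolding hull_def by (intro hull_under_mono) auto
    then have "trace (hull d (map b [0..<n])) \<inter> {..<w1} \<subseteq> {..<d}"
      using f(2)[OF d(2)] trace_mono by blast
    moreover have "{..<d} \<subseteq> trace (hull d (map b [0..<n])) \<inter> {..<w1}"
      using subset_hull_under[of "emb ` {..<d} \<union> emb ` set (map b [0..<n])" G]
        closure_pointsD(1)[OF d(2)] w1_less_w2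
      unfolding trace_def hull_def by fastforce
    ultimately show ?thesis unfolding stable_def by blast
  qed
  then show False using F(2)[OF d(1) beats[OF d(1)]] by blast
qed

text \<open>Above the threshold \<open>h\<close> player II can jump over any interval without adding
  points of it to the hull and without leaving the good positions. The skipped intervals are free
  for the other sets built at the same time.\<close>

definition gap :: "'o \<Rightarrow> 'o list \<Rightarrow> 'o \<Rightarrow> bool" where
  "gap d s h \<longleftrightarrow> (\<forall>z<w2. \<exists>b. z \<le> b \<and> b < w2 \<and> good d (s @ [b]) \<and> trace (hull d (s @ [b])) \<inter> {h..<z} = {})"

lemma gap_mono: "gap d s h \<Longrightarrow> h \<le> h' \<Longrightarrow> gap d s h'"
  unfolding gap_def by (meson atLeastLessThan_subset_iff disjoint_iff order_refl order_trans atLeastLessThan_iff)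

text \<open>Otherwise every large successor hull would meet \<open>\<omega>\<^sub>1\<close> many disjoint intervals.\<close>

lemma gap_exists:
  assumes "good d s" "d < w1" shows "\<exists>h<w2. gap d s h"
proof (rule ccontr)
  assume "\<not> ?thesis"
  then have "\<forall>h. \<exists>z. h < w2 \<longrightarrow> z < w2 \<and>
    (\<forall>b. z \<le> b \<and> b < w2 \<and> good d (s @ [b]) \<longrightarrow> trace (hull d (s @ [b])) \<inter> {h..<z} \<noteq> {})"
    unfolding gap_def by meson
  then obtain g where g: "\<And>h. h < w2 \<Longrightarrow> g h < w2"
    "\<And>h b. h < w2 \<Longrightarrow> g h \<le> b \<Longrightarrow> b < w2 \<Longrightarrow> good d (s @ [b]) \<Longrightarrow>
       trace (hull d (s @ [b])) \<inter> {h..<g h} \<noteq> {}" by metis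
  \<comment> \<open>The values \<open>f x\<close> are left endpoints so sparse that the omega1 many
    intervals from \<open>f x\<close> to \<open>g (f x)\<close> are disjoint. A good move above all
    of them would have a hull with a point in each, hence an uncountable trace.\<close>
  define P where "P f x v \<longleftrightarrow> (x < w1 \<longrightarrow> v < w2 \<and> (\<forall>y<x. g (f y) < v))" for f :: "'o \<Rightarrow> 'o" and x v
  have "\<exists>f. \<forall>x. P f x (f x)"
  proof (rule dependent_wf_choice[OF wf])
    show "P f x v = P f' x v" if "\<And>z. (z, x) \<in> {(x, y). x < y} \<Longrightarrow> f z = f' z" for f f' x v
      using that unfolding P_def by auto
    fix x f assume IH: "\<And>y. (y, x) \<in> {(x, y). x < y} \<Longrightarrow> P f y (f y)"
    show "\<exists>v. P f x v"
    proof (cases "x < w1")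
      case True
      then have "(\<lambda>y. g (f y)) ` {..<x} \<subseteq> {..<w2}"
        using IH g(1) less_trans unfolding P_def by fastforce
      then show ?thesis using bounded_w2_countable[of "(\<lambda>y. g (f y)) ` {..<x}"] True less_w1
        unfolding P_def by auto
    qed (simp add: P_def)
  qed
  then obtain f where f: "\<And>x. x < w1 \<Longrightarrow> f x < w2" "\<And>x y. x < w1 \<Longrightarrow> y < x \<Longrightarrow> g (f y) < f x"
    unfolding P_def by blast
  have "(\<lambda>x. g (f x)) ` {..<w1} \<subseteq> {..<w2}" using f(1) g(1) by auto
  then obtain z where z: "z < w2" "\<And>x. x < w1 \<Longrightarrow> g (f x) < z"
    using bounded_w2[OF image_lepoll, of "\<lambda>x. g (f x)"] by auto
  obtain b where b: "z < b" "b < w2" "good d (s @ [b])" using good_extend[OF assms(1) z(1)] by blast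
  define X where "X = trace (hull d (s @ [b]))"
  have "\<exists>p. p \<in> X \<and> f x \<le> p \<and> p < g (f x)" if "x < w1" for x
    using g(2)[OF f(1)[OF that] _ b(2,3)] z(2)[OF that] b(1) unfolding X_def by fastforce
  then obtain p where p: "\<And>x. x < w1 \<Longrightarrow> p x \<in> X \<and> f x \<le> p x \<and> p x < g (f x)" by metis
  have "p x < p y" if "y < w1" "x < y" for x y
    using p[of x] p[of y] f(2)[OF that] that by (meson less_trans less_le_trans)
  then have "inj_on p {..<w1}" by (intro linorder_inj_onI) force+
  moreover have "countable X" unfolding X_def by (intro countable_trace countable_hull assms)
  ultimately show False
    using p uncountable_w1 by (meson countable_image_inj_on countable_subset image_subsetI lessThan_iff)
qed

end

section \<open>Countable sets whose traces occupy prescribed disjoint blocks\<close>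

context hull_game begin

text \<open>The bound \<open>z'\<close> is taken above the move, above the whole new trace and above
  a gap threshold of the new position, so that it can be both the end of the block and the next
  threshold.\<close>

lemma game_step:
  assumes "z < w2" "d < w1" and st: "\<And>j. set (st j) \<subseteq> {..<w2}" "\<And>j. gap d (st j) (h j)"
  shows "\<exists>b z'. z \<le> b \<and> b < z' \<and> z' < w2 \<and> good d (st i @ [b]) \<and> gap d (st i @ [b]) z' \<and>
    trace (hull d (st i @ [b])) \<inter> {h i..<z} = {} \<and> trace (hull d (st i @ [b])) \<subseteq> {..<z'}"
proof -
  obtain b where b: "z \<le> b" "b < w2" "good d (st i @ [b])"
    "trace (hull d (st i @ [b])) \<inter> {h i..<z} = {}"
    using st(2)[of i] \<open>z < w2\<close> unfolding gap_def by meson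
  obtain h' where h': "h' < w2" "gap d (st i @ [b]) h'" using gap_exists[OF b(3) \<open>d < w1\<close>] by blast
  have "countable (insert h' (insert b (trace (hull d (st i @ [b])))))"
    using \<open>d < w1\<close> by (intro countable_insert countable_trace countable_hull)
  moreover have "insert h' (insert b (trace (hull d (st i @ [b])))) \<subseteq> {..<w2}"
    using b h' unfolding trace_def by auto
  ultimately obtain z' where z': "z' < w2" "\<forall>a\<in>insert h' (insert b (trace (hull d (st i @ [b])))). a < z'"
    using bounded_w2_countable by blast
  then have "gap d (st i @ [b]) z'" using gap_mono[OF h'(2), of z'] by (simp add: less_imp_le)
  then show ?thesis using b z' by blast
qed

text \<open>\<open>c\<close> names the set that owns the block from \<open>z k\<close> to
  \<open>z (Suc k)\<close>. The last clause excludes points of the traces above the supremum of the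
  \<open>z k\<close>.\<close>

definition interleaved :: "'o \<Rightarrow> (nat \<Rightarrow> nat) \<Rightarrow> (nat \<Rightarrow> 'q set) \<Rightarrow> (nat \<Rightarrow> 'o) \<Rightarrow> bool" where
  "interleaved d c X z \<longleftrightarrow> strict_mono z \<and> (\<forall>k. z k < w2) \<and>
    (\<forall>j. closed_under G (X j) \<and> X j \<in> ctbl_subsets Q \<and> trace (X j) \<inter> {..<w1} = {..<d}) \<and>
    (\<forall>j k. trace (X j) \<inter> {z k..<z (Suc k)} \<noteq> {} \<longleftrightarrow> c k = j) \<and>
    (\<forall>j. \<forall>x\<in>trace (X j). z 0 \<le> x \<longrightarrow> (\<exists>k. z k \<le> x \<and> x < z (Suc k)))"

text \<open>The sets are built by prolonging one good position at a time. The gap below a new move \<open>b\<close>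
  persists, because a closed set containing \<open>b\<close> is determined below \<open>b\<close> by its trace on \<open>w1\<close>.\<close>

lemma interleaved_sets:
  fixes c :: "nat \<Rightarrow> nat"
  assumes d: "good d []" "d < w1"
  shows "\<exists>X z. interleaved d c X z"
proof -
  \<comment> \<open>A state consists of the positions \<open>st j\<close>, their thresholds
    \<open>h j\<close> and the end \<open>z\<close> of the last block. Step k prolongs only the
    position with index \<open>c k\<close> and moves its threshold to the new end.\<close>
  define P where "P t \<longleftrightarrow> (case t of (st, h, z) \<Rightarrow> z < w2 \<and> (\<forall>j. set (st j) \<subseteq> {..<w2} \<and> good d (st j) \<and>
    gap d (st j) (h j) \<and> h j \<le> z \<and> trace (hull d (st j)) \<subseteq> {..<h j}))"
    for t :: "(nat \<Rightarrow> 'o list) \<times> (nat \<Rightarrow> 'o) \<times> 'o"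
  define R where "R k t t' \<longleftrightarrow> (case t of (st, h, z) \<Rightarrow> case t' of (st', h', z') \<Rightarrow>
    \<exists>b. z \<le> b \<and> b < z' \<and> st' = st(c k := st (c k) @ [b]) \<and> h' = h(c k := z') \<and>
      trace (hull d (st (c k) @ [b])) \<inter> {h (c k)..<z} = {})"
    for k and t t' :: "(nat \<Rightarrow> 'o list) \<times> (nat \<Rightarrow> 'o) \<times> 'o"
  have "\<exists>f. \<forall>k. P (f k) \<and> R k (f k) (f (Suc k))"
  proof (rule dependent_nat_choice)
    obtain h where h: "h < w2" "gap d [] h" using gap_exists[OF d] by blast
    have "countable (insert h (trace (hull d [])))"
      using d by (intro countable_insert countable_trace countable_hull)
    moreover have "insert h (trace (hull d [])) \<subseteq> {..<w2}"
      using h by (auto simp: trace_def)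
    ultimately obtain z where "z < w2" "\<forall>a\<in>insert h (trace (hull d [])). a < z"
      using bounded_w2_countable by blast
    then have "P (\<lambda>_. [], \<lambda>_. z, z)"
      using gap_mono[OF h(2), of z] d unfolding P_def by auto
    then show "\<exists>t. P t" by blast
    fix t k assume "P t"
    then obtain st h z where t: "t = (st, h, z)" and P: "z < w2" "\<And>j. set (st j) \<subseteq> {..<w2}"
      "\<And>j. good d (st j)" "\<And>j. gap d (st j) (h j)" "\<And>j. h j \<le> z"
      "\<And>j. trace (hull d (st j)) \<subseteq> {..<h j}" unfolding P_def by (cases t) auto
    obtain b z' where b: "z \<le> b" "b < z'" "z' < w2" "good d (st (c k) @ [b])" "gap d (st (c k) @ [b]) z'"
      "trace (hull d (st (c k) @ [b])) \<inter> {h (c k)..<z} = {}" "trace (hull d (st (c k) @ [b])) \<subseteq> {..<z'}"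
      using game_step[where st = st and h = h and i = "c k", OF P(1) d(2) P(2,4)] by blast
    have "h j \<le> z'" for j using P(5)[of j] b(1,2) by order
    then have "P (st(c k := st (c k) @ [b]), h(c k := z'), z')"
      unfolding P_def using P b by auto
    moreover have "R k t (st(c k := st (c k) @ [b]), h(c k := z'), z')"
      unfolding R_def t using b by auto
    ultimately show "\<exists>t'. P t' \<and> R k t t'" by blast
  qed
  then obtain f where f: "\<And>k. P (f k)" "\<And>k. R k (f k) (f (Suc k))" by blast
  define st where "st k = fst (f k)" for k
  define h where "h k = fst (snd (f k))" for k
  define z where "z k = snd (snd (f k))" for k
  have fk: "f k = (st k, h k, z k)" for k unfolding st_def h_def z_def by simp
  have zw2: "z k < w2" and st: "set (st k j) \<subseteq> {..<w2}" and gd: "good d (st k j)"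
    and hz: "h k j \<le> z k" and trh: "trace (hull d (st k j)) \<subseteq> {..<h k j}" for k j
    using f(1)[of k] unfolding P_def fk by auto
  from f(2) have "\<forall>k. \<exists>b. z k \<le> b \<and> b < z (Suc k) \<and> st (Suc k) = (st k)(c k := st k (c k) @ [b]) \<and>
      h (Suc k) = (h k)(c k := z (Suc k)) \<and> trace (hull d (st k (c k) @ [b])) \<inter> {h k (c k)..<z k} = {}"
    unfolding R_def fk prod.case ..
  from choice[OF this] obtain b where bk: "\<forall>k. z k \<le> b k \<and> b k < z (Suc k) \<and>
      st (Suc k) = (st k)(c k := st k (c k) @ [b k]) \<and> h (Suc k) = (h k)(c k := z (Suc k)) \<and>
      trace (hull d (st k (c k) @ [b k])) \<inter> {h k (c k)..<z k} = {}" by (rule exE)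
  have b: "z k \<le> b k" "b k < z (Suc k)"
    "st (Suc k) = (st k)(c k := st k (c k) @ [b k])" "h (Suc k) = (h k)(c k := z (Suc k))"
    "trace (hull d (st k (c k) @ [b k])) \<inter> {h k (c k)..<z k} = {}" for k using bk by simp_all
  define T where "T k j = trace (hull d (st k j))" for k j
  have mono_st: "set (st k j) \<subseteq> set (st (Suc k) j)" for k j by (subst b(3)) auto
  have b_mem: "b k \<in> T (Suc k) (c k)" for k
  proof -
    have "b k \<in> set (st (Suc k) (c k))" by (subst b(3)) simp
    then show ?thesis unfolding T_def using st[of "Suc k" "c k"] by (intro mem_trace_hull) auto
  qed
  have mono_T: "T k j \<subseteq> T m j" if "k \<le> m" for k m j
  proof -
    have "T n j \<subseteq> T (Suc n) j" for n unfolding T_def by (rule trace_mono[OF hull_mono[OF mono_st]])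
    then show ?thesis using that by (rule lift_Suc_mono_le)
  qed
  have zmono: "strict_mono z" unfolding strict_mono_Suc_iff using b(1,2) le_less_trans by blast
  have endext: "x \<in> T k j" if "y \<in> T k j" "x \<in> T m j" "x < y" "k \<le> m" for x y k m j
  proof -
    have ce: "closed_under e_op (hull d s)" for s using closed_hull closed_G_imp_e_op by blast
    have sb: "trace (hull d (st k j)) \<inter> {..<w1} = {..<d}" for k j
      using good_imp_stable[OF gd] unfolding stable_def by blast
    have "y \<in> T m j" using mono_T that by blast
    then show ?thesis
      using trace_below_iff[OF ce sb, of y k j x] trace_below_iff[OF ce sb, of y m j x] that
      unfolding T_def by blast
  qed
  have hk: "h k j = h 0 j \<or> (\<exists>m<k. c m = j \<and> h k j = z (Suc m))" for k j
  proof (induction k)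
    case (Suc k)
    then show ?case using b(4)[of k] by (cases "c k = j") (auto simp: less_Suc_eq)
  qed simp
  \<comment> \<open>A point of a prolonged hull below block k lies, by the gap, below the threshold
    set at an earlier turn m of the same index. It is then in block m or below the move
    \<open>b m\<close>; in the second case \<open>endext\<close> shows that it was present
    before.\<close>
  have blocks: "\<exists>m<k. c m = j \<and> z m \<le> x \<and> x < z (Suc m)" if "x \<in> T k j" "z 0 \<le> x" for x k j
    using that
  proof (induction k)
    case 0
    then show ?case using trh[of 0 j] hz[of 0 j] unfolding T_def by fastforce
  next
    case (Suc k)
    show ?case
    proof (cases "c k = j")
      case False
      then have "T (Suc k) j = T k j" unfolding T_def using b(3)[of k] by simp
      then show ?thesis using Suc less_Suc_eq by metis
    next
      case True
      have "x < z (Suc k)" using trh[of "Suc k" j] hz[of "Suc k" j] Suc.prems unfolding T_def by fastforce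
      show ?thesis
      proof (cases "z k \<le> x")
        case True then show ?thesis using \<open>c k = j\<close> \<open>x < z (Suc k)\<close> by blast
      next
        case False
        have "T (Suc k) j = trace (hull d (st k j @ [b k]))" unfolding T_def using b(3)[of k] True by simp
        then have "x \<notin> {h k j..<z k}" using b(5)[of k] Suc.prems(1) True by blast
        then have "x < h k j" using False by (auto simp: not_le)
        then obtain m where m: "m < k" "c m = j" "x < z (Suc m)"
        proof (cases "h k j = h 0 j")
          case True
          then have "x < z 0" using \<open>x < h k j\<close> hz[of 0 j] by simp
          then show ?thesis using Suc.prems(2) by simp
        next
          case False
          then show ?thesis using hk[of k j] \<open>x < h k j\<close> that by auto
        qed
        show ?thesis
        proof (cases "z m \<le> x")
          case True then show ?thesis using m less_Suc_eq by blast
        next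
          case False
          have "b m \<in> T k j" using b_mem[of m] mono_T[of "Suc m" k j] m by auto
          moreover have "x < b m" using False b(1)[of m] by simp
          ultimately have "x \<in> T k j" using endext[of "b m" k j x "Suc k"] Suc.prems(1) by simp
          then show ?thesis using Suc.IH Suc.prems(2) less_Suc_eq by metis
        qed
      qed
    qed
  qed
  define X where "X j = (\<Union>k. hull d (st k j))" for j
  have trX: "trace (X j) = (\<Union>k. T k j)" for j unfolding X_def T_def by (rule trace_UN)
  have "mono (\<lambda>k. hull d (st k j))" for j
    by (rule monoI[OF lift_Suc_mono_le]) (rule hull_mono[OF mono_st])
  then have "closed_under G (X j)" for j
    unfolding X_def by (intro closed_under_UN_mono closed_hull) (auto intro: mono_on_subset)
  moreover have "X j \<in> ctbl_subsets Q" for j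
    using hull_subset[OF d(2) st] countable_hull[OF d(2)] unfolding ctbl_subsets_def X_def by blast
  moreover have "trace (X j) \<inter> {..<w1} = {..<d}" for j
    using good_imp_stable[OF gd] unfolding trX T_def stable_def by blast
  moreover have "trace (X j) \<inter> {z k..<z (Suc k)} \<noteq> {} \<longleftrightarrow> c k = j" for j k
  proof
    assume "c k = j"
    then have "b k \<in> trace (X j) \<inter> {z k..<z (Suc k)}" using b_mem[of k] b(1,2) unfolding trX by auto
    then show "trace (X j) \<inter> {z k..<z (Suc k)} \<noteq> {}" by blast
  next
    assume "trace (X j) \<inter> {z k..<z (Suc k)} \<noteq> {}"
    then obtain x n where x: "x \<in> T n j" "z k \<le> x" "x < z (Suc k)" unfolding trX by auto
    moreover have "z 0 \<le> x" using x(2) strict_mono_less_eq[OF zmono, of 0 k] by (meson le0 order_trans)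
    ultimately obtain m where m: "c m = j" "z m \<le> x" "x < z (Suc m)" using blocks by blast
    have "m < Suc k" "k < Suc m" using m x strict_mono_less[OF zmono] by (meson le_less_trans)+
    then have "m = k" by simp
    then show "c k = j" using m(1) by simp
  qed
  moreover have "\<exists>k. z k \<le> x \<and> x < z (Suc k)" if "x \<in> trace (X j)" "z 0 \<le> x" for x j
    using that blocks unfolding trX by blast
  ultimately show ?thesis unfolding interleaved_def using zmono zw2 by (intro exI[of _ X] exI[of _ z]) blast
qed

end

subsection \<open>Decoding a real from three sets of ordinals\<close>

text \<open>The marks are the first elements of the runs of \<open>X\<close> above \<open>h\<close>,
  where runs are separated by elements of \<open>Y\<close> or \<open>Z\<close>. The relation is a
  parameter because the construction is transported along the collapse of a model, which is known to
  preserve membership.\<close>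

definition marks_by :: "('a \<Rightarrow> 'a \<Rightarrow> bool) \<Rightarrow> 'a \<Rightarrow> 'a set \<Rightarrow> 'a set \<Rightarrow> 'a set \<Rightarrow> 'a set" where
  "marks_by L h X Y Z = {x \<in> X. (h = x \<or> L h x) \<and>
     (\<forall>y\<in>X. (h = y \<or> L h y) \<and> L y x \<longrightarrow> (\<exists>w\<in>Y \<union> Z. L y w \<and> L w x))}"

text \<open>The n-th mark, counted by its predecessors among the marks, puts n into the real iff
  some element of \<open>Y\<close> follows it with no element of \<open>Z\<close> in
  between.\<close>

definition decode_by :: "('a \<Rightarrow> 'a \<Rightarrow> bool) \<Rightarrow> 'a \<Rightarrow> 'a set \<Rightarrow> 'a set \<Rightarrow> 'a set \<Rightarrow> nat set" where
  "decode_by L h X Y Z = (\<lambda>x. card {y \<in> marks_by L h X Y Z. L y x}) `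
     {x \<in> marks_by L h X Y Z. \<exists>y\<in>Y. L x y \<and> \<not> (\<exists>w\<in>Z. L x w \<and> L w y)}"

abbreviation decode :: "'o::linorder \<Rightarrow> 'o set \<Rightarrow> 'o set \<Rightarrow> 'o set \<Rightarrow> nat set" where
  "decode \<equiv> decode_by (<)"

lemma marks_by_less:
  fixes h :: "'o::linorder"
  shows "marks_by (<) h X Y Z = {x \<in> X. h \<le> x \<and> (\<forall>y\<in>X. h \<le> y \<and> y < x \<longrightarrow> (\<exists>w\<in>Y \<union> Z. y < w \<and> w < x))}"
  unfolding marks_by_def le_less by (simp add: disj_commute)

text \<open>The pattern \<open>c\<close> gives even blocks to \<open>X 0\<close> and block 2k+1 to
  \<open>X 1\<close> or \<open>X 2\<close> according to whether k is in \<open>r\<close>. So the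
  k-th mark is the least element of \<open>X 0\<close> in block 2k, and the next point of the other
  two sets reveals the bit.\<close>

lemma decode_blocks:
  fixes z :: "nat \<Rightarrow> 'o::wellorder" and X :: "nat \<Rightarrow> 'o set" and r :: "nat set"
  defines "c \<equiv> \<lambda>k. if even k then 0 else if k div 2 \<in> r then 1 else (2::nat)"
  assumes z: "strict_mono z"
    and meets: "\<And>j k. X j \<inter> {z k..<z (Suc k)} \<noteq> {} \<longleftrightarrow> c k = j"
    and cover: "\<And>j x. x \<in> X j \<Longrightarrow> z 0 \<le> x \<Longrightarrow> \<exists>k. z k \<le> x \<and> x < z (Suc k)"
  shows "decode (z 0) (X 0) (X 1) (X 2) = r"
proof -
  have block: "\<exists>k. c k = j \<and> z k \<le> x \<and> x < z (Suc k)" if "x \<in> X j" "z 0 \<le> x" for j x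
    using cover[OF that] meets that(1) by fastforce
  have less_block: "m < n" if "x < y" "z m \<le> x" "y < z (Suc n)" "m \<noteq> n" for x y m n
  proof -
    have "z m < z (Suc n)" using that by order
    then have "m < Suc n" using strict_mono_less[OF z] by simp
    then show ?thesis using that(4) by simp
  qed
  have block_less: "x < y" if "m < n" "x < z (Suc m)" "z n \<le> y" for x y m n
  proof -
    have "z (Suc m) \<le> z n" using that(1) strict_mono_less_eq[OF z] by simp
    then show ?thesis using that by order
  qed
  have z0: "z 0 \<le> z k" for k using strict_mono_less_eq[OF z] by simp
  define d where "d k = (LEAST x. x \<in> X 0 \<inter> {z (2 * k)..<z (Suc (2 * k))})" for k
  have d: "d k \<in> X 0" "z (2 * k) \<le> d k" "d k < z (Suc (2 * k))" for k
  proof -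
    have "\<exists>x. x \<in> X 0 \<inter> {z (2 * k)..<z (Suc (2 * k))}" using meets[of 0 "2 * k"] unfolding c_def by auto
    then have "d k \<in> X 0 \<inter> {z (2 * k)..<z (Suc (2 * k))}" unfolding d_def by (rule LeastI_ex)
    then show "d k \<in> X 0" "z (2 * k) \<le> d k" "d k < z (Suc (2 * k))" by auto
  qed
  have d_le: "d k \<le> x" if "x \<in> X 0" "z (2 * k) \<le> x" "x < z (Suc (2 * k))" for x k
    unfolding d_def using that by (intro Least_le) auto
  have d_less: "d m < d n" if "m < n" for m n using block_less[of "2 * m" "2 * n"] d that by auto
  then have d_smono: "strict_mono d" by (intro strict_monoI)
  have odd: "\<exists>w\<in>X 1 \<union> X 2. z (Suc (2 * m)) \<le> w \<and> w < z (Suc (Suc (2 * m)))" for m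
  proof -
    have "c (Suc (2 * m)) = 1 \<or> c (Suc (2 * m)) = 2" unfolding c_def by simp
    then have "X 1 \<inter> {z (Suc (2 * m))..<z (Suc (Suc (2 * m)))} \<noteq> {} \<or>
      X 2 \<inter> {z (Suc (2 * m))..<z (Suc (Suc (2 * m)))} \<noteq> {}"
      using meets by blast
    then show ?thesis by auto
  qed
  have even_block: "\<exists>m. z (2 * m) \<le> x \<and> x < z (Suc (2 * m))" if x: "x \<in> X 0" "z 0 \<le> x" for x
  proof -
    obtain k where k: "c k = 0" "z k \<le> x" "x < z (Suc k)" using block[OF x] by blast
    then have "even k" unfolding c_def by (auto split: if_splits)
    then show ?thesis using k by (elim evenE) auto
  qed
  have D: "marks_by (<) (z 0) (X 0) (X 1) (X 2) = range d"
  proof (intro equalityI subsetI)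
    fix x assume "x \<in> marks_by (<) (z 0) (X 0) (X 1) (X 2)"
    then have x: "x \<in> X 0" "z 0 \<le> x"
      and gap: "\<And>y. y \<in> X 0 \<Longrightarrow> z 0 \<le> y \<Longrightarrow> y < x \<Longrightarrow> \<exists>w\<in>X 1 \<union> X 2. y < w \<and> w < x"
      unfolding marks_by_less by auto
    obtain k where k: "z (2 * k) \<le> x" "x < z (Suc (2 * k))" using even_block[OF x] by blast
    have "\<not> d k < x"
    proof
      assume "d k < x"
      then obtain w where w: "w \<in> X 1 \<union> X 2" "d k < w" "w < x"
        using gap[OF d(1) order_trans[OF z0 d(2)]] by blast
      then have "z (2 * k) \<le> w" "w < z (Suc (2 * k))" using d[of k] k by order+
      then have "c (2 * k) = 1 \<or> c (2 * k) = 2" using w(1) meets[of 1 "2 * k"] meets[of 2 "2 * k"] by auto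
      then show False unfolding c_def by simp
    qed
    then show "x \<in> range d" using d_le[OF x(1) k] by (metis not_less rangeI antisym)
  next
    fix x assume "x \<in> range d"
    then obtain k where k: "x = d k" by blast
    have "\<exists>w\<in>X 1 \<union> X 2. y < w \<and> w < d k" if y: "y \<in> X 0" "z 0 \<le> y" "y < d k" for y
    proof -
      obtain m where m: "z (2 * m) \<le> y" "y < z (Suc (2 * m))" using even_block[OF y(1,2)] by blast
      have "m \<noteq> k" using d_le[OF y(1)] m y(3) by (metis leD)
      then have "m < k" using less_block[OF y(3) m(1) d(3)] by simp
      obtain w where w: "w \<in> X 1 \<union> X 2" "z (Suc (2 * m)) \<le> w" "w < z (Suc (Suc (2 * m)))" using odd by blast
      have "y < w" using m w by order
      moreover have "w < d k" using block_less[of "Suc (2 * m)" "2 * k" w "d k"] w d(2) \<open>m < k\<close> by simp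
      ultimately show ?thesis using w by blast
    qed
    then show "x \<in> marks_by (<) (z 0) (X 0) (X 1) (X 2)"
      using d(1,2)[of k] z0[of "2 * k"] unfolding marks_by_less k by auto
  qed
  have cd: "card {y \<in> range d. y < d k} = k" for k
  proof -
    have "{y \<in> range d. y < d k} = d ` {..<k}" using strict_mono_less[OF d_smono] by auto
    moreover have "inj_on d {..<k}"
      by (rule inj_on_subset[OF strict_mono_imp_inj_on[OF d_smono, of UNIV] subset_UNIV])
    ultimately show ?thesis by (simp add: card_image)
  qed
  have B: "(\<exists>y\<in>X 1. d k < y \<and> \<not> (\<exists>w\<in>X 2. d k < w \<and> w < y)) \<longleftrightarrow> k \<in> r" for k
  proof
    assume k: "k \<in> r"
    then have "c (Suc (2 * k)) = 1" unfolding c_def by simp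
    then obtain y where y: "y \<in> X 1" "z (Suc (2 * k)) \<le> y" "y < z (Suc (Suc (2 * k)))"
      using meets[of 1 "Suc (2 * k)"] by auto
    have "\<not> (\<exists>w\<in>X 2. d k < w \<and> w < y)"
    proof
      assume "\<exists>w\<in>X 2. d k < w \<and> w < y"
      then obtain w where w: "w \<in> X 2" "d k < w" "w < y" by blast
      then have "c (2 * k) = 2 \<or> c (Suc (2 * k)) = 2"
        using meets[of 2 "2 * k"] meets[of 2 "Suc (2 * k)"] d(2)[of k] y(3)
        by (meson atLeastLessThan_iff disjoint_iff le_less_linear less_imp_le less_trans order_trans)
      then show False using k unfolding c_def by simp
    qed
    moreover have "d k < y" using d(3)[of k] y(2) by order
    ultimately show "\<exists>y\<in>X 1. d k < y \<and> \<not> (\<exists>w\<in>X 2. d k < w \<and> w < y)" using y(1) by blast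
  next
    assume "\<exists>y\<in>X 1. d k < y \<and> \<not> (\<exists>w\<in>X 2. d k < w \<and> w < y)"
    then obtain y where y: "y \<in> X 1" "d k < y" "\<not> (\<exists>w\<in>X 2. d k < w \<and> w < y)" by blast
    show "k \<in> r"
    proof (rule ccontr)
      assume "k \<notin> r"
      then have c2: "c (Suc (2 * k)) = 2" unfolding c_def by simp
      then obtain w where w: "w \<in> X 2" "z (Suc (2 * k)) \<le> w" "w < z (Suc (Suc (2 * k)))"
        using meets[of 2 "Suc (2 * k)"] by auto
      have "z 0 \<le> y" using y(2) d(2)[of k] z0[of "2 * k"] by order
      then obtain m where m: "c m = 1" "z m \<le> y" "y < z (Suc m)" using block[OF y(1)] by blast
      have "m \<noteq> 2 * k" using m(1) unfolding c_def by auto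
      then have "2 * k < m" using less_block[OF y(2) d(2) m(3)] by simp
      moreover have "m \<noteq> Suc (2 * k)" using m(1) c2 by auto
      ultimately have "w < y" using block_less[of "Suc (2 * k)" m w y] w m by simp
      moreover have "d k < w" using d(3)[of k] w(2) by order
      ultimately show False using y(3) w(1) by blast
    qed
  qed
  have "{x \<in> range d. \<exists>y\<in>X 1. x < y \<and> \<not> (\<exists>w\<in>X 2. x < w \<and> w < y)} = d ` r" using B by blast
  then show ?thesis unfolding decode_by_def D by (simp only: image_image cd image_ident)
qed

section \<open>Every real is decoded from three members of any club\<close>

context omega_1_2_coding begin

text \<open>The three sets grow from one good empty position, so their traces on omega1 are the same
  d in \<open>S\<close>. Adding \<open>e_op\<close> to an operation for the club provides the end
  extension required by the game.\<close>

theorem decode_from_club: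
  assumes C: "club_in Q C" and S: "stat S"
  shows "\<exists>d\<in>S. \<exists>X. \<exists>h<w2. (\<forall>j. X j \<in> C \<and> trace (X j) \<inter> {..<w1} = {..<d}) \<and>
    decode h (trace (X 0)) (trace (X 1)) (trace (X (2::nat))) = r"
proof -
  obtain G' where G': "\<And>s. finite s \<Longrightarrow> countable (G' s)" "\<And>s. G' s \<subseteq> Q"
    "\<And>X. X \<in> ctbl_subsets Q \<Longrightarrow> closed_under G' X \<Longrightarrow> X \<in> C"
    using club_in_imp_closed_under[OF C] by metis
  interpret hull_game w1 w2 emb Q e "\<lambda>s. G' s \<union> e_op s"
    by unfold_locales (use G' countable_e_op e_op_subset in auto)
  obtain d where d: "d \<in> S" "good d []" using good_Nil[OF S] by blast
  then have "d < w1" using S unfolding stat_def by blast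
  define c where "c k = (if even k then 0 else if k div 2 \<in> r then 1 else (2::nat))" for k
  obtain X z where "interleaved d c X z"
    using interleaved_sets[OF d(2) \<open>d < w1\<close>, of c] by (elim exE)
  note Xz = this[unfolded interleaved_def]
  have "decode (z 0) (trace (X 0)) (trace (X 1)) (trace (X 2)) = r"
    using Xz unfolding c_def by (intro decode_blocks[where X = "\<lambda>j. trace (X j)"]) blast+
  moreover have "X j \<in> C" for j
  proof -
    have "closed_under G' (X j)" using Xz unfolding closed_under_def by blast
    then show ?thesis using G'(3) Xz by blast
  qed
  moreover have "trace (X j) \<inter> {..<w1} = {..<d}" "z 0 < w2" for j using Xz by blast+
  ultimately show ?thesis
    by (intro bexI[OF _ d(1)] exI[of _ X] exI[of _ "z 0"] conjI allI)
qed

end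

section \<open>Ordinals of a universe of sets\<close>

lemma mem_iff_elts: "mem x y \<longleftrightarrow> x \<in> elts y"
  unfolding elts_def by simp

lemma elts_inject: "elts x = elts y \<Longrightarrow> x = y"
  using extensionality[of x y] unfolding elts_def by blast

lemma ex_elts_image:
  fixes F :: "'v::set_universe \<Rightarrow> 'v"
  shows "\<exists>y. elts y = F ` elts x"
proof -
  obtain y where "\<forall>z. mem z y \<longleftrightarrow> (\<exists>w. mem w x \<and> z = F w)" using replacement[of x F] by blast
  then have "elts y = F ` elts x" unfolding elts_def by auto
  then show ?thesis by blast
qed

lemma ex_elts_subset: "A \<subseteq> elts x \<Longrightarrow> \<exists>y. elts y = A"
  using separation[of x "\<lambda>w. w \<in> A"] unfolding elts_def by auto

lemma ex_elts_lepoll: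
  fixes A :: "'v::set_universe set"
  assumes "A \<lesssim> elts (x :: 'v)" shows "\<exists>y. elts y = A"
proof -
  from assms obtain F where "A \<subseteq> F ` elts x" unfolding lepoll_iff by blast
  then show ?thesis using ex_elts_image[of F x] ex_elts_subset by metis
qed

lemma elts_induct: "(\<And>x. (\<And>y. y \<in> elts x \<Longrightarrow> P y) \<Longrightarrow> P x) \<Longrightarrow> P a"
  using wfp_induct_rule[OF foundation, of P a] unfolding mem_iff_elts by blast

lemma elts_irrefl: "x \<notin> elts x"
  using foundation unfolding mem_iff_elts[symmetric] by (metis wfp_on_def wfp_imp_irreflp irreflpD)

lemma Ord_elt: "Ord x \<Longrightarrow> y \<in> elts x \<Longrightarrow> Ord y"
  unfolding Ord_def by blast

lemma Ord_elts_subset: "Ord x \<Longrightarrow> y \<in> elts x \<Longrightarrow> elts y \<subseteq> elts x"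
  unfolding Ord_def by blast

lemma Ord_trichotomy: "Ord a \<Longrightarrow> Ord b \<Longrightarrow> a \<in> elts b \<or> a = b \<or> b \<in> elts a"
proof (induction a arbitrary: b rule: elts_induct)
  case IHa: (1 a)
  show ?case using IHa.prems(2)
  proof (induction b rule: elts_induct)
    case IHb: (1 b)
    show ?case
    proof (rule ccontr)
      assume neg: "\<not> ?thesis"
      have "z \<in> elts b" if "z \<in> elts a" for z
        using IHa.IH[OF that Ord_elt[OF IHa.prems(1) that] IHb.prems] neg that
          Ord_elts_subset[OF IHa.prems(1) that] by blast
      moreover have "z \<in> elts a" if "z \<in> elts b" for z
        using IHb.IH[OF that Ord_elt[OF IHb.prems that]] neg that
          Ord_elts_subset[OF IHb.prems that] by blast
      ultimately have "elts a = elts b" by blast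
      then show False using neg elts_inject by blast
    qed
  qed
qed

lemma OrdI_subset:
  assumes "\<And>y. y \<in> elts x \<Longrightarrow> Ord y" "\<And>y. y \<in> elts x \<Longrightarrow> elts y \<subseteq> elts x" shows "Ord x"
  using assms unfolding Ord_def by blast

text \<open>As a well-ordered type the ordinals come under the combinatorics above, although the
  universe has no set of all ordinals.\<close>

typedef (overloaded) 'v ordinal = "{x :: 'v::set_universe. Ord x}"
  morphisms val ordinal
proof -
  obtain x :: 'v where "\<forall>w. \<not> mem w x" using infinity by blast
  then have "Ord x" unfolding Ord_def elts_def by simp
  then show ?thesis by blast
qed

lemma Ord_val [simp]: "Ord (val a)"
  using val by simp

instantiation ordinal :: (set_universe) wellorder
begin

definition "less_ordinal a b \<longleftrightarrow> val a \<in> elts (val b)"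
definition "less_eq_ordinal (a :: 'a ordinal) b \<longleftrightarrow> a = b \<or> a < b"

instance
proof
  have trans: "x < z" if "x < y" "y < z" for x y z :: "'a ordinal"
    using that Ord_elts_subset[OF Ord_val] unfolding less_ordinal_def by blast
  have irrefl: "\<not> x < x" for x :: "'a ordinal" unfolding less_ordinal_def by (rule elts_irrefl)
  fix x y z :: "'a ordinal"
  show "x < y \<longleftrightarrow> x \<le> y \<and> \<not> y \<le> x"
    unfolding less_eq_ordinal_def using trans[of x y x] irrefl[of x] by blast
  show "x \<le> x" unfolding less_eq_ordinal_def by simp
  show "x \<le> y \<Longrightarrow> y \<le> z \<Longrightarrow> x \<le> z" unfolding less_eq_ordinal_def using trans by blast
  show "x \<le> y \<Longrightarrow> y \<le> x \<Longrightarrow> x = y" unfolding less_eq_ordinal_def using trans irrefl by blast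
  show "x \<le> y \<or> y \<le> x"
    using Ord_trichotomy[OF Ord_val[of x] Ord_val[of y]] unfolding less_eq_ordinal_def less_ordinal_def
    by (auto simp: val_inject)
next
  fix P :: "'a ordinal \<Rightarrow> bool" and a :: "'a ordinal"
  assume IH: "\<And>x. (\<And>y. y < x \<Longrightarrow> P y) \<Longrightarrow> P x"
  have "\<forall>a. val a = x \<longrightarrow> P a" for x
    by (induction x rule: elts_induct) (auto intro: IH simp: less_ordinal_def)
  then show "P a" by blast
qed

end

lemma ex_ordinal: "Ord x \<Longrightarrow> \<exists>a. x = val a"
  using ordinal_inverse[of x] by (metis mem_Collect_eq)

lemma inj_val: "inj val"
  by (simp add: inj_def val_inject)

lemma elts_val: "elts (val a) = val ` {..<a}"
proof (intro equalityI subsetI)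
  fix x assume "x \<in> elts (val a)"
  moreover from this obtain b where "x = val b" using ex_ordinal[OF Ord_elt[OF Ord_val]] by blast
  ultimately show "x \<in> val ` {..<a}" by (auto simp: less_ordinal_def)
qed (auto simp: less_ordinal_def)

lemma val_mem_iff [simp]: "val a \<in> elts (val b) \<longleftrightarrow> a < b"
  by (simp add: less_ordinal_def)

lemma countable_elts_val: "countable (elts (val a)) \<longleftrightarrow> countable {..<a}"
  unfolding elts_val using inj_val by (metis countable_image countable_image_inj_on inj_on_subset top_greatest)

lemma val_image_lepoll: "val ` A \<lesssim> val ` B \<longleftrightarrow> A \<lesssim> B"
  using inj_val by (metis inj_on_image_lepoll_1 inj_on_image_lepoll_2 inj_on_subset top_greatest)

subsection \<open>Hereditary cardinality\<close>

lemma trcl_subset: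
  assumes "elts x \<subseteq> A" "\<And>y. y \<in> A \<Longrightarrow> elts y \<subseteq> A" shows "trcl x \<subseteq> A"
proof
  fix y assume "y \<in> trcl x"
  then have "mem\<^sup>+\<^sup>+ y x" unfolding trcl_def by simp
  then show "y \<in> A"
    using assms by (induction rule: converse_tranclp_induct) (auto simp: mem_iff_elts)
qed

lemma elts_subset_trcl: "elts x \<subseteq> trcl x"
  unfolding trcl_def elts_def by auto

lemma trcl_closed: "y \<in> trcl x \<Longrightarrow> elts y \<subseteq> trcl x"
  unfolding trcl_def elts_def by (auto intro: tranclp_into_tranclp2)

lemma trcl_Ord: "Ord x \<Longrightarrow> trcl x = elts x"
  by (intro antisym trcl_subset elts_subset_trcl) (auto simp: Ord_def)

lemma hered_subset: "elts y \<subseteq> trcl x \<Longrightarrow> x \<in> hered K \<Longrightarrow> y \<in> hered K"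
proof -
  assume "elts y \<subseteq> trcl x" "x \<in> hered K"
  then have "trcl y \<lesssim> trcl x" "trcl x \<prec> K"
    using trcl_subset[of y "trcl x"] trcl_closed unfolding hered_def
    by (auto intro: subset_imp_lepoll)
  then show ?thesis unfolding hered_def by (auto intro: lesspoll_trans1)
qed

lemma hered_elt: "y \<in> elts x \<Longrightarrow> x \<in> hered K \<Longrightarrow> y \<in> hered K"
  using hered_subset[of y x] trcl_closed elts_subset_trcl by blast

subsection \<open>Consequences of the Strong Reflection Principle\<close>

text \<open>A universe without Power Set may lack omega1 and omega2 as elements. Here they are
  elements, as is the case when some \<open>\<theta>\<close> contains all ordinals below
  omega2.\<close>

locale omega_2_exists =
  fixes w1 w2 :: "'v::set_universe ordinal"
  assumes elts_w1: "elts (val w1) = omega1" and elts_w2: "elts (val w2) = omega2"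
begin

lemma omega1_eq: "omega1 = val ` {..<w1}"
  using elts_w1 elts_val by metis

lemma omega2_eq: "omega2 = val ` {..<w2}"
  using elts_w2 elts_val by metis

sublocale omega_1_2 w1 w2
proof
  fix a :: "'v ordinal"
  show "a < w1 \<longleftrightarrow> countable {..<a}"
    unfolding less_ordinal_def elts_w1 omega1_def countable_elts_val[symmetric] by simp
  have "elts (val a) \<lesssim> (omega1 :: 'v set) \<longleftrightarrow> {..<a} \<lesssim> {..<w1}"
    unfolding elts_val omega1_eq by (rule val_image_lepoll)
  then show "a < w2 \<longleftrightarrow> {..<a} \<lesssim> {..<w1}"
    unfolding less_ordinal_def elts_w2 omega2_def by simp
qed

lemma lesspoll_omega2: "A \<lesssim> (omega1 :: 'v set) \<Longrightarrow> A \<prec> (omega2 :: 'v set)"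
proof -
  have "{..<w1} \<lesssim> {..<w2}" using w1_less_w2 by (intro subset_imp_lepoll) auto
  then have "(omega1 :: 'v set) \<prec> (omega2 :: 'v set)"
    using not_lepoll_w2 eqpoll_imp_lepoll[OF eqpoll_sym, of "val ` {..<w1}" "val ` {..<w2}"]
    unfolding omega1_eq omega2_eq lesspoll_def val_image_lepoll by blast
  then show "A \<prec> (omega2 :: 'v set)" if "A \<lesssim> (omega1 :: 'v set)" using that by (rule lesspoll_trans1[rotated])
qed

definition e :: "'v ordinal \<Rightarrow> 'v ordinal \<Rightarrow> 'v ordinal" where
  "e = (SOME e. \<forall>b x. x < b \<and> b < w2 \<longrightarrow> e b ` {..<w1} = {..<b})"

sublocale omega_1_2_coding w1 w2 val "hered omega2" e
proof
  show "inj val" by (rule inj_val)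
  have "val a \<in> hered omega2" if "a < w2" for a :: "'v ordinal"
    unfolding hered_def mem_Collect_eq trcl_Ord[OF Ord_val]
  proof (rule lesspoll_omega2)
    show "elts (val a) \<lesssim> (omega1 :: 'v set)" using that less_w2[of a] unfolding elts_val omega1_eq val_image_lepoll by simp
  qed
  then show "val ` {..<w2} \<subseteq> hered omega2" by blast
  have "\<exists>f. \<forall>x. x < b \<and> b < w2 \<longrightarrow> f ` {..<w1} = {..<b}" for b
  proof (cases "\<exists>x. x < b \<and> b < w2")
    case True
    then obtain x where x: "x < b" "b < w2" by blast
    then obtain g where g: "{..<b} \<subseteq> g ` {..<w1}" using less_w2 unfolding lepoll_iff by blast
    have "(\<lambda>c. if g c < b then g c else x) ` {..<w1} = {..<b}" using g x by (auto simp: image_iff)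
    then show ?thesis by blast
  qed blast
  then have "\<exists>f. \<forall>b. \<forall>x. x < b \<and> b < w2 \<longrightarrow> f b ` {..<w1} = {..<b}"
    by (intro choice allI)
  then have "\<forall>b x. x < b \<and> b < w2 \<longrightarrow> e b ` {..<w1} = {..<b}" unfolding e_def by (rule someI_ex)
  then show "x < b \<Longrightarrow> b < w2 \<Longrightarrow> e b ` {..<w1} = {..<b}" for x b by blast
qed

abbreviation "Hw2 \<equiv> hered (omega2 :: 'v set)"

lemma trace_eq_iff: "trace Y \<inter> {..<w1} = {..<d} \<Longrightarrow> elts (val d) = Y \<inter> omega1"
proof -
  assume Y: "trace Y \<inter> {..<w1} = {..<d}"
  have "Y \<inter> omega1 = val ` (trace Y \<inter> {..<w1})"
    using w1_less_w2 unfolding omega1_eq trace_def by auto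
  then show ?thesis unfolding Y elts_val by simp
qed

lemma club_omega1_closure_points:
  assumes f: "selfmap f" shows "club_omega1 (val ` closure_points f)"
  unfolding club_omega1_def
proof (intro conjI ballI impI)
  show "val ` closure_points f \<subseteq> omega1" unfolding omega1_eq closure_points_def by auto
  fix x :: 'v assume "x \<in> omega1"
  then obtain a where a: "x = val a" "a < w1" unfolding omega1_eq by blast
  obtain d where "d \<in> closure_points f" "a < d" using closure_points_unbounded[OF f a(2)] .
  then show "\<exists>\<beta>\<in>val ` closure_points f. x \<in> elts \<beta>" unfolding a less_ordinal_def by blast
next
  fix x :: 'v
  assume "x \<in> omega1"
    and lim: "elts x \<noteq> {} \<and> (\<forall>\<alpha>\<in>elts x. \<exists>\<beta>\<in>val ` closure_points f \<inter> elts x. \<alpha> \<in> elts \<beta>)"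
  then obtain d where d: "x = val d" "d < w1" unfolding omega1_eq by blast
  have "\<exists>c\<in>closure_points f. c < d \<and> a < c" if "a < d" for a
    using lim that unfolding d less_ordinal_def by blast
  then have "f a < d" if "a < d" for a using closure_pointsD(2) that by (meson less_trans)
  moreover have "\<exists>a. a < d" using lim unfolding d elts_val by blast
  ultimately show "x \<in> val ` closure_points f" unfolding d closure_points_def using d(2) by blast
qed

lemma stationary_omega1_imp_stat: "stationary_omega1 T \<Longrightarrow> stat (val -` T)"
  using club_omega1_closure_points unfolding stationary_omega1_def stat_def omega1_eq
  by (fastforce simp: val_inject)

lemma projective_stationaryI:
  assumes P: "P \<subseteq> ctbl_subsets Hw2"
    and meet: "\<And>S C. stat S \<Longrightarrow> club_in Hw2 C \<Longrightarrow> \<exists>Y\<in>P \<inter> C. \<exists>d\<in>S. trace Y \<inter> {..<w1} = {..<d}"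
  shows "projective_stationary Hw2 P"
  unfolding projective_stationary_def stationary_in_def
proof (intro conjI allI impI)
  show "omega1 \<subseteq> Hw2" using emb_subset w1_less_w2 unfolding omega1_eq by auto
  fix T :: "'v set" and C assume T: "stationary_omega1 T" and C: "club_in Hw2 C"
  obtain Y d where Y: "Y \<in> P \<inter> C" "d \<in> val -` T" "trace Y \<inter> {..<w1} = {..<d}"
    using meet[OF stationary_omega1_imp_stat[OF T] C] by blast
  then have "val d \<in> T" "elts (val d) = Y \<inter> omega1" using trace_eq_iff by blast+
  then show "{Y \<in> P. \<exists>\<alpha>\<in>T. elts \<alpha> = Y \<inter> omega1} \<inter> C \<noteq> {}" using Y(1) by blast
qed (use P in auto)

text \<open>When a model of the chain is an element of the next one, closure under this operation
  puts its trace on omega1 into the next one as well. That forces these traces to grow strictly at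
  successor steps.\<close>

definition height_op :: "'v set \<Rightarrow> 'v set" where
  "height_op s = val ` {d. d < w1 \<and> (\<exists>x\<in>s. trace (elts x) \<inter> {..<w1} = {..<d})}"

lemma countable_height_op: "finite s \<Longrightarrow> countable (height_op s)"
proof -
  assume "finite s"
  have "inj_on (\<lambda>d. {..<d}) {d :: 'v ordinal. d < w1 \<and> (\<exists>x\<in>s. trace (elts x) \<inter> {..<w1} = {..<d})}"
    by (intro inj_onI) (metis lessThan_eq_iff)
  moreover have "(\<lambda>d. {..<d}) ` {d. d < w1 \<and> (\<exists>x\<in>s. trace (elts x) \<inter> {..<w1} = {..<d})} \<subseteq>
      (\<lambda>x. trace (elts x) \<inter> {..<w1}) ` s" by auto
  ultimately have "countable {d. d < w1 \<and> (\<exists>x\<in>s. trace (elts x) \<inter> {..<w1} = {..<d})}"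
    using \<open>finite s\<close> by (metis (no_types, lifting) countable_finite countable_image_inj_on finite_imageI finite_subset)
  then show ?thesis unfolding height_op_def by (rule countable_image)
qed

lemma height_op_subset: "height_op s \<subseteq> Hw2"
  using emb_subset w1_less_w2 unfolding height_op_def by auto

lemma ex_successor:
  assumes "x < w1" obtains y where "y < w1" "{..<y} = {..x}" "elts (val y) = insert (val x) (elts (val x))"
proof -
  obtain b where b: "b < w1" "x < b" using max_less_w1[OF assms assms] by blast
  define y where "y = (LEAST y. x < y)"
  have "x < y" "y \<le> b" unfolding y_def using b(2) by (auto intro: LeastI Least_le)
  moreover have "z \<le> x" if "z < y" for z using not_less_Least[of z "\<lambda>y. x < y"] that unfolding y_def by simp
  ultimately have "{..<y} = {..x}" "y < w1" using b(1) by auto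
  moreover from this have "elts (val y) = insert (val x) (elts (val x))"
    unfolding elts_val by (simp flip: ivl_disj_un_singleton(2))
  ultimately show ?thesis using that by blast
qed

lemma filtration_trace: "filtration N \<Longrightarrow> filtration (\<lambda>x. trace (N x))"
  unfolding filtration_def by (simp add: countable_trace trace_mono flip: trace_UN)

text \<open>The principle is applied to the members of \<open>P\<close> that are closed under
  \<open>height_op\<close> and meet omega1 in an ordinal. Along the chain this ordinal increases
  strictly at successors, hence dominates the index, and the union contains omega1.\<close>

theorem SRP_chain:
  assumes SRP: "SRP_omega2 TYPE('v)" and P: "P \<subseteq> ctbl_subsets Hw2"
    and meet: "\<And>S C. stat S \<Longrightarrow> club_in Hw2 C \<Longrightarrow> \<exists>Y\<in>P \<inter> C. \<exists>d\<in>S. trace Y \<inter> {..<w1} = {..<d}"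
  shows "\<exists>N. filtration N \<and> (\<forall>x<w1. N x \<in> P) \<and> {..<w1} \<subseteq> trace (\<Union>x<w1. N x)"
proof -
  define P' where "P' = {Y \<in> P. closed_under height_op Y \<and> (\<exists>d. trace Y \<inter> {..<w1} = {..<d})}"
  have "projective_stationary Hw2 P'"
  proof (rule projective_stationaryI)
    show "P' \<subseteq> ctbl_subsets Hw2" using P unfolding P'_def by blast
    fix S C assume S: "stat S" and C: "club_in Hw2 C"
    have "club_in Hw2 {X \<in> ctbl_subsets Hw2. closed_under height_op X}"
      by (intro club_in_closed_under countable_height_op) (auto simp: closed_under_def height_op_subset)
    from club_in_Int[OF C this] obtain E where
      E: "E \<subseteq> C \<inter> {X \<in> ctbl_subsets Hw2. closed_under height_op X}" "club_in Hw2 E" by blast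
    obtain Y d where Y: "Y \<in> P \<inter> E" "d \<in> S" "trace Y \<inter> {..<w1} = {..<d}" using meet[OF S E(2)] by blast
    then have "Y \<in> P' \<inter> C" using E(1) unfolding P'_def by blast
    then show "\<exists>Y\<in>P' \<inter> C. \<exists>d\<in>S. trace Y \<inter> {..<w1} = {..<d}" using Y(2,3) by blast
  qed
  with SRP[unfolded SRP_omega2_def, rule_format, of P']
  obtain N0 :: "'v \<Rightarrow> 'v set" where
    N0: "\<forall>\<xi>\<in>omega1. countable (N0 \<xi>) \<and> elementary_sub (N0 \<xi>) Hw2 \<and> N0 \<xi> \<in> P'"
    and suc0: "\<forall>\<xi>\<in>omega1. \<forall>\<eta>\<in>omega1. elts \<eta> = insert \<xi> (elts \<xi>) \<longrightarrow>
       (\<exists>x\<in>N0 \<eta>. elts x = N0 \<xi>) \<and> N0 \<xi> \<subseteq> N0 \<eta>"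
    and lim0: "\<forall>\<xi>\<in>omega1. elts \<xi> \<noteq> {} \<and> (\<forall>\<alpha>\<in>elts \<xi>. \<exists>\<beta>\<in>elts \<xi>. \<alpha> \<in> elts \<beta>) \<longrightarrow>
       N0 \<xi> = (\<Union>\<zeta>\<in>elts \<xi>. N0 \<zeta>)"
    by (elim impE exE conjE meta_impE)
  define N where "N x = N0 (val x)" for x
  have N: "countable (N x)" "N x \<in> P'" if "x < w1" for x
    using N0 that unfolding N_def omega1_eq by auto
  have suc: "(\<exists>n\<in>N y. elts n = N x) \<and> N x \<subseteq> N y" if "x < w1" "y < w1" "{..<y} = {..x}" for x y
  proof -
    have "elts (val y) = insert (val x) (elts (val x))"
      unfolding elts_val that(3) by (simp flip: ivl_disj_un_singleton(2))
    then show ?thesis using suc0 that(1,2) unfolding N_def omega1_eq by blast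
  qed
  have lim: "N d = (\<Union>x<d. N x)" if "d < w1" "limit_below d" for d
  proof -
    have "elts (val d) \<noteq> {} \<and> (\<forall>\<alpha>\<in>elts (val d). \<exists>\<beta>\<in>elts (val d). \<alpha> \<in> elts \<beta>)"
      using that(2) unfolding limit_below_def elts_val[of d] by auto
    then have "N0 (val d) = (\<Union>\<zeta>\<in>elts (val d). N0 \<zeta>)" using lim0 that(1) unfolding omega1_eq by blast
    then show ?thesis unfolding N_def elts_val by simp
  qed
  have mono: "N x \<subseteq> N y" if "x \<le> y" "y < w1" for x y
    using that
  proof (induction y rule: less_induct)
    case (less y)
    show ?case
    proof (cases "x = y")
      case False
      then have "x < y" using less.prems by simp
      show ?thesis
      proof (cases "limit_below y")
        case True
        then show ?thesis using lim[OF less.prems(2)] \<open>x < y\<close> by blast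
      next
        case False
        then obtain p where p: "p < y" "\<And>z. z < y \<Longrightarrow> z \<le> p"
          using \<open>x < y\<close> unfolding limit_below_def by (metis not_less)
        then have "{..<y} = {..p}" by auto
        moreover have "p < w1" using p(1) less.prems(2) by simp
        ultimately have "N p \<subseteq> N y" using suc less.prems(2) by blast
        moreover have "N x \<subseteq> N p" using less.IH[OF p(1)] p(2)[OF \<open>x < y\<close>] \<open>p < w1\<close> by blast
        ultimately show ?thesis by blast
      qed
    qed simp
  qed
  have filt: "filtration N" unfolding filtration_def using N(1) mono lim by blast
  obtain d where d: "\<And>x. x < w1 \<Longrightarrow> trace (N x) \<inter> {..<w1} = {..<d x}"
    using N(2) unfolding P'_def mem_Collect_eq by metis
  have d_w1: "d x < w1" if "x < w1" for x
  proof -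
    have "countable (trace (N x) \<inter> {..<w1})" using N(1)[OF that] by (intro countable_Int1 countable_trace)
    then show ?thesis using d[OF that] less_w1 by simp
  qed
  have d_suc: "d x < d y" if "x < w1" "y < w1" "{..<y} = {..x}" for x y
  proof -
    from suc[OF that] obtain n where n: "n \<in> N y" "elts n = N x" by blast
    have "val (d x) \<in> height_op {n}"
      unfolding height_op_def by (rule imageI) (simp add: n(2) d[OF that(1)] d_w1[OF that(1)])
    moreover have "closed_under height_op (N y)" using N(2)[OF that(2)] unfolding P'_def by blast
    ultimately have "val (d x) \<in> N y" using n(1) unfolding closed_under_def by blast
    then have "d x \<in> trace (N y) \<inter> {..<w1}"
      unfolding trace_def using d_w1[OF that(1)] w1_less_w2 by simp
    then show ?thesis using d[OF that(2)] by simp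
  qed
  have d_mono: "d x \<le> d y" if "x \<le> y" "y < w1" for x y
  proof -
    have "x < w1" using that by order
    have "trace (N x) \<inter> {..<w1} \<subseteq> trace (N y) \<inter> {..<w1}"
      by (intro Int_mono trace_mono mono that order_refl)
    then have "{..<d x} \<subseteq> {..<d y}" unfolding d[OF \<open>x < w1\<close>] d[OF that(2)] .
    then show ?thesis by simp
  qed
  have le_d: "x \<le> d x" if "x < w1" for x
    using that
  proof (induction x rule: less_induct)
    case (less x)
    show ?case
    proof (rule ccontr)
      assume "\<not> x \<le> d x"
      then have lt: "d x < x" by simp
      have dx: "d x < w1" by (rule d_w1[OF less.prems])
      obtain s where s: "s < w1" "{..<s} = {..d x}" using ex_successor[OF dx] by metis
      have "s \<le> x" using s(2) lt by (metis atMost_iff lessThan_iff not_le)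
      have "d x \<le> d (d x)" using less.IH[OF lt dx] .
      also have "\<dots> < d s" by (rule d_suc[OF dx s])
      also have "\<dots> \<le> d x" by (rule d_mono[OF \<open>s \<le> x\<close> less.prems])
      finally show False by simp
    qed
  qed
  have "x \<in> trace (\<Union>x<w1. N x)" if "x < w1" for x
  proof -
    from ex_successor[OF that] obtain s where s: "s < w1" "{..<s} = {..x}" by metis
    have "x < d s" using le_d[OF that] d_suc[OF that s] by simp
    then have "x \<in> trace (N s)" using d[OF s(1)] by blast
    then show ?thesis unfolding trace_UN using s(1) by blast
  qed
  then show ?thesis using filt N(2) unfolding P'_def by blast
qed

text \<open>If \<open>r\<close> were not decoded, a chain of sets with traces outside
  \<open>F\<close> would exist. Its union meets omega2 in an ordinal g, and on a club the traces of
  the chain are the images of countable ordinals under \<open>e g\<close>. Stationarity of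
  \<open>F\<close> at this particular g puts one of these traces into \<open>F\<close>.\<close>

theorem decode_surj:
  assumes SRP: "SRP_omega2 TYPE('v)"
    and F: "\<And>g. w1 \<le> g \<Longrightarrow> g < w2 \<Longrightarrow> stat {x. x < w1 \<and> e g ` {..<x} \<in> F}"
  shows "\<exists>h<w2. \<exists>X\<in>F. \<exists>Y\<in>F. \<exists>Z\<in>F. decode h X Y Z = r"
proof (rule ccontr)
  assume neg: "\<not> ?thesis"
  define P where "P = {Y \<in> ctbl_subsets Hw2. closed_under e_op Y \<and> trace Y \<notin> F}"
  have "\<exists>Y\<in>P \<inter> C. \<exists>d\<in>S. trace Y \<inter> {..<w1} = {..<d}" if S: "stat S" and C: "club_in Hw2 C" for S C
  proof -
    have "club_in Hw2 {X \<in> ctbl_subsets Hw2. closed_under e_op X}"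
      by (intro club_in_closed_under countable_e_op) (auto simp: closed_under_def e_op_subset)
    from club_in_Int[OF C this] obtain E where
      E: "E \<subseteq> C \<inter> {X \<in> ctbl_subsets Hw2. closed_under e_op X}" "club_in Hw2 E" by blast
    obtain d X h where d: "d \<in> S" and X: "h < w2 \<and> (\<forall>j. X j \<in> E \<and> trace (X j) \<inter> {..<w1} = {..<d}) \<and>
      decode h (trace (X 0)) (trace (X 1)) (trace (X (2::nat))) = r"
      using decode_from_club[OF E(2) S, of r] by (elim bexE exE)
    have "\<exists>j. trace (X j) \<notin> F"
    proof (rule ccontr)
      assume "\<nexists>j. trace (X j) \<notin> F"
      then have "trace (X 0) \<in> F" "trace (X 1) \<in> F" "trace (X 2) \<in> F" by simp_all
      then show False using neg X by blast
    qed
    then obtain j where j: "trace (X j) \<notin> F" by blast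
    have Xj: "X j \<in> E" "trace (X j) \<inter> {..<w1} = {..<d}" using X by simp_all
    then have "X j \<in> P \<inter> C" using j E(1) unfolding P_def by blast
    then show ?thesis using d Xj(2) by blast
  qed
  then obtain N where N: "filtration N" "\<And>x. x < w1 \<Longrightarrow> N x \<in> P"
    and w1N: "{..<w1} \<subseteq> trace (\<Union>x<w1. N x)"
    using SRP_chain[OF SRP, of P] unfolding P_def by blast
  define J where "J = trace (\<Union>x<w1. N x)"
  have Nmono: "N x \<subseteq> N y" if "x \<le> y" "y < w1" for x y using N(1) that unfolding filtration_def by blast
  \<comment> \<open>The union contains omega1 and its stages are closed under \<open>e_op\<close>,
    so together with b it contains every value of \<open>e b\<close> on omega1. Thus
    \<open>J\<close> is an initial segment.\<close>
  have down: "x \<in> J" if b_J: "b \<in> J" and "x < b" for x b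
  proof -
    have b: "b < w2" using b_J unfolding J_def trace_def by blast
    define c where "c = e_inv b x"
    have c: "c < w1" "e b c = x" using e_inv[OF \<open>x < b\<close> b] unfolding c_def by auto
    then have "c \<in> J" using w1N unfolding J_def by blast
    then obtain z where z: "z < w1" "c \<in> trace (N z)" unfolding J_def trace_UN by blast
    obtain y where y: "y < w1" "b \<in> trace (N y)" using b_J unfolding J_def trace_UN by blast
    note yz = y z
    define m where "m = max y z"
    have m: "m < w1" "b \<in> trace (N m)" "c \<in> trace (N m)"
      using yz trace_mono[OF Nmono[of y m]] trace_mono[OF Nmono[of z m]] unfolding m_def by auto
    have "closed_under e_op (N m)" using N(2)[OF m(1)] unfolding P_def by blast
    then have "x \<in> trace (N m)" using closed_e_op(1)[OF _ m(2) \<open>x < b\<close> c(1) m(3)] c(2) by blast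
    then show ?thesis using m(1) unfolding J_def trace_UN by blast
  qed
  have "J \<lesssim> {..<w1}" unfolding J_def trace_UN by (rule filtration_lepoll[OF filtration_trace[OF N(1)]])
  moreover have "J \<subseteq> {..<w2}" unfolding J_def trace_def by blast
  ultimately have "\<exists>b. b < w2 \<and> b \<notin> J" using not_lepoll_w2 by (metis lessThan_iff subsetI subset_antisym)
  define g where "g = (LEAST b. b \<notin> J)"
  have "g \<notin> J" "g < w2" unfolding g_def using \<open>\<exists>b. b < w2 \<and> b \<notin> J\<close>
    by (metis LeastI, metis Least_le le_less_trans)
  have J: "J = {..<g}"
  proof (intro equalityI subsetI)
    fix x assume "x \<in> J"
    then show "x \<in> {..<g}" using down \<open>g \<notin> J\<close> by (metis lessThan_iff linorder_less_linear)
  qed (use not_less_Least g_def in auto)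
  have "w1 \<le> g" using w1N J unfolding J_def by (metis lessThan_subset_iff)
  obtain z where "z < g" using \<open>w1 \<le> g\<close> ex_less_w1 less_le_trans by blast
  have "(\<Union>x<w1. e g ` {..<x}) = {..<g}"
  proof -
    have "(\<Union>x<w1. e g ` {..<x}) = e g ` {..<w1}"
      unfolding image_UN[symmetric] initial_segments_UN ..
    then show ?thesis using e_image[OF \<open>z < g\<close> \<open>g < w2\<close>] by simp
  qed
  then have "(\<Union>x<w1. trace (N x)) = (\<Union>x<w1. e g ` {..<x})"
    using J unfolding J_def trace_UN by simp
  from filtration_agree[OF filtration_trace[OF N(1)] filtration_image this]
  obtain f where f: "selfmap f" "\<And>d. d \<in> closure_points f \<Longrightarrow> trace (N d) = e g ` {..<d}" by metis
  obtain d where "d < w1" "e g ` {..<d} \<in> F" "d \<in> closure_points f"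
    using statD[OF F[OF \<open>w1 \<le> g\<close> \<open>g < w2\<close>] f(1)] by blast
  then show False using f(2) N(2) unfolding P_def by fastforce
qed

lemma Times_lepoll_w2: "A \<lesssim> {..<w2} \<Longrightarrow> B \<lesssim> {..<w2} \<Longrightarrow> A \<times> B \<lesssim> {..<w2}"
proof -
  assume "A \<lesssim> {..<w2}" "B \<lesssim> {..<w2}"
  have "infinite {..<w2}" using infinite_w1 w1_less_w2 by (meson finite_subset lessThan_subset_iff less_imp_le)
  moreover have "{a} \<times> B \<lesssim> {..<w2}" for a
    by (rule lepoll_trans1[OF times_singleton_eqpoll \<open>B \<lesssim> {..<w2}\<close>])
  ultimately have "(\<Union>a\<in>A. {a} \<times> B) \<lesssim> {..<w2}"
    using \<open>A \<lesssim> {..<w2}\<close> by (intro UN_lepoll_infinite)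
  moreover have "A \<times> B = (\<Union>a\<in>A. {a} \<times> B)" by auto
  ultimately show ?thesis by metis
qed

text \<open>For the family of all images of countable ordinals under the maps \<open>e g\<close>,
  the stationarity required by \<open>decode_surj\<close> is trivial. The family has size at most
  omega2, so there are at most omega2 decodings.\<close>

theorem reals_lepoll_w2:
  assumes SRP: "SRP_omega2 TYPE('v)"
  shows "(UNIV :: nat set set) \<lesssim> {..<w2}"
proof -
  define F where "F = (\<lambda>(g, x). e g ` {..<x}) ` ({..<w2} \<times> {..<w1})"
  have "{x. x < w1 \<and> e g ` {..<x} \<in> F} = {..<w1}" if "g < w2" for g using that unfolding F_def by auto
  moreover have "stat {..<w1}"
    unfolding stat_def
  proof (intro conjI allI impI)
    fix f assume "selfmap f"
    obtain a where "a < w1" using ex_less_w1 by blast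
    then obtain d where "d \<in> closure_points f" using closure_points_unbounded[OF \<open>selfmap f\<close>] by metis
    then show "{..<w1} \<inter> closure_points f \<noteq> {}" using closure_pointsD(1) by blast
  qed simp
  ultimately have "\<exists>h<w2. \<exists>X\<in>F. \<exists>Y\<in>F. \<exists>Z\<in>F. decode h X Y Z = r" for r
    using decode_surj[OF SRP, of F] by simp
  then have "r \<in> (\<lambda>(h, X, Y, Z). decode h X Y Z) ` ({..<w2} \<times> F \<times> F \<times> F)" for r
  proof -
    obtain h X Y Z where "h < w2" "X \<in> F" "Y \<in> F" "Z \<in> F" "decode h X Y Z = r"
      using \<open>\<And>r. \<exists>h<w2. \<exists>X\<in>F. \<exists>Y\<in>F. \<exists>Z\<in>F. decode h X Y Z = r\<close>[of r] by blast
    then show ?thesis by (intro image_eqI[of _ _ "(h, X, Y, Z)"]) simp_all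
  qed
  then have "UNIV \<subseteq> (\<lambda>(h, X, Y, Z). decode h X Y Z) ` ({..<w2} \<times> F \<times> F \<times> F)" by blast
  then have "(UNIV :: nat set set) \<lesssim> {..<w2} \<times> F \<times> F \<times> F" by (rule subset_image_lepoll)
  moreover have "{..<w1} \<lesssim> {..<w2}" using w1_less_w2 by (intro subset_imp_lepoll) auto
  then have "F \<lesssim> {..<w2}"
    unfolding F_def by (rule lepoll_trans[OF image_lepoll Times_lepoll_w2[OF lepoll_refl]])
  then have "{..<w2} \<times> F \<times> F \<times> F \<lesssim> {..<w2}" by (intro Times_lepoll_w2 lepoll_refl)
  ultimately show ?thesis by (rule lepoll_trans)
qed

section \<open>Antichains of stationary subsets of omega1 have size at most omega1\<close>

definition code :: "'v ordinal set \<Rightarrow> 'v" where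
  "code T = (SOME x. elts x = val ` T)"

lemma elts_code: "T \<lesssim> {..<w2} \<Longrightarrow> elts (code T) = val ` T"
proof -
  assume "T \<lesssim> {..<w2}"
  then have "val ` T \<lesssim> elts (val w2)" unfolding elts_val val_image_lepoll .
  then have "\<exists>x. elts x = val ` T" by (rule ex_elts_lepoll)
  then show ?thesis unfolding code_def by (rule someI_ex)
qed

lemma code_hered:
  assumes T: "T \<subseteq> {..<w1}" shows "code T \<in> Hw2"
proof -
  have "T \<lesssim> {..<w2}" using T w1_less_w2 by (intro subset_imp_lepoll) auto
  have "trcl (code T) \<subseteq> omega1"
  proof (rule trcl_subset)
    show "elts (code T) \<subseteq> omega1" unfolding elts_code[OF \<open>T \<lesssim> {..<w2}\<close>] omega1_eq using T by (rule image_mono)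
    show "elts y \<subseteq> omega1" if "y \<in> omega1" for y :: 'v
      using that Ord_elts_subset[OF Ord_val[of w1]] unfolding elts_w1 by blast
  qed
  then have "trcl (code T) \<prec> (omega2 :: 'v set)" by (intro lesspoll_omega2 subset_imp_lepoll)
  then show ?thesis unfolding hered_def by blast
qed

text \<open>The bound is proved for a maximal antichain \<open>B\<close> above \<open>A\<close>.
  Maximality ensures that the sets Y which contain the code of some T in \<open>B\<close> with Y
  \<inter> omega1 \<in> T can be found in every club over every stationary set. The union
  \<open>U\<close> of a chain of such sets turns out to contain the codes of all members of
  \<open>B\<close>.\<close>

theorem antichain_lepoll:
  assumes SRP: "SRP_omega2 TYPE('v)" and stat: "\<And>T. T \<in> A \<Longrightarrow> stat T"
    and anti: "\<And>T T'. \<lbrakk>T \<in> A; T' \<in> A; stat (T \<inter> T')\<rbrakk> \<Longrightarrow> T = T'"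
  shows "A \<lesssim> {..<w1}"
proof -
  define fam where "fam = {B. A \<subseteq> B \<and> (\<forall>T\<in>B. stat T) \<and> (\<forall>T\<in>B. \<forall>T'\<in>B. stat (T \<inter> T') \<longrightarrow> T = T')}"
  have "A \<in> fam" using assms unfolding fam_def by blast
  moreover have "\<Union>K \<in> fam" if "K \<noteq> {}" "subset.chain fam K" for K
  proof -
    have K: "\<And>B. B \<in> K \<Longrightarrow> B \<in> fam" "\<And>B B'. B \<in> K \<Longrightarrow> B' \<in> K \<Longrightarrow> B \<subseteq> B' \<or> B' \<subseteq> B"
      using that(2) unfolding subset_chain_def by auto
    have "T = T'" if T: "T \<in> \<Union>K" "T' \<in> \<Union>K" "stat (T \<inter> T')" for T T'
    proof -
      obtain B B' where "B \<in> K" "T \<in> B" "B' \<in> K" "T' \<in> B'" using T by blast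
      then have "\<exists>B\<in>K. T \<in> B \<and> T' \<in> B" using K(2)[of B B'] by blast
      then obtain B where "B \<in> K" "T \<in> B" "T' \<in> B" by blast
      then show ?thesis using K(1) T(3) unfolding fam_def by blast
    qed
    moreover have "A \<subseteq> \<Union>K" "\<forall>T\<in>\<Union>K. stat T" using K(1) \<open>K \<noteq> {}\<close> unfolding fam_def by blast+
    ultimately show ?thesis unfolding fam_def by blast
  qed
  ultimately obtain B where B: "B \<in> fam" "\<And>B'. B' \<in> fam \<Longrightarrow> B \<subseteq> B' \<Longrightarrow> B' = B"
    using subset_Zorn_nonempty[of fam] by blast
  have Bstat: "stat T" if "T \<in> B" for T using B(1) that unfolding fam_def by blast
  have Banti: "T = T'" if "T \<in> B" "T' \<in> B" "stat (T \<inter> T')" for T T' using B(1) that unfolding fam_def by blast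
  have maximal: "\<exists>T\<in>B. stat (S \<inter> T)" if S: "stat S" for S
  proof (rule ccontr)
    assume *: "\<not> ?thesis"
    then have "insert S B \<in> fam" using B(1) S unfolding fam_def by (auto simp: Int_commute)
    then have "S \<in> B" using B(2) by blast
    then show False using * S by auto
  qed
  have elts_code': "elts (code T) = val ` T" if "T \<subseteq> {..<w1}" for T
    using that w1_less_w2 by (intro elts_code subset_imp_lepoll) auto
  have code_H: "code T \<in> Hw2" if "T \<in> B" for T
    using Bstat[OF that] unfolding stat_def by (intro code_hered) blast
  have code_inj: "inj_on code B"
  proof (rule inj_onI)
    fix T T' assume *: "T \<in> B" "T' \<in> B" "code T = code T'"
    then have "val ` T = val ` T'" using elts_code' Bstat unfolding stat_def by metis
    then show "T = T'" unfolding inj_image_eq_iff[OF inj_val] .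
  qed
  define P where "P = {Y \<in> ctbl_subsets Hw2. \<exists>T\<in>B. code T \<in> Y \<and> (\<exists>d\<in>T. trace Y \<inter> {..<w1} = {..<d})}"
  have "\<exists>Y\<in>P \<inter> C. \<exists>d\<in>S. trace Y \<inter> {..<w1} = {..<d}" if S: "stat S" and C: "club_in Hw2 C" for S C
  proof -
    obtain T where T: "T \<in> B" "stat (S \<inter> T)" using maximal[OF S] by blast
    obtain G where G: "\<And>s. finite s \<Longrightarrow> countable (G s)" "\<And>s. G s \<subseteq> Hw2"
      "\<And>X. X \<in> ctbl_subsets Hw2 \<Longrightarrow> closed_under G X \<Longrightarrow> X \<in> C"
      using club_in_imp_closed_under[OF C] by metis
    obtain f where f: "selfmap f" "\<And>d. d \<in> closure_points f \<Longrightarrow>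
        trace (hull_under G (val ` {..<d} \<union> {code T})) \<inter> {..<w1} = {..<d}"
      by (rule hull_trace_closure_points[of G "{code T}"]) (use G(1) in auto)
    obtain d where d: "d \<in> S" "d \<in> T" "d \<in> closure_points f" using statD[OF T(2) f(1)] by blast
    define Y where "Y = hull_under G (val ` {..<d} \<union> {code T})"
    have "countable (val ` {..<d} \<union> {code T})" using less_w1 closure_pointsD(1)[OF d(3)] by simp
    then have "countable Y" unfolding Y_def using G(1) by (rule countable_hull_under)
    moreover have "Y \<subseteq> Hw2" unfolding Y_def
    proof (rule hull_under_least)
      have "{..<d} \<subseteq> {..<w2}" using closure_pointsD(1)[OF d(3)] w1_less_w2 by auto
      then have "val ` {..<d} \<subseteq> Hw2" by (rule order_trans[OF image_mono emb_subset])
      then show "val ` {..<d} \<union> {code T} \<subseteq> Hw2" using code_H[OF T(1)] by simp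
      show "closed_under G Hw2" using G(2) unfolding closed_under_def by blast
    qed
    ultimately have Y: "Y \<in> ctbl_subsets Hw2" unfolding ctbl_subsets_def by blast
    then have "Y \<in> C" using G(3) closed_hull_under unfolding Y_def by blast
    moreover have "code T \<in> Y" using subset_hull_under unfolding Y_def by fastforce
    moreover have tr: "trace Y \<inter> {..<w1} = {..<d}" using f(2)[OF d(3)] unfolding Y_def .
    ultimately have "Y \<in> P \<inter> C" using Y T(1) d(2) unfolding P_def by blast
    then show ?thesis using tr d(1) by blast
  qed
  then obtain N where N: "filtration N" "\<And>x. x < w1 \<Longrightarrow> N x \<in> P"
    and w1N: "{..<w1} \<subseteq> trace (\<Union>x<w1. N x)"
    using SRP_chain[OF SRP, of P] unfolding P_def by blast
  define U where "U = (\<Union>x<w1. N x)"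
  have U: "U \<lesssim> {..<w1}" unfolding U_def by (rule filtration_lepoll[OF N(1)])
  obtain a where "a < w1" using ex_less_w1 by blast
  then obtain u where "u \<in> U" using w1N unfolding U_def trace_def by blast
  obtain E0 where E0: "U \<subseteq> E0 ` {..<w1}" using U unfolding lepoll_iff by blast
  define E where "E c = (if E0 c \<in> U then E0 c else u)" for c
  have "E ` {..<w1} = U" unfolding E_def using E0 \<open>u \<in> U\<close> by (auto simp: image_iff)
  then have "(\<Union>x<w1. N x) = (\<Union>x<w1. E ` {..<x})"
    unfolding image_UN[symmetric] initial_segments_UN U_def[symmetric] by simp
  from filtration_agree[OF N(1) filtration_image this]
  obtain f1 where f1: "selfmap f1" "\<And>d. d \<in> closure_points f1 \<Longrightarrow> N d = E ` {..<d}" by metis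
  have "filtration (\<lambda>x. trace (N x) \<inter> {..<w1})" by (intro filtration_Int filtration_trace N(1))
  moreover have "filtration (\<lambda>x. {..<x})" using filtration_image[of "\<lambda>x. x"] by simp
  moreover have "(\<Union>x<w1. trace (N x) \<inter> {..<w1}) = (\<Union>x<w1. {..<x})"
    using w1N unfolding trace_UN initial_segments_UN by blast
  ultimately obtain f2 where f2: "selfmap f2"
    "\<And>d. d \<in> closure_points f2 \<Longrightarrow> trace (N d) \<inter> {..<w1} = {..<d}"
    using filtration_agree[of "\<lambda>x. trace (N x) \<inter> {..<w1}" "\<lambda>x. {..<x}"] by metis
  have "code T \<in> U" if T: "T \<in> B" for T
  proof -
    \<comment> \<open>On \<open>S\<close> the model \<open>N x\<close> is the image of
      \<open>{..<x}\<close> under \<open>E\<close> and meets omega1 in x. It therefore contains the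
      code of a member of \<open>B\<close> containing x, listed by \<open>E\<close> at an index
      below x. Fodor's lemma fixes this member on a stationary set, and the antichain condition
      identifies it with \<open>T\<close>.\<close>
    define S where "S = T \<inter> closure_points f1 \<inter> closure_points f2"
    have S: "stat S" unfolding S_def by (intro stat_Int_closure_points Bstat T f1(1) f2(1))
    have "\<exists>y T'. y < x \<and> T' \<in> B \<and> E y = code T' \<and> x \<in> T'" if "x \<in> S" for x
    proof -
      have x: "x \<in> closure_points f1" "x \<in> closure_points f2" "x < w1"
        using that closure_pointsD(1) unfolding S_def by blast+
      obtain T' d where T': "T' \<in> B" "code T' \<in> N x" "d \<in> T'" "trace (N x) \<inter> {..<w1} = {..<d}"
        using N(2)[OF x(3)] unfolding P_def by blast
      have "d = x" using T'(4) f2(2)[OF x(2)] by (metis lessThan_eq_iff)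
      then show ?thesis using T' f1(2)[OF x(1)] by fastforce
    qed
    then obtain y T' where yT: "\<And>x. x \<in> S \<Longrightarrow> y x < x \<and> T' x \<in> B \<and> E (y x) = code (T' x) \<and> x \<in> T' x" by metis
    then obtain c where c: "stat {x \<in> S. y x = c}" using Fodor[OF S, of y] by blast
    obtain x0 where x0: "x0 \<in> S" "y x0 = c" using stat_unbounded[OF c \<open>a < w1\<close>] by blast
    have "{x \<in> S. y x = c} \<subseteq> T \<inter> T' x0"
    proof
      fix x assume x: "x \<in> {x \<in> S. y x = c}"
      then have "code (T' x) = code (T' x0)" using yT[of x] yT[OF x0(1)] x0(2) by auto
      then have "T' x = T' x0" using code_inj yT[of x] yT[OF x0(1)] x by (auto dest: inj_onD)
      then show "x \<in> T \<inter> T' x0" using yT[of x] x unfolding S_def by auto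
    qed
    then have "stat (T \<inter> T' x0)" using c Bstat[OF T] stat_mono unfolding stat_def by (meson le_infI1)
    then have "T = T' x0" using Banti[OF T] yT[OF x0(1)] by blast
    then have "code T = E c" using yT[OF x0(1)] x0(2) by simp
    moreover have "c < w1" using yT[OF x0(1)] x0 closure_pointsD(1) unfolding S_def by (metis IntD1 IntD2 less_trans)
    ultimately show ?thesis using \<open>E ` {..<w1} = U\<close> by blast
  qed
  then have "code ` B \<lesssim> {..<w1}" using U by (meson image_subsetI lepoll_trans subset_imp_lepoll)
  then have "B \<lesssim> {..<w1}" unfolding inj_on_image_lepoll_1[OF code_inj] .
  moreover have "A \<subseteq> B" using B(1) unfolding fam_def by blast
  ultimately show ?thesis by (meson lepoll_trans subset_imp_lepoll)
qed

end

section \<open>Coding countable sets of ordinals by reals\<close>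

function collapse_on :: "'v::set_universe set \<Rightarrow> 'v \<Rightarrow> 'v" where
  "collapse_on d x = (SOME y. elts y = collapse_on d ` (elts x \<inter> d))"
  by pat_completeness auto
termination
  by (relation "inv_image {(x, y). mem x y} snd")
    (use foundation in \<open>auto simp: wfp_def mem_iff_elts\<close>)

declare collapse_on.simps [simp del]

lemma elts_collapse_on: "elts (collapse_on d x) = collapse_on d ` (elts x \<inter> d)"
proof -
  obtain y where "elts y = elts x \<inter> d" using ex_elts_subset[of "elts x \<inter> d" x] by blast
  then have "\<exists>z. elts z = collapse_on d ` (elts x \<inter> d)" using ex_elts_image[of "collapse_on d" y] by simp
  then have "elts (SOME z. elts z = collapse_on d ` (elts x \<inter> d)) = collapse_on d ` (elts x \<inter> d)" by (rule someI_ex)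
  then show ?thesis by (subst collapse_on.simps)
qed

lemma collapse_on_iso:
  assumes "\<And>x. x \<in> d \<Longrightarrow> elts (f x) \<inter> f ` d = f ` (elts x \<inter> d)" and "x \<in> d"
  shows "collapse_on (f ` d) (f x) = collapse_on d x"
  using assms(2)
proof (induction x rule: elts_induct)
  case (1 x)
  have "elts (collapse_on (f ` d) (f x)) = collapse_on (f ` d) ` f ` (elts x \<inter> d)"
    unfolding elts_collapse_on assms(1)[OF 1(2)] ..
  also have "\<dots> = collapse_on d ` (elts x \<inter> d)"
    unfolding image_image using 1(1) by (intro image_cong) auto
  finally show ?case using elts_inject elts_collapse_on by metis
qed

lemma inj_on_collapse_on:
  assumes "\<And>x. x \<in> d \<Longrightarrow> Ord x" shows "inj_on (collapse_on d) d"
proof (rule inj_onI, rule ccontr)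
  fix x y assume xy: "x \<in> d" "y \<in> d" "collapse_on d x = collapse_on d y" "x \<noteq> y"
  have "collapse_on d a \<noteq> collapse_on d b" if "a \<in> elts b" "a \<in> d" for a b
  proof -
    have "collapse_on d a \<in> elts (collapse_on d b)" unfolding elts_collapse_on using that by blast
    then show ?thesis using elts_irrefl by metis
  qed
  then show False using Ord_trichotomy[of x y] assms xy by metis
qed

text \<open>The enumeration is that of the transitive collapse of \<open>d\<close>, not of
  \<open>d\<close>: isomorphic sets have the same collapse and hence literally the same
  \<open>to_nat_on\<close>. So codes are invariant under \<in>-isomorphisms.\<close>

definition element_code :: "'v::set_universe set \<Rightarrow> 'v \<Rightarrow> nat" where
  "element_code d x = to_nat_on (collapse_on d ` d) (collapse_on d x)"

definition subset_code :: "'v::set_universe set \<Rightarrow> 'v set \<Rightarrow> nat set" where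
  "subset_code d y = element_code d ` y"

lemma element_code_iso:
  fixes f :: "'v::set_universe \<Rightarrow> 'v"
  assumes "\<And>x. x \<in> d \<Longrightarrow> elts (f x) \<inter> f ` d = f ` (elts x \<inter> d)" "x \<in> d"
  shows "element_code (f ` d) (f x) = element_code d x"
proof -
  have "collapse_on (f ` d) ` f ` d = collapse_on d ` d"
    unfolding image_image using collapse_on_iso[OF assms(1)] by (intro image_cong) auto
  then show ?thesis unfolding element_code_def using collapse_on_iso[OF assms] by simp
qed

lemma inj_on_element_code:
  assumes "countable d" "\<And>x. x \<in> d \<Longrightarrow> Ord x" shows "inj_on (element_code d) d"
  unfolding element_code_def
  using comp_inj_on[OF inj_on_collapse_on[OF assms(2)] inj_on_to_nat_on[OF countable_image[OF assms(1)]]]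
  by (simp add: comp_def)

lemma subset_code_iso:
  fixes f :: "'v::set_universe \<Rightarrow> 'v"
  assumes "\<And>x. x \<in> d \<Longrightarrow> elts (f x) \<inter> f ` d = f ` (elts x \<inter> d)" "y \<subseteq> d"
  shows "subset_code (f ` d) (f ` y) = subset_code d y"
  unfolding subset_code_def image_image using element_code_iso[OF assms(1)] assms(2)
  by (intro image_cong) auto

lemma decode_by_iso:
  assumes f: "inj_on f D" "\<And>x y. \<lbrakk>x \<in> D; y \<in> D\<rbrakk> \<Longrightarrow> L' (f x) (f y) \<longleftrightarrow> L x y"
    and D: "h \<in> D" "X \<subseteq> D" "Y \<subseteq> D" "Z \<subseteq> D"
  shows "decode_by L' (f h) (f ` X) (f ` Y) (f ` Z) = decode_by L h X Y Z"
proof -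
  have fe: "f x = f y \<longleftrightarrow> x = y" if "x \<in> D" "y \<in> D" for x y using f(1) that by (auto dest: inj_onD)
  have "f x \<in> marks_by L' (f h) (f ` X) (f ` Y) (f ` Z) \<longleftrightarrow> x \<in> marks_by L h X Y Z" if "x \<in> X" for x
  proof -
    have "(f h = f y \<or> L' (f h) (f y)) = (h = y \<or> L h y)" if "y \<in> X" for y
      using fe[of h y] f(2)[of h y] D that by blast
    moreover have "L' (f y) (f x) = L y x" if "y \<in> X" for y using f(2) D(2) that \<open>x \<in> X\<close> by blast
    moreover have "(L' (f y) (f w) \<and> L' (f w) (f x)) = (L y w \<and> L w x)" if "y \<in> X" "w \<in> Y \<union> Z" for y w
      using f(2) D that \<open>x \<in> X\<close> by blast
    ultimately show ?thesis
      using \<open>x \<in> X\<close> unfolding marks_by_def image_Un[symmetric] by simp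
  qed
  moreover have "marks_by L' (f h) (f ` X) (f ` Y) (f ` Z) \<subseteq> f ` X" unfolding marks_by_def by blast
  moreover have sub: "marks_by L h X Y Z \<subseteq> X" unfolding marks_by_def by blast
  ultimately have m: "marks_by L' (f h) (f ` X) (f ` Y) (f ` Z) = f ` marks_by L h X Y Z" by blast
  define m where "m = marks_by L h X Y Z"
  have mD: "m \<subseteq> D" using sub D(2) unfolding m_def by blast
  have "card {y \<in> f ` m. L' y (f x)} = card {y \<in> m. L y x}" if "x \<in> m" for x
  proof -
    have "{y \<in> f ` m. L' y (f x)} = f ` {y \<in> m. L y x}" using f(2) mD that by blast
    moreover have "inj_on f {y \<in> m. L y x}" by (rule inj_on_subset[OF f(1)]) (use mD in blast)
    ultimately show ?thesis by (simp add: card_image)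
  qed
  moreover have "{x \<in> f ` m. \<exists>y\<in>f ` Y. L' x y \<and> \<not> (\<exists>w\<in>f ` Z. L' x w \<and> L' w y)} =
      f ` {x \<in> m. \<exists>y\<in>Y. L x y \<and> \<not> (\<exists>w\<in>Z. L x w \<and> L w y)}"
  proof -
    have *: "(\<exists>y\<in>f ` Y. L' (f x) y \<and> \<not> (\<exists>w\<in>f ` Z. L' (f x) w \<and> L' w y)) =
        (\<exists>y\<in>Y. L x y \<and> \<not> (\<exists>w\<in>Z. L x w \<and> L w y))" if "x \<in> m" for x
    proof -
      have "L' (f x) (f y) = L x y" if "y \<in> Y" for y using f(2) mD D(3) \<open>x \<in> m\<close> that by blast
      moreover have "L' (f x) (f w) = L x w" if "w \<in> Z" for w using f(2) mD D(4) \<open>x \<in> m\<close> that by blast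
      moreover have "L' (f w) (f y) = L w y" if "w \<in> Z" "y \<in> Y" for w y using f(2) D(3,4) that by blast
      ultimately show ?thesis by simp
    qed
    show ?thesis unfolding Compr_image_eq by (intro arg_cong[where f = "image f"] Collect_cong conj_cong refl *)
  qed
  ultimately show ?thesis
    unfolding decode_by_def m m_def[symmetric] by (simp only: image_image) (rule image_cong, simp_all)
qed

section \<open>Guessing models and their collapses\<close>

definition the_set :: "'v::set_universe set \<Rightarrow> 'v" where
  "the_set A = (SOME x. elts x = A)"

lemma elts_the_set: "A \<subseteq> elts x \<Longrightarrow> elts (the_set A) = A"
  unfolding the_set_def using ex_elts_subset by (rule someI_ex)

context omega_1_2 begin

text \<open>Transfers clubs of omega1 to clubs on a set enumerated in type omega1, so that internal
  stationarity can be tested along the enumeration.\<close>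

lemma club_of_enumeration:
  assumes E: "E ` {..<w1} = M" and f: "selfmap f"
  shows "club_in M ((\<lambda>x. E ` {..<x}) ` closure_points f)"
  unfolding club_in_def
proof (intro conjI ballI allI impI)
  show "(\<lambda>x. E ` {..<x}) ` closure_points f \<subseteq> ctbl_subsets M"
  proof
    fix Y assume "Y \<in> (\<lambda>x. E ` {..<x}) ` closure_points f"
    then obtain x where x: "Y = E ` {..<x}" "x < w1" using closure_pointsD(1) by blast
    then have "{..<x} \<subseteq> {..<w1}" by auto
    then have "Y \<subseteq> M" unfolding x(1) E[symmetric] by (rule image_mono)
    then show "Y \<in> ctbl_subsets M" using x less_w1 unfolding ctbl_subsets_def by simp
  qed
  fix Y assume "Y \<in> ctbl_subsets M"
  then have Y: "Y \<subseteq> E ` {..<w1}" "countable Y" unfolding ctbl_subsets_def E by auto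
  then obtain Y' where Y': "Y' \<subseteq> {..<w1}" "countable Y'" "Y = E ` Y'" by (meson countable_subset_image)
  obtain b where b: "b < w1" "\<forall>a\<in>Y'. a < b" using bounded_w1[OF Y'(2,1)] by blast
  obtain d where d: "d \<in> closure_points f" "b < d" using closure_points_unbounded[OF f b(1)] .
  have "Y' \<subseteq> {..<d}" using b(2) d(2) by auto
  then have "Y \<subseteq> E ` {..<d}" unfolding Y'(3) by (rule image_mono)
  then show "\<exists>D\<in>(\<lambda>x. E ` {..<x}) ` closure_points f. Y \<subseteq> D" using d(1) by blast
next
  fix K assume K: "K \<noteq> {} \<and> countable K \<and> subset.chain ((\<lambda>x. E ` {..<x}) ` closure_points f) K"
  then have "\<forall>Y\<in>K. \<exists>x. x \<in> closure_points f \<and> Y = E ` {..<x}" unfolding subset_chain_def by blast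
  then obtain p where p: "\<And>Y. Y \<in> K \<Longrightarrow> p Y \<in> closure_points f" "\<And>Y. Y \<in> K \<Longrightarrow> Y = E ` {..<p Y}" by metis
  define X where "X = p ` K"
  have X: "countable X" "X \<noteq> {}" "X \<subseteq> closure_points f" using K p(1) unfolding X_def by auto
  have KX: "K = (\<lambda>x. E ` {..<x}) ` X" unfolding X_def image_image using p(2) by auto
  have "X \<subseteq> {..<w1}" using X(3) closure_pointsD(1) by blast
  then obtain b where b: "b < w1" "\<forall>a\<in>X. a < b" using bounded_w1[OF X(1)] by blast
  define d where "d = (LEAST d. \<forall>x\<in>X. x \<le> d)"
  have le_b: "\<forall>x\<in>X. x \<le> b" using b(2) by (simp add: less_imp_le)
  have d: "x \<le> d" if "x \<in> X" for x unfolding d_def using LeastI[of "\<lambda>d. \<forall>x\<in>X. x \<le> d", OF le_b] that by blast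
  have "d < w1" using Least_le[of "\<lambda>d. \<forall>x\<in>X. x \<le> d", OF le_b] b(1) unfolding d_def by simp
  have ex: "\<exists>x\<in>X. y < x" if "y < d" for y
    using not_less_Least[of y "\<lambda>d. \<forall>x\<in>X. x \<le> d"] that unfolding d_def by (auto simp: not_le)
  have "f y < d" if "y < d" for y
  proof -
    from ex[OF that] obtain x where "x \<in> X" "y < x" by blast
    then have "f y < x" using closure_pointsD(2)[of x f y] X(3) by blast
    then show ?thesis using d[OF \<open>x \<in> X\<close>] by simp
  qed
  moreover have "\<exists>x. x < d"
  proof -
    obtain x where x: "x \<in> X" using X(2) by blast
    then obtain z where "z < x" using X(3) unfolding closure_points_def by blast
    then show ?thesis using d[OF x] by (meson less_le_trans)
  qed
  ultimately have "d \<in> closure_points f" unfolding closure_points_def using \<open>d < w1\<close> by blast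
  moreover have "(\<Union>x\<in>X. {..<x}) = {..<d}"
  proof (intro equalityI subsetI)
    fix y assume "y \<in> (\<Union>x\<in>X. {..<x})"
    then show "y \<in> {..<d}" using d by (auto intro: less_le_trans)
  qed (use ex in auto)
  then have "\<Union>K = E ` {..<d}" unfolding KX image_UN[symmetric] by (simp flip: image_UN)
  ultimately show "\<Union>K \<in> (\<lambda>x. E ` {..<x}) ` closure_points f" by blast
qed

end

section \<open>Reals inside the universe and the closure operations\<close>

context omega_2_exists begin

lemma countable_omega0: "countable (omega0 :: 'v set)"
proof -
  have "inj_on card ((\<lambda>a :: 'v ordinal. {..<a}) ` {a. finite {..<a}})"
  proof (rule inj_onI)
    fix x y assume "x \<in> (\<lambda>a :: 'v ordinal. {..<a}) ` {a. finite {..<a}}"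
      "y \<in> (\<lambda>a :: 'v ordinal. {..<a}) ` {a. finite {..<a}}" "card x = card y"
    then obtain b c where bc: "x = {..<b}" "y = {..<c}" "finite x" "finite y" by blast
    have "x \<subseteq> y \<or> y \<subseteq> x" unfolding bc by (metis lessThan_subset_iff linear)
    then show "x = y" using bc \<open>card x = card y\<close> card_subset_eq by metis
  qed
  then have "countable ((\<lambda>a :: 'v ordinal. {..<a}) ` {a. finite {..<a}})" by (rule countableI')
  moreover have "inj_on (\<lambda>a :: 'v ordinal. {..<a}) {a. finite {..<a}}" by (intro inj_onI) (metis lessThan_eq_iff)
  ultimately have "countable {a :: 'v ordinal. finite {..<a}}" by (rule countable_image_inj_on)
  moreover have "omega0 \<subseteq> val ` {a :: 'v ordinal. finite {..<a}}"
  proof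
    fix x :: 'v assume "x \<in> omega0"
    then obtain b where "x = val b" "finite (elts (val b))" unfolding omega0_def using ex_ordinal by blast
    moreover have "inj_on val {..<b}" using inj_val by (rule inj_on_subset) simp
    ultimately show "x \<in> val ` {a. finite {..<a}}" unfolding elts_val by (auto dest: finite_imageD)
  qed
  ultimately show ?thesis by (meson countable_image countable_subset)
qed

definition nat_ord :: "nat \<Rightarrow> 'v ordinal" where
  "nat_ord = (SOME f. inj f \<and> range f \<subseteq> {..<w1})"

lemma nat_ord: "inj nat_ord" "nat_ord n < w1"
proof -
  have "\<exists>f :: nat \<Rightarrow> 'v ordinal. inj f \<and> range f \<subseteq> {..<w1}"
    using infinite_w1 infinite_iff_countable_subset by blast
  then have "inj nat_ord \<and> range nat_ord \<subseteq> {..<w1}" unfolding nat_ord_def by (rule someI_ex)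
  then show "inj nat_ord" "nat_ord n < w1" by auto
qed

text \<open>Reals are represented inside the universe through \<open>nat_ord\<close>, which need not enumerate
  the finite ordinals.\<close>

definition real_of :: "nat set \<Rightarrow> 'v" where
  "real_of r = code (nat_ord ` r)"

definition of_real :: "'v \<Rightarrow> nat set" where
  "of_real x = {n. val (nat_ord n) \<in> elts x}"

lemma nat_ord_image: "nat_ord ` r \<subseteq> {..<w1}"
  using nat_ord(2) by blast

lemma elts_real_of: "elts (real_of r) = val ` nat_ord ` r"
proof -
  have "nat_ord ` r \<subseteq> {..<w2}" using nat_ord_image[of r] w1_less_w2 by (auto intro: less_trans)
  then show ?thesis unfolding real_of_def by (intro elts_code subset_imp_lepoll)
qed

lemma of_real_real_of [simp]: "of_real (real_of r) = r"
  unfolding of_real_def elts_real_of using inj_val nat_ord(1) by (auto simp: inj_def)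

lemma real_of_hered: "real_of r \<in> Hw2"
  unfolding real_of_def by (rule code_hered[OF nat_ord_image])

text \<open>The enumeration is fixed once and for all, independently of any model. Closure under
  \<open>op_real\<close> and \<open>op_index\<close> makes the reals of a model exactly those
  indexed by its ordinals below omega2.\<close>

definition real_index :: "'v ordinal \<Rightarrow> nat set" where
  "real_index = (SOME g. g ` {..<w2} = UNIV)"

lemma real_index_surj:
  assumes "SRP_omega2 TYPE('v)" shows "real_index ` {..<w2} = UNIV"
proof -
  obtain g where "(UNIV :: nat set set) \<subseteq> g ` {..<w2}"
    using reals_lepoll_w2[OF assms] unfolding lepoll_iff by blast
  then have "\<exists>g. g ` {..<w2} = (UNIV :: nat set set)" by blast
  then show ?thesis unfolding real_index_def by (rule someI_ex)
qed

text \<open>For a model M containing omega1 and closed under these maps, a countable d in M is a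
  subset of M, and an uncountable d in M has uncountably many elements in M. Hence a set in M with
  countable collapse is countable and contained in M.\<close>

definition enum_elts :: "'v \<Rightarrow> 'v \<Rightarrow> 'v" where
  "enum_elts d = (SOME f. if countable (elts d) then f ` omega1 = elts d
     else inj_on f omega1 \<and> f ` omega1 \<subseteq> elts d)"

lemma enum_elts:
  assumes "elts d \<noteq> {}"
  shows "if countable (elts d) then enum_elts d ` omega1 = elts d
    else inj_on (enum_elts d) omega1 \<and> enum_elts d ` omega1 \<subseteq> elts d"
proof -
  have "\<exists>f :: 'v \<Rightarrow> 'v. if countable (elts d) then f ` omega1 = elts d else inj_on f omega1 \<and> f ` omega1 \<subseteq> elts d"
  proof (cases "countable (elts d)")
    case True
    have "infinite (omega1 :: 'v set)"
      unfolding omega1_eq using infinite_w1 inj_val by (metis finite_imageD inj_on_subset subset_UNIV)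
    then have "elts d \<lesssim> (omega1 :: 'v set)" by (rule countable_lepoll_infinite[OF True])
    then obtain g where g: "elts d \<subseteq> g ` (omega1 :: 'v set)" unfolding lepoll_iff by blast
    obtain c where "c \<in> elts d" using assms by blast
    then have "(\<lambda>x. if g x \<in> elts d then g x else c) ` omega1 = elts d" using g by (auto simp: image_iff)
    then have "\<exists>f :: 'v \<Rightarrow> 'v. f ` omega1 = elts d"
      by (intro exI[of "\<lambda>f. f ` omega1 = elts d" "\<lambda>x. if g x \<in> elts d then g x else c"])
    then show ?thesis using True by simp
  next
    case False
    define P where "P f x v \<longleftrightarrow> (x < w1 \<longrightarrow> v \<in> elts d - f ` {..<x})" for f :: "'v ordinal \<Rightarrow> 'v" and x v
    have "\<exists>f. \<forall>x. P f x (f x)"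
    proof (rule dependent_wf_choice[OF wf])
      show "P f x v = P f' x v" if "\<And>z. (z, x) \<in> {(x, y). x < y} \<Longrightarrow> f z = f' z" for f f' x v
      proof -
        have "f ` {..<x} = f' ` {..<x}" using that by (intro image_cong) auto
        then show ?thesis unfolding P_def by simp
      qed
      fix x f
      show "\<exists>v. P f x v"
      proof (cases "x < w1")
        case True
        then have "countable (f ` {..<x})" using less_w1 by simp
        then have "\<not> elts d \<subseteq> f ` {..<x}" using False countable_subset by blast
        then show ?thesis unfolding P_def by blast
      qed (simp add: P_def)
    qed
    then obtain f where f: "\<And>x. x < w1 \<Longrightarrow> f x \<in> elts d - f ` {..<x}" unfolding P_def by blast
    have inj: "inj_on f {..<w1}"
    proof (rule linorder_inj_onI)
      show "f x \<noteq> f y" if "x < y" "x \<in> {..<w1}" "y \<in> {..<w1}" for x y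
        using f[of y] that by (metis DiffD2 imageI lessThan_iff)
    qed auto
    have "inj_on (\<lambda>x. f (the_inv val x)) omega1"
      unfolding omega1_eq by (rule inj_onI) (use inj in \<open>auto simp: the_inv_f_f[OF inj_val] dest: inj_onD\<close>)
    moreover have "(\<lambda>x. f (the_inv val x)) ` omega1 \<subseteq> elts d"
      unfolding omega1_eq image_image the_inv_f_f[OF inj_val] using f by auto
    ultimately have "inj_on (\<lambda>x. f (the_inv val x)) omega1 \<and> (\<lambda>x. f (the_inv val x)) ` omega1 \<subseteq> elts d" ..
    then show ?thesis using False by auto
  qed
  then show ?thesis unfolding enum_elts_def by (rule someI_ex)
qed


text \<open>By normality, almost all \<open>M\<close> are closed under the following operations.\<close>

definition op_enum :: "'v list \<Rightarrow> 'v" where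
  "op_enum l = enum_elts (l ! 0) (l ! 1)"

definition op_Int :: "'v list \<Rightarrow> 'v" where
  "op_Int l = the_set (elts (l ! 0) \<inter> elts (l ! 1))"

definition op_subset :: "'v list \<Rightarrow> 'v" where
  "op_subset l = the_set {x \<in> elts (l ! 0). to_nat_on (elts (l ! 0)) x \<in> of_real (l ! 1)}"

definition op_code :: "'v list \<Rightarrow> 'v" where
  "op_code l = real_of (subset_code (elts (l ! 0)) (elts (l ! 1)))"

definition op_uncode :: "'v list \<Rightarrow> 'v" where
  "op_uncode l = the_set {x \<in> elts (l ! 0). element_code (elts (l ! 0)) x \<in> of_real (l ! 1)}"

definition op_decode :: "'v list \<Rightarrow> 'v" where
  "op_decode l = real_of (decode_by mem (l ! 0) (elts (l ! 1)) (elts (l ! 2)) (elts (l ! 3)))"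

definition op_real :: "'v list \<Rightarrow> 'v" where
  "op_real l = real_of (real_index (the_inv val (l ! 0)))"

definition op_index :: "'v list \<Rightarrow> 'v" where
  "op_index l = val (SOME b. b < w2 \<and> real_index b = of_real (l ! 0))"

definition ops :: "('v list \<Rightarrow> 'v) set" where
  "ops = {op_enum, op_Int, op_subset, op_code, op_uncode, op_decode, op_real, op_index}"

text \<open>The images of \<open>{..<x}\<close> under \<open>e g\<close> form the standard
  filtration of g; the places where it enters \<open>H\<close> show whether the countable subsets of
  g lying in \<open>H\<close> are stationary.\<close>

definition hits :: "'v set \<Rightarrow> 'v ordinal \<Rightarrow> 'v ordinal set" where
  "hits H g = {x. x < w1 \<and> (\<exists>w\<in>H. elts w = val ` e g ` {..<x})}"

text \<open>What the tree argument uses of a collapse, stated without reference to the original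
  model. Membership of countable subsets of a given countable set of ordinals depends on
  \<open>R\<close> alone, which allows the comparison of different \<open>H\<close>.\<close>

definition good_model :: "nat set set \<Rightarrow> 'v set \<Rightarrow> bool" where
  "good_model R H \<longleftrightarrow> (\<forall>x\<in>H. elts x \<subseteq> H) \<and> H \<lesssim> (omega1 :: 'v set) \<and> val w1 \<in> H \<and>
     (\<forall>d\<in>H. countable (elts d) \<and> elts d \<subseteq> Collect Ord \<longrightarrow>
        (\<forall>y\<subseteq>elts d. (\<exists>w\<in>H. elts w = y) \<longleftrightarrow> subset_code (elts d) y \<in> R)) \<and>
     (\<forall>h X Y Z. val h \<in> H \<and> X \<in> H \<and> Y \<in> H \<and> Z \<in> H \<and>
        (\<forall>S\<in>{X, Y, Z}. countable (elts S) \<and> elts S \<subseteq> Collect Ord) \<longrightarrow>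
        decode h (val -` elts X) (val -` elts Y) (val -` elts Z) \<in> R) \<and>
     (\<forall>g. w1 \<le> g \<and> g < w2 \<and> val g \<in> H \<longrightarrow> stat (hits H g))"

end

section \<open>A single guessing model and its collapse\<close>

locale nice_model = omega_2_exists w1 w2 for w1 w2 :: "'v::set_universe ordinal" +
  fixes M K :: "'v set" and \<pi> :: "'v \<Rightarrow> 'v" and a :: "'v ordinal"
  assumes Hw2_K: "Hw2 \<subseteq> K" and K_subset: "\<lbrakk>x \<in> K; elts y \<subseteq> elts x\<rbrakk> \<Longrightarrow> y \<in> K"
    and K_elt: "\<lbrakk>x \<in> K; y \<in> elts x\<rbrakk> \<Longrightarrow> y \<in> K"
    and M_K: "M \<subseteq> K" and omega1_M: "omega1 \<subseteq> M" and M_size: "M \<approx> (omega1 :: 'v set)"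
    and M_ext: "\<lbrakk>x \<in> M; y \<in> M; elts x \<inter> M = elts y \<inter> M\<rbrakk> \<Longrightarrow> x = y"
    and collapse: "x \<in> M \<Longrightarrow> elts (\<pi> x) = \<pi> ` (elts x \<inter> M)"
    and closed: "\<lbrakk>h \<in> ops; set l \<subseteq> M; h l \<in> K\<rbrakk> \<Longrightarrow> h l \<in> M"
    and IS: "stationary_in M {Y \<in> ctbl_subsets M. \<exists>x\<in>M. elts x = Y}"
    and M_w2: "M \<inter> omega2 = val ` {..<a}"
    and approx: "omega1_approximation_property (\<pi> ` M)"
    and reals: "real_index ` {..<w2} = UNIV"
begin

definition "R = real_index ` {..<a}"

lemma inj_collapse: "inj_on \<pi> M"
proof (rule inj_onI)
  fix x y assume "x \<in> M" "y \<in> M" "\<pi> x = \<pi> y"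
  then show "x = y"
  proof (induction x arbitrary: y rule: elts_induct)
    case (1 x)
    have eq: "\<pi> ` (elts x \<inter> M) = \<pi> ` (elts y \<inter> M)"
      using collapse[OF 1(2)] collapse[OF 1(3)] 1(4) by simp
    have "z \<in> elts y" if z: "z \<in> elts x" "z \<in> M" for z
    proof -
      have "\<pi> z \<in> \<pi> ` (elts y \<inter> M)" unfolding eq[symmetric] using z by blast
      then obtain z' where "z' \<in> elts y" "z' \<in> M" "\<pi> z = \<pi> z'" by blast
      then show ?thesis using 1(1)[OF z] by blast
    qed
    moreover have "z \<in> elts x" if z: "z \<in> elts y" "z \<in> M" for z
    proof -
      have "\<pi> z \<in> \<pi> ` (elts x \<inter> M)" unfolding eq using z by blast
      then obtain z' where "z' \<in> elts x" "z' \<in> M" "\<pi> z' = \<pi> z" by force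
      then show ?thesis using 1(1) z(2) by blast
    qed
    ultimately show ?case using M_ext[OF 1(2,3)] by blast
  qed
qed

lemma collapse_mem: "x \<in> M \<Longrightarrow> y \<in> M \<Longrightarrow> \<pi> x \<in> elts (\<pi> y) \<longleftrightarrow> x \<in> elts y"
  using collapse[of y] inj_collapse by (auto dest: inj_onD)

lemma transitive_H: "x \<in> \<pi> ` M \<Longrightarrow> elts x \<subseteq> \<pi> ` M"
  using collapse by blast

lemma countable_elts_M:
  assumes x: "x \<in> M" and c: "countable (elts (\<pi> x))"
  shows "elts x \<subseteq> M" "countable (elts x)" "elts (\<pi> x) = \<pi> ` elts x"
proof -
  have closed_enum: "enum_elts x y \<in> M" if "y \<in> omega1" "enum_elts x y \<in> elts x" for y
    using closed[of op_enum "[x, y]"] that x omega1_M M_K K_elt[of x]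
    by (auto simp: ops_def op_enum_def)
  have "countable (\<pi> ` (elts x \<inter> M))" using c unfolding collapse[OF x] .
  then have cM: "countable (elts x \<inter> M)"
    by (rule countable_image_inj_on) (rule inj_on_subset[OF inj_collapse], blast)
  show cx: "countable (elts x)"
  proof (rule ccontr)
    assume u: "uncountable (elts x)"
    then have "elts x \<noteq> {}" by auto
    then have en: "inj_on (enum_elts x) omega1" "enum_elts x ` omega1 \<subseteq> elts x"
      using enum_elts[of x] u by auto
    then have "enum_elts x ` omega1 \<subseteq> elts x \<inter> M" using closed_enum by blast
    then have "countable (enum_elts x ` omega1)" using cM countable_subset by blast
    then have "countable (omega1 :: 'v set)" using en(1) by (rule countable_image_inj_on)
    then show False using uncountable_w1 countable_elts_val[of w1] unfolding elts_w1 by blast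
  qed
  show sub: "elts x \<subseteq> M"
  proof
    fix y assume y: "y \<in> elts x"
    then have "elts x \<noteq> {}" by blast
    then have "y \<in> enum_elts x ` omega1" using enum_elts[of x] cx y by simp
    then obtain c where "y = enum_elts x c" "c \<in> omega1" by (rule imageE)
    then show "y \<in> M" using closed_enum[of c] y by simp
  qed
  show "elts (\<pi> x) = \<pi> ` elts x" using collapse[OF x] sub by (simp add: Int_absorb2)
qed

lemma closedD:
  "h \<in> ops \<Longrightarrow> set l \<subseteq> M \<Longrightarrow> h l \<in> Hw2 \<Longrightarrow> h l \<in> M"
  using closed Hw2_K by blast

lemma R_iff: "r \<in> R \<longleftrightarrow> real_of r \<in> M"
proof
  assume "r \<in> R"
  then obtain b where b: "b < a" "r = real_index b" unfolding R_def by blast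
  then have "val b \<in> M" using M_w2 by blast
  moreover have "op_real [val b] = real_of r" unfolding op_real_def b(2) by (simp add: the_inv_f_f[OF inj_val])
  ultimately show "real_of r \<in> M"
    using closedD[of op_real "[val b]"] real_of_hered by (simp add: ops_def)
next
  assume r: "real_of r \<in> M"
  define b where "b = (SOME b. b < w2 \<and> real_index b = r)"
  have "r \<in> real_index ` {..<w2}" unfolding reals by simp
  then have "\<exists>b. b < w2 \<and> real_index b = r" by auto
  then have "b < w2 \<and> real_index b = r" unfolding b_def by (rule someI_ex)
  then have b: "b < w2" "real_index b = r" by simp_all
  have "op_index [real_of r] = val b" unfolding op_index_def b_def by simp
  moreover have "val b \<in> Hw2" using emb_subset b(1) by blast
  ultimately have "val b \<in> M" using closedD[of op_index "[real_of r]"] r by (simp add: ops_def)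
  then have "val b \<in> val ` {..<a}" using b(1) M_w2 unfolding omega2_eq by blast
  then show "r \<in> R" using b(2) inj_val unfolding R_def by (auto simp: inj_def)
qed

text \<open>The collapse is an \<in>-isomorphism between the countable set \<open>d\<close> and its
  preimage, so a subset and its preimage have the same code. Closure under \<open>op_code\<close>
  and \<open>op_uncode\<close> gives the two directions.\<close>

lemma subset_code_iff:
  assumes d: "d \<in> \<pi> ` M" "countable (elts d)" "elts d \<subseteq> Collect Ord" and y: "y \<subseteq> elts d"
  shows "(\<exists>w\<in>\<pi> ` M. elts w = y) \<longleftrightarrow> subset_code (elts d) y \<in> R"
proof -
  obtain d' where d': "d' \<in> M" "d = \<pi> d'" using d(1) by blast
  note cd = countable_elts_M[OF d'(1) d(2)[unfolded d'(2)]]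
  have iso: "elts (\<pi> x) \<inter> \<pi> ` elts d' = \<pi> ` (elts x \<inter> elts d')" if "x \<in> elts d'" for x
  proof -
    have "x \<in> M" using cd(1) that by blast
    then have "elts (\<pi> x) \<inter> \<pi> ` elts d' = \<pi> ` (elts x \<inter> M) \<inter> \<pi> ` elts d'" using collapse by simp
    also have "\<dots> = \<pi> ` (elts x \<inter> M \<inter> elts d')"
      by (rule inj_on_image_Int[OF inj_collapse, symmetric]) (use cd(1) in auto)
    also have "elts x \<inter> M \<inter> elts d' = elts x \<inter> elts d'" using cd(1) by blast
    finally show ?thesis .
  qed
  have code: "subset_code (elts d) (\<pi> ` z) = subset_code (elts d') z" if "z \<subseteq> elts d'" for z
    using subset_code_iso[of "elts d'" \<pi>, OF iso that] unfolding d'(2) cd(3) .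
  obtain y' where y': "y' \<subseteq> elts d'" "y = \<pi> ` y'"
    using y unfolding d'(2) cd(3) by (meson subset_imageE)
  show ?thesis
  proof
    assume "\<exists>w\<in>\<pi> ` M. elts w = y"
    then obtain w where w: "w \<in> M" "elts (\<pi> w) = y" by blast
    have "countable (elts (\<pi> w))" unfolding w(2) using y d(2) by (rule countable_subset)
    note cw = countable_elts_M[OF w(1) this]
    have "\<pi> ` elts w = \<pi> ` y'" using cw(3) w(2) y'(2) by simp
    then have "elts w = y'"
      using inj_on_image_eq_iff[OF inj_collapse cw(1), of y'] y'(1) cd(1) by auto
    then have "op_code [d', w] = real_of (subset_code (elts d) y)"
      unfolding op_code_def using code[OF y'(1)] y'(2) by simp
    then have "real_of (subset_code (elts d) y) \<in> M"
      using closedD[of op_code "[d', w]"] real_of_hered w(1) d'(1) by (simp add: ops_def)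
    then show "subset_code (elts d) y \<in> R" unfolding R_iff .
  next
    assume "subset_code (elts d) y \<in> R"
    then have r: "real_of (subset_code (elts d) y) \<in> M" unfolding R_iff .
    define k where "k = op_uncode [d', real_of (subset_code (elts d) y)]"
    \<comment> \<open>Injectivity of the codes is available for sets of ordinals, and it is
      \<open>d\<close> whose elements are ordinals here. It is carried back to the preimage
      \<open>d'\<close> through the equality of codes.\<close>
    have "inj_on (element_code (elts d) \<circ> \<pi>) (elts d')"
      using inj_on_subset[OF inj_collapse cd(1)] inj_on_element_code[OF d(2)] d(3)
      unfolding d'(2) cd(3) by (intro comp_inj_on) auto
    moreover have "(element_code (elts d) \<circ> \<pi>) x = element_code (elts d') x" if "x \<in> elts d'" for x
      using element_code_iso[of "elts d'" \<pi>, OF iso that] unfolding d'(2) cd(3) by simp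
    ultimately have "inj_on (element_code (elts d')) (elts d')" by (metis inj_on_cong)
    then have "{x \<in> elts d'. element_code (elts d') x \<in> subset_code (elts d') y'} = y'"
      unfolding subset_code_def using y'(1) by (auto dest: inj_onD)
    then have "{x \<in> elts d'. element_code (elts d') x \<in> subset_code (elts d) y} = y'"
      using code[OF y'(1)] y'(2) by simp
    then have k: "elts k = y'"
      unfolding k_def op_uncode_def using elts_the_set[OF y'(1)] by simp
    have "k \<in> M"
      unfolding k_def
    proof (rule closed)
      show "op_uncode \<in> ops" unfolding ops_def by simp
      show "set [d', real_of (subset_code (elts d) y)] \<subseteq> M" using r d'(1) by simp
      have "elts (op_uncode [d', real_of (subset_code (elts d) y)]) \<subseteq> elts d'"
        using k y'(1) unfolding k_def by simp
      then show "op_uncode [d', real_of (subset_code (elts d) y)] \<in> K"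
        using K_subset d'(1) M_K by blast
    qed
    moreover have "elts (\<pi> k) = y" using collapse[OF \<open>k \<in> M\<close>] k y' cd(1) by (simp add: Int_absorb2 subset_trans)
    ultimately show "\<exists>w\<in>\<pi> ` M. elts w = y" by blast
  qed
qed

lemma decode_in_R:
  assumes h: "val h \<in> \<pi> ` M" and XYZ: "X \<in> \<pi> ` M" "Y \<in> \<pi> ` M" "Z \<in> \<pi> ` M"
    "\<And>S. S \<in> {X, Y, Z} \<Longrightarrow> countable (elts S) \<and> elts S \<subseteq> Collect Ord"
  shows "decode h (val -` elts X) (val -` elts Y) (val -` elts Z) \<in> R"
proof -
  have eq: "val ` (val -` elts S) = elts S" if "S \<in> {X, Y, Z}" for S
    using XYZ(4)[OF that] ex_ordinal by blast
  have "decode h (val -` elts X) (val -` elts Y) (val -` elts Z) =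
      decode_by mem (val h) (val ` (val -` elts X)) (val ` (val -` elts Y)) (val ` (val -` elts Z))"
    by (rule decode_by_iso[where D = UNIV, symmetric]) (auto simp: inj_val mem_iff_elts)
  also have "\<dots> = decode_by mem (val h) (elts X) (elts Y) (elts Z)" using eq by simp
  finally have 1: "decode h (val -` elts X) (val -` elts Y) (val -` elts Z) = decode_by mem (val h) (elts X) (elts Y) (elts Z)" .
  obtain h' X' Y' Z' where pre: "h' \<in> M" "val h = \<pi> h'" "X' \<in> M" "X = \<pi> X'" "Y' \<in> M" "Y = \<pi> Y'" "Z' \<in> M" "Z = \<pi> Z'"
    using h XYZ(1-3) by blast
  have c: "elts S \<subseteq> M" "elts (\<pi> S) = \<pi> ` elts S" if "S \<in> {X', Y', Z'}" for S
  proof -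
    have "S \<in> M" "countable (elts (\<pi> S))" using that pre XYZ(4) by auto
    then show "elts S \<subseteq> M" "elts (\<pi> S) = \<pi> ` elts S" using countable_elts_M by blast+
  qed
  have "decode_by mem (\<pi> h') (\<pi> ` elts X') (\<pi> ` elts Y') (\<pi> ` elts Z') =
      decode_by mem h' (elts X') (elts Y') (elts Z')"
    by (rule decode_by_iso[where D = M]) (use inj_collapse collapse_mem c(1) pre in \<open>auto simp: mem_iff_elts\<close>)
  then have 2: "decode_by mem (val h) (elts X) (elts Y) (elts Z) = decode_by mem h' (elts X') (elts Y') (elts Z')"
    unfolding pre using c(2) by simp
  have "op_decode [h', X', Y', Z'] = real_of (decode_by mem h' (elts X') (elts Y') (elts Z'))"
    unfolding op_decode_def by (simp add: numeral_2_eq_2 numeral_3_eq_3)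
  moreover have "op_decode [h', X', Y', Z'] \<in> M"
  proof (rule closedD)
    show "op_decode \<in> ops" unfolding ops_def by simp
    show "op_decode [h', X', Y', Z'] \<in> Hw2" unfolding op_decode_def by (rule real_of_hered)
  qed (use pre in simp)
  ultimately show ?thesis unfolding 1 2 R_iff by simp
qed

text \<open>Internal stationarity yields a member \<open>m\<close> of \<open>M\<close> that is an
  initial part of an enumeration of \<open>M\<close>, at a place d in any given club. Intersecting
  \<open>m\<close> with the preimage of g and collapsing gives the image of \<open>{..<d}\<close>
  under \<open>e g\<close>, because the two filtrations of g agree on a club.\<close>

lemma stat_H:
  assumes g: "w1 \<le> g" "g < w2" "val g \<in> \<pi> ` M"
  shows "stat (hits (\<pi> ` M) g)"
  unfolding stat_def
proof (intro conjI allI impI)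
  fix f assume f: "selfmap f"
  obtain g' where g': "g' \<in> M" "val g = \<pi> g'" using g(3) by blast
  have "M \<lesssim> val ` {..<w1}" using M_size unfolding omega1_eq by (rule eqpoll_imp_lepoll)
  then have "M \<lesssim> {..<w1}" using image_lepoll lepoll_trans by blast
  then obtain E0 where E0: "M \<subseteq> E0 ` {..<w1}" unfolding lepoll_iff by blast
  define E where "E c = (if E0 c \<in> M then E0 c else g')" for c
  have E: "E ` {..<w1} = M" unfolding E_def using E0 g'(1) infinite_w1 by (auto simp: image_iff)
  define A where "A x = \<pi> ` E ` {..<x} \<inter> elts (val g)" for x
  have "filtration A" unfolding A_def by (intro filtration_Int image_filtration filtration_image)
  moreover have "filtration (\<lambda>x. val ` e g ` {..<x})" by (intro image_filtration filtration_image)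
  moreover have "(\<Union>x<w1. A x) = (\<Union>x<w1. val ` e g ` {..<x})"
  proof -
    obtain z where "z < g" using g(1) ex_less_w1 less_le_trans by blast
    have "(\<Union>x<w1. val ` e g ` {..<x}) = val ` e g ` {..<w1}"
      unfolding image_UN[symmetric] initial_segments_UN ..
    also have "\<dots> = elts (val g)" unfolding e_image[OF \<open>z < g\<close> g(2)] elts_val ..
    finally have 1: "(\<Union>x<w1. val ` e g ` {..<x}) = elts (val g)" .
    have "(\<Union>x<w1. A x) = (\<Union>x<w1. \<pi> ` E ` {..<x}) \<inter> elts (val g)" unfolding A_def by blast
    also have "(\<Union>x<w1. \<pi> ` E ` {..<x}) = \<pi> ` M"
      unfolding image_UN[symmetric] initial_segments_UN E ..
    also have "\<pi> ` M \<inter> elts (val g) = elts (val g)" using transitive_H[OF g(3)] by blast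
    finally show ?thesis using 1 by simp
  qed
  ultimately obtain f1 where f1: "selfmap f1" "\<And>d. d \<in> closure_points f1 \<Longrightarrow> A d = val ` e g ` {..<d}"
    using filtration_agree[of A "\<lambda>x. val ` e g ` {..<x}"] by metis
  note comb = selfmap_combine[OF f f1(1)]
  have "{Y \<in> ctbl_subsets M. \<exists>x\<in>M. elts x = Y} \<inter> (\<lambda>x. E ` {..<x}) ` closure_points (\<lambda>x. max (f x) (f1 x)) \<noteq> {}"
    using IS club_of_enumeration[OF E comb(1)] unfolding stationary_in_def by blast
  then obtain m d where m: "m \<in> M" "elts m = E ` {..<d}" "d \<in> closure_points f" "d \<in> closure_points f1"
    unfolding comb(2) by blast
  have "{..<d} \<subseteq> {..<w1}" using closure_pointsD(1)[OF m(3)] by auto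
  then have "E ` {..<d} \<subseteq> E ` {..<w1}" by (rule image_mono)
  then have mM: "elts m \<subseteq> M" unfolding m(2) E .
  define k where "k = op_Int [m, g']"
  have k: "elts k = elts m \<inter> elts g'" unfolding k_def op_Int_def using elts_the_set[of "elts m \<inter> elts g'" m] by simp
  have "k \<in> M" unfolding k_def
  proof (rule closed)
    show "op_Int \<in> ops" unfolding ops_def by simp
    show "set [m, g'] \<subseteq> M" using m(1) g'(1) by simp
    show "op_Int [m, g'] \<in> K" using K_subset[of m] k m(1) M_K unfolding k_def by blast
  qed
  have "elts (\<pi> k) = \<pi> ` (elts m \<inter> (elts g' \<inter> M))"
    unfolding collapse[OF \<open>k \<in> M\<close>] k by (simp add: Int_assoc)
  also have "\<dots> = \<pi> ` elts m \<inter> \<pi> ` (elts g' \<inter> M)" by (rule inj_on_image_Int[OF inj_collapse mM]) blast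
  also have "\<dots> = A d" unfolding A_def m(2) g'(2) collapse[OF g'(1)] ..
  also have "\<dots> = val ` e g ` {..<d}" by (rule f1(2)[OF m(4)])
  finally have "d \<in> hits (\<pi> ` M) g"
    unfolding hits_def using closure_pointsD(1)[OF m(3)] \<open>k \<in> M\<close> by blast
  then show "hits (\<pi> ` M) g \<inter> closure_points f \<noteq> {}"
    using m(3) by blast
qed (use hits_def in blast)

lemma good_model_H: "good_model R (\<pi> ` M)"
proof -
  obtain w where "w \<in> \<pi> ` M" "elts w = (omega1 :: 'v set)" using approx unfolding omega1_approximation_property_def by blast
  then have "val w1 \<in> \<pi> ` M" using elts_inject[of w "val w1"] elts_w1 by simp
  moreover have "\<pi> ` M \<lesssim> (omega1 :: 'v set)" using M_size image_lepoll lepoll_trans2 by blast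
  ultimately show ?thesis
    unfolding good_model_def
  proof (intro conjI ballI allI impI; (elim conjE)?)
    fix d y assume "d \<in> \<pi> ` M" "countable (elts d)" "elts d \<subseteq> Collect Ord" "y \<subseteq> elts d"
    then show "(\<exists>w\<in>\<pi> ` M. elts w = y) \<longleftrightarrow> subset_code (elts d) y \<in> R" by (rule subset_code_iff)
  next
    fix h X Y Z assume "val h \<in> \<pi> ` M" "X \<in> \<pi> ` M" "Y \<in> \<pi> ` M" "Z \<in> \<pi> ` M"
      "\<forall>S\<in>{X, Y, Z}. countable (elts S) \<and> elts S \<subseteq> Collect Ord"
    then show "decode h (val -` elts X) (val -` elts Y) (val -` elts Z) \<in> R"
      by (intro decode_in_R) blast+
  next
    fix g assume "w1 \<le> g" "g < w2" "val g \<in> \<pi> ` M"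
    then show "stat (hits (\<pi> ` M) g)" by (rule stat_H)
  qed (use transitive_H in auto)
qed

text \<open>If \<open>M\<close> contained all reals, all countable approximations of every subset of \<open>\<omega>\<^sub>1\<close> would be
  in the collapse, and hence so would be every subset of \<open>\<omega>\<^sub>1\<close>.\<close>

lemma R_not_UNIV: "R \<noteq> UNIV"
proof
  assume RU: "R = UNIV"
  obtain w where w: "w \<in> \<pi> ` M" "elts w = (omega1 :: 'v set)"
    using approx unfolding omega1_approximation_property_def by blast
  have "\<exists>y\<in>\<pi> ` M. elts y = A" if A: "A \<subseteq> omega1" for A
  proof -
    have "\<exists>y\<in>\<pi> ` M. elts y = elts z \<inter> A" if z: "z \<in> \<pi> ` M" "countable_in (\<pi> ` M) z" for z
    proof -
      obtain h :: "'v \<Rightarrow> 'v" where "inj_on h (elts z)" "h ` elts z \<subseteq> omega0"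
        using z(2) unfolding countable_in_def by (elim bexE exE conjE) (rule that)
      then have cz: "countable (elts z)" using countable_omega0 countable_subset countable_image_inj_on by metis
      obtain z' where z': "z' \<in> M" "z = \<pi> z'" using z(1) by blast
      note c = countable_elts_M[OF z'(1) cz[unfolded z'(2)]]
      define y where "y = {x \<in> elts z'. \<pi> x \<in> A}"
      define r where "r = to_nat_on (elts z') ` y"
      have "real_of r \<in> M" using RU R_iff by blast
      have "{x \<in> elts z'. to_nat_on (elts z') x \<in> r} = y"
        using inj_on_to_nat_on[OF c(2)] unfolding r_def y_def by (auto dest: inj_onD)
      then have "op_subset [z', real_of r] = the_set y" unfolding op_subset_def by simp
      then have k: "elts (op_subset [z', real_of r]) = y" using elts_the_set[of y z'] unfolding y_def by auto
      have kM: "op_subset [z', real_of r] \<in> M"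
      proof (rule closed)
        show "op_subset \<in> ops" unfolding ops_def by simp
        show "set [z', real_of r] \<subseteq> M" using z'(1) \<open>real_of r \<in> M\<close> by simp
        show "op_subset [z', real_of r] \<in> K" using K_subset[of z'] k z'(1) M_K unfolding y_def by blast
      qed
      have "elts (\<pi> (op_subset [z', real_of r])) = \<pi> ` y"
        using collapse[OF kM] k c(1) unfolding y_def by (metis (no_types, lifting) Int_absorb2 mem_Collect_eq subset_iff)
      also have "\<dots> = elts z \<inter> A" unfolding z'(2) c(3) y_def by blast
      finally show ?thesis using kM by blast
    qed
    then show ?thesis using approx w A unfolding omega1_approximation_property_def by metis
  qed
  then have "Pow omega1 \<subseteq> elts ` (\<pi> ` M)" by blast
  then have "Pow (omega1 :: 'v set) \<lesssim> \<pi> ` M" by (rule subset_image_lepoll)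
  also have "\<pi> ` M \<lesssim> M" by (rule image_lepoll)
  also have "M \<lesssim> (omega1 :: 'v set)" using M_size by (rule eqpoll_imp_lepoll)
  finally show False using lesspoll_Pow_self[of "omega1 :: 'v set"] lesspoll_trans2 by blast
qed

text \<open>An isomorphism of the ordinals of \<open>M\<close> onto an ordinal satisfies the
  recursion of the collapse, hence coincides with \<open>\<pi>\<close> on them. So a large order
  type means that the collapse contains many ordinals.\<close>

lemma ordinals_H:
  assumes \<tau>: "Ord \<tau>" "has_order_type (M \<inter> Collect Ord) mem (elts \<tau>)"
  shows "elts \<tau> \<subseteq> \<pi> ` M"
proof -
  obtain f where f: "bij_betw f (M \<inter> Collect Ord) (elts \<tau>)"
    "\<And>x y. x \<in> M \<inter> Collect Ord \<Longrightarrow> y \<in> M \<inter> Collect Ord \<Longrightarrow> mem x y \<longleftrightarrow> f x \<in> elts (f y)"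
    using \<tau>(2) unfolding has_order_type_def by blast
  have "f x = \<pi> x" if "x \<in> M \<inter> Collect Ord" for x
    using that
  proof (induction x rule: elts_induct)
    case (1 x)
    have fx: "f x \<in> elts \<tau>" using f(1) 1(2) bij_betwE by blast
    have sub: "elts x \<inter> M \<subseteq> M \<inter> Collect Ord" using 1(2) Ord_elt by blast
    have "elts (f x) = f ` (elts x \<inter> M)"
    proof (intro equalityI subsetI)
      fix z assume z: "z \<in> elts (f x)"
      then have "z \<in> elts \<tau>" using Ord_elts_subset[OF \<tau>(1) fx] by blast
      then obtain y where y: "y \<in> M \<inter> Collect Ord" "z = f y" using f(1) unfolding bij_betw_def by blast
      then have "y \<in> elts x" using f(2)[OF y(1) 1(2)] z unfolding mem_iff_elts by blast
      then show "z \<in> f ` (elts x \<inter> M)" using y by blast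
    next
      fix z assume "z \<in> f ` (elts x \<inter> M)"
      then obtain y where y: "y \<in> elts x" "y \<in> M" "z = f y" by blast
      then have "y \<in> M \<inter> Collect Ord" using sub by blast
      then show "z \<in> elts (f x)" using f(2)[OF _ 1(2), of y] y unfolding mem_iff_elts by blast
    qed
    also have "\<dots> = \<pi> ` (elts x \<inter> M)" using 1(1) sub by (intro image_cong) auto
    also have "\<dots> = elts (\<pi> x)" using collapse 1(2) by simp
    finally show ?case by (rule elts_inject)
  qed
  then have "f ` (M \<inter> Collect Ord) \<subseteq> \<pi> ` M" by auto
  then show ?thesis using f(1) unfolding bij_betw_def by simp
qed

end

section \<open>The tree of countable traces\<close>

lemma has_order_type_unique:
  assumes "has_order_type A r S" "has_order_type A r S'"
    and "\<And>x. x \<in> S \<Longrightarrow> elts x \<subseteq> S" "\<And>x. x \<in> S' \<Longrightarrow> elts x \<subseteq> S'"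
  shows "S = S'"
proof -
  obtain f g where f: "bij_betw f A S" "\<And>x y. x \<in> A \<Longrightarrow> y \<in> A \<Longrightarrow> r x y \<longleftrightarrow> f x \<in> elts (f y)"
    and g: "bij_betw g A S'" "\<And>x y. x \<in> A \<Longrightarrow> y \<in> A \<Longrightarrow> r x y \<longleftrightarrow> g x \<in> elts (g y)"
    using assms(1,2) unfolding has_order_type_def by blast
  have el: "elts (h x) = h ` {y \<in> A. r y x}"
    if h: "bij_betw h A T" "\<And>x y. x \<in> A \<Longrightarrow> y \<in> A \<Longrightarrow> r x y \<longleftrightarrow> h x \<in> elts (h y)"
      and T: "\<And>x. x \<in> T \<Longrightarrow> elts x \<subseteq> T" and x: "x \<in> A" for h T x
  proof (intro equalityI subsetI)
    fix z assume z: "z \<in> elts (h x)"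
    have "h x \<in> T" using h(1) x bij_betwE by blast
    then have "z \<in> h ` A" using T z h(1) unfolding bij_betw_def by blast
    then obtain y where y: "y \<in> A" "z = h y" by blast
    then show "z \<in> h ` {y \<in> A. r y x}" using h(2)[OF y(1) x] z by blast
  next
    fix z assume "z \<in> h ` {y \<in> A. r y x}"
    then obtain y where "z = h y" "y \<in> A" "r y x" by blast
    then show "z \<in> elts (h x)" using h(2)[OF _ x] by blast
  qed
  have "\<forall>x\<in>A. f x = v \<longrightarrow> g x = v" for v
  proof (induction v rule: elts_induct)
    case (1 v)
    have "g x = f x" if x: "x \<in> A" "f x = v" for x
    proof (rule elts_inject)
      have "g y = f y" if "y \<in> A" "r y x" for y
        using 1[of "f y"] f(2)[OF that(1) x(1)] that x(2) by blast
      then have "g ` {y \<in> A. r y x} = f ` {y \<in> A. r y x}" by (intro image_cong) auto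
      then show "elts (g x) = elts (f x)"
        using el[OF f assms(3) x(1)] el[OF g assms(4) x(1)] by simp
    qed
    then show ?case by blast
  qed
  then have "f ` A = g ` A" by (intro image_cong) auto
  then show ?thesis using f(1) g(1) unfolding bij_betw_def by simp
qed

context omega_2_exists begin

text \<open>The trace of \<open>H\<close> on the countable subsets of b. It is a set of the universe
  because \<open>H\<close> has size at most omega1.\<close>

definition node :: "'v set \<Rightarrow> 'v ordinal \<Rightarrow> 'v" where
  "node H b = (SOME x. elts x = {y \<in> H. countable (elts y) \<and> elts y \<subseteq> elts (val b)})"

text \<open>A node does not mention its height, but the height is the union of its members, by
  \<open>Union_node\<close>.\<close>

definition node_height :: "'v \<Rightarrow> 'v ordinal" where
  "node_height x = (SOME b. elts (val b) = \<Union> (elts ` elts x))"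

definition node_less :: "'v \<Rightarrow> 'v \<Rightarrow> bool" where
  "node_less x y \<longleftrightarrow> node_height x < node_height y \<and>
     elts x = {z \<in> elts y. elts z \<subseteq> elts (val (node_height x))}"

lemma elts_node:
  assumes "good_model R H"
  shows "elts (node H b) = {y \<in> H. countable (elts y) \<and> elts y \<subseteq> elts (val b)}"
proof -
  have "H \<lesssim> elts (val w1)" using assms unfolding good_model_def elts_w1 by blast
  moreover have "{y \<in> H. countable (elts y) \<and> elts y \<subseteq> elts (val b)} \<lesssim> H"
    by (rule subset_imp_lepoll) (rule Collect_restrict)
  ultimately have "{y \<in> H. countable (elts y) \<and> elts y \<subseteq> elts (val b)} \<lesssim> elts (val w1)"
    by (rule lepoll_trans[rotated])
  then have "\<exists>x. elts x = {y \<in> H. countable (elts y) \<and> elts y \<subseteq> elts (val b)}" by (rule ex_elts_lepoll)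
  then show ?thesis unfolding node_def by (rule someI_ex)
qed

lemma good_model_trans: "good_model R H \<Longrightarrow> x \<in> H \<Longrightarrow> y \<in> elts x \<Longrightarrow> y \<in> H"
  unfolding good_model_def by (elim conjE) blast

lemma good_model_ord: "good_model R H \<Longrightarrow> val b \<in> H \<Longrightarrow> c \<le> b \<Longrightarrow> val c \<in> H"
  using good_model_trans[of R H "val b" "val c"] by (cases "c = b") auto

lemma good_model_stat:
  "\<lbrakk>good_model R H; w1 \<le> g; g < w2; val g \<in> H\<rbrakk> \<Longrightarrow> stat (hits H g)"
  unfolding good_model_def by (elim conjE) simp

lemma countable_e_image: "x < w1 \<Longrightarrow> countable (val ` e g ` {..<x})"
  using less_w1 by simp

lemma e_image_subset:
  assumes "w1 \<le> g" "g < w2" "x \<le> w1" shows "val ` e g ` {..<x} \<subseteq> elts (val g)"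
proof -
  obtain z where "z < g" using assms(1) ex_less_w1 less_le_trans by blast
  have "e g ` {..<x} \<subseteq> e g ` {..<w1}" using assms(3) by (intro image_mono) auto
  then show ?thesis unfolding e_image[OF \<open>z < g\<close> assms(2)] elts_val by (rule image_mono)
qed

text \<open>A countable b is itself a member of the node. For larger b the stationary set of hits is
  unbounded, so images under \<open>e b\<close> of arbitrarily large countable ordinals are in
  \<open>H\<close>, and they cover b.\<close>

lemma Union_node:
  assumes H: "good_model R H" and b: "b < w2" "val b \<in> H"
  shows "\<Union> (elts ` elts (node H b)) = elts (val b)"
proof
  show "\<Union> (elts ` elts (node H b)) \<subseteq> elts (val b)" unfolding elts_node[OF H] by blast
  show "elts (val b) \<subseteq> \<Union> (elts ` elts (node H b))"
  proof (cases "b < w1")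
    case True
    then have "val b \<in> elts (node H b)" unfolding elts_node[OF H] using b(2) less_w1 countable_elts_val by blast
    then show ?thesis by blast
  next
    case False
    then have "w1 \<le> b" by simp
    show ?thesis
    proof
      fix v assume "v \<in> elts (val b)"
      then obtain c where c: "v = val c" "c < b" unfolding elts_val by blast
      then have "c \<in> e b ` {..<w1}" using e_image[OF c(2) b(1)] by blast
      then obtain i where i: "i < w1" "c = e b i" by blast
      obtain d where d: "d \<in> hits H b" "i < d"
        using stat_unbounded[OF good_model_stat[OF H \<open>w1 \<le> b\<close> b] i(1)] .
      then obtain w where w: "d < w1" "w \<in> H" "elts w = val ` e b ` {..<d}" unfolding hits_def by blast
      have "w \<in> elts (node H b)"
        unfolding elts_node[OF H]
        using w countable_e_image[OF w(1)] e_image_subset[OF \<open>w1 \<le> b\<close> b(1), of d] by simp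
      moreover have "v \<in> elts w" unfolding w(3) c(1) i(2) using d(2) by blast
      ultimately show "v \<in> \<Union> (elts ` elts (node H b))" by blast
    qed
  qed
qed

lemma node_height_node:
  assumes "good_model R H" "b < w2" "val b \<in> H" shows "node_height (node H b) = b"
proof -
  have "elts (val (node_height (node H b))) = \<Union> (elts ` elts (node H b))"
    unfolding node_height_def by (rule someI[of _ b]) (rule Union_node[OF assms, symmetric])
  then have "val (node_height (node H b)) = val b"
    unfolding Union_node[OF assms] by (rule elts_inject)
  then show ?thesis by (simp add: val_inject)
qed

lemma node_less_iff:
  assumes H: "good_model R H" and b: "b < w2" "val b \<in> H"
  shows "node_less y (node H b) \<longleftrightarrow> node_height y < b \<and> y = node H (node_height y)"
proof -
  have "{z \<in> elts (node H b). elts z \<subseteq> elts (val c)} = elts (node H c)" if "c < b" for c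
  proof -
    have "elts (val c) \<subseteq> elts (val b)" using that Ord_elts_subset[OF Ord_val, of "val c" b] by simp
    then show ?thesis unfolding elts_node[OF H] by blast
  qed
  then have "{z \<in> elts (node H b). elts z \<subseteq> elts (val (node_height y))} = elts (node H (node_height y))"
    if "node_height y < b" using that .
  moreover have "elts y = elts (node H (node_height y)) \<longleftrightarrow> y = node H (node_height y)"
    using elts_inject[of y] by auto
  ultimately show ?thesis
    unfolding node_less_def node_height_node[OF assms] by (cases "node_height y < b") simp_all
qed

text \<open>Whether a countable subset of \<open>g\<close> is in a model is decided by its code relative to any
  member \<open>e g ` {..<x}\<close> of the model that covers it, and the code is a real.\<close>

lemma node_eqI:
  assumes H: "good_model R H" "good_model R H'" and g: "w1 \<le> g" "g < w2" "val g \<in> H" "val g \<in> H'"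
    and s: "stat (hits H g \<inter> hits H' g)"
  shows "node H g = node H' g"
proof -
  have sub: "elts (node H g) \<subseteq> elts (node H' g)"
    if H: "good_model R H" "good_model R H'"
    and s: "stat (hits H g \<inter> hits H' g)" for H H'
  proof
    fix z assume "z \<in> elts (node H g)"
    then have z: "z \<in> H" "countable (elts z)" "elts z \<subseteq> val ` {..<g}"
      unfolding elts_node[OF H(1)] elts_val by blast+
    obtain z0 where "z0 < g" using g(1) ex_less_w1 less_le_trans by blast
    have "elts z \<subseteq> (\<lambda>i. val (e g i)) ` {..<w1}"
      using z(3) unfolding e_image[OF \<open>z0 < g\<close> g(2), symmetric] image_image .
    then obtain J where J: "J \<subseteq> {..<w1}" "countable J" "elts z = (\<lambda>i. val (e g i)) ` J"
      using z(2) by (meson countable_subset_image)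
    obtain i where i: "i < w1" "\<forall>j\<in>J. j < i" using bounded_w1[OF J(2,1)] by blast
    obtain d where d: "d \<in> hits H g \<inter> hits H' g" "i < d"
      using stat_unbounded[OF s i(1)] .
    then obtain w where w: "d < w1" "w \<in> H" "elts w = val ` e g ` {..<d}" unfolding hits_def by blast
    obtain w' where w': "w' \<in> H'" "elts w' = val ` e g ` {..<d}" using d(1) unfolding hits_def by blast
    have "w' = w" using w(3) w'(2) by (metis elts_inject)
    have "J \<subseteq> {..<d}" using i(2) d(2) by auto
    then have zw: "elts z \<subseteq> elts w" unfolding J(3) w(3) image_image by (rule image_mono)
    have cw: "countable (elts w) \<and> elts w \<subseteq> Collect Ord" unfolding w(3) using countable_e_image[OF w(1)] by auto
    have code: "(\<exists>v\<in>G. elts v = elts z) \<longleftrightarrow> subset_code (elts w) (elts z) \<in> R" if "good_model R G" "w \<in> G" for G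
      using that cw zw unfolding good_model_def by blast
    have "subset_code (elts w) (elts z) \<in> R" using code[OF H(1) w(2)] z(1) by blast
    then obtain v where "v \<in> H'" "elts v = elts z" using code[OF H(2)] w'(1) \<open>w' = w\<close> by blast
    then have "z \<in> H'" using elts_inject by metis
    then show "z \<in> elts (node H' g)" unfolding elts_node[OF H(2)] elts_val using z(2,3) by blast
  qed
  have "elts (node H g) = elts (node H' g)"
    by (intro equalityI sub H) (use s in \<open>simp_all add: Int_commute\<close>)
  then show ?thesis by (rule elts_inject)
qed

text \<open>Models of different heights contribute branches of different lengths, so a node may come
  from many models. The tree property chooses one family compatible at all levels; decoding from it
  gives every real by \<open>decode_surj\<close>, but only reals of \<open>R\<close> by the
  definition of a good model.\<close>

theorem unbounded_good_models:
  assumes SRP: "SRP_omega2 TYPE('v)" and TP: "tree_property_omega2 TYPE('v)"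
    and good: "\<And>H. H \<in> \<H> \<Longrightarrow> good_model R H"
    and unbounded: "\<And>b. b < w2 \<Longrightarrow> \<exists>H\<in>\<H>. val b \<in> H"
  shows "R = UNIV"
proof -
  define T where "T = {node H b |H b. H \<in> \<H> \<and> b < w2 \<and> val b \<in> H}"
  define L where "L b = {x \<in> T. node_height x = b}" for b
  have T_cases: "\<exists>H\<in>\<H>. node_height x < w2 \<and> val (node_height x) \<in> H \<and> x = node H (node_height x)"
    if "x \<in> T" for x
    using that node_height_node[OF good] unfolding T_def by auto
  have nodeT: "node H b \<in> T" if "H \<in> \<H>" "b < w2" "val b \<in> H" for H b using that unfolding T_def by blast
  have less: "node_less y (node H b) \<longleftrightarrow> node_height y < b \<and> y = node H (node_height y)"
    if "H \<in> \<H>" "b < w2" "val b \<in> H" for y H b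
    using node_less_iff[OF good that(2,3)] that(1) by blast
  have preds: "preds T node_less (node H b) = node H ` {..<b}" if H: "H \<in> \<H>" "b < w2" "val b \<in> H" for H b
  proof (intro equalityI subsetI)
    fix y assume "y \<in> preds T node_less (node H b)"
    then show "y \<in> node H ` {..<b}" unfolding preds_def using less[OF H] by blast
  next
    fix y assume "y \<in> node H ` {..<b}"
    then obtain c where c: "c < b" "y = node H c" by blast
    have "val c \<in> H" "c < w2" using good_model_ord[OF good[OF H(1)] H(3)] c(1) H(2) by (simp, order)
    then show "y \<in> preds T node_less (node H b)"
      unfolding preds_def using less[OF H] nodeT[OF H(1)] node_height_node[OF good[OF H(1)]] c by auto
  qed
  have ht: "node_height (node H c) = c" if "H \<in> \<H>" "b < w2" "val b \<in> H" "c < b" for H b c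
    using node_height_node[OF good[OF that(1)], of c] good_model_ord[OF good[OF that(1)] that(3), of c] that by simp
  have lessn: "node_less (node H c) (node H d) \<longleftrightarrow> c < d"
    if H: "H \<in> \<H>" "b < w2" "val b \<in> H" "c < b" "d < b" for H b c d
  proof -
    have "val d \<in> H" "d < w2" using good_model_ord[OF good[OF H(1)] H(3)] H(2,5) by (simp, order)
    then show ?thesis using less[OF H(1), of d "node H c"] ht[OF H(1-4)] by simp
  qed
  have tree: "is_tree T node_less"
    unfolding is_tree_def
  proof (intro conjI ballI allI impI; (elim conjE)?)
    fix x show "\<not> node_less x x" unfolding node_less_def by simp
  next
    fix x y z assume "node_less x y" "node_less y z"
    moreover from this have "elts (val (node_height x)) \<subseteq> elts (val (node_height y))"
      by (intro Ord_elts_subset Ord_val) (simp add: node_less_def)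
    ultimately show "node_less x z" unfolding node_less_def by auto
  next
    fix x B assume x: "x \<in> T" and B: "B \<subseteq> preds T node_less x" "B \<noteq> {}"
    obtain H where H: "H \<in> \<H>" "node_height x < w2" "val (node_height x) \<in> H" "x = node H (node_height x)"
      using T_cases[OF x] by blast
    have B': "B \<subseteq> node H ` {..<node_height x}" using B(1) preds[OF H(1-3)] H(4) by simp
    define b where "b = (LEAST b. b < node_height x \<and> node H b \<in> B)"
    have "\<exists>b. b < node_height x \<and> node H b \<in> B" using B' B(2) by blast
    then have b: "b < node_height x \<and> node H b \<in> B" unfolding b_def by (rule LeastI_ex)
    have "y = node H b \<or> node_less (node H b) y" if "y \<in> B" for y
    proof -
      obtain c where c: "c < node_height x" "y = node H c" using B' \<open>y \<in> B\<close> by blast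
      then have "b \<le> c" unfolding b_def using \<open>y \<in> B\<close> by (intro Least_le) blast
      then show ?thesis using lessn[OF H(1-3), of b c] b c by (cases "b = c") auto
    qed
    then show "\<exists>m\<in>B. \<forall>y\<in>B. y = m \<or> node_less m y" using b by blast
  qed
  have ot: "has_order_type (preds T node_less x) node_less (elts (val (node_height x)))" if x: "x \<in> T" for x
  proof -
    obtain H where H: "H \<in> \<H>" "node_height x < w2" "val (node_height x) \<in> H" "x = node H (node_height x)"
      using T_cases[OF x] by blast
    have p: "preds T node_less x = node H ` {..<node_height x}" using preds[OF H(1-3)] H(4) by simp
    have "bij_betw (\<lambda>y. val (node_height y)) (node H ` {..<node_height x}) (val ` {..<node_height x})"
    proof (rule bij_betw_imageI)
      show "inj_on (\<lambda>y. val (node_height y)) (node H ` {..<node_height x})"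
        by (rule inj_onI) (use ht[OF H(1-3)] in \<open>auto simp: val_inject\<close>)
      show "(\<lambda>y. val (node_height y)) ` node H ` {..<node_height x} = val ` {..<node_height x}"
        unfolding image_image using ht[OF H(1-3)] by (intro image_cong) auto
    qed
    moreover have "node_less y z \<longleftrightarrow> val (node_height y) \<in> elts (val (node_height z))"
      if "y \<in> node H ` {..<node_height x}" "z \<in> node H ` {..<node_height x}" for y z
      using that lessn[OF H(1-3)] ht[OF H(1-3)] by auto
    ultimately show ?thesis
      unfolding has_order_type_def p elts_val[of "node_height x"]
      by (intro exI[of _ "\<lambda>y. val (node_height y)"] conjI ballI)
  qed
  have trans_val: "elts x \<subseteq> elts (val b)" if "x \<in> elts (val b)" for x b
    using Ord_elts_subset[OF Ord_val that] .
  have level: "level T node_less (elts (val b)) = L b" for b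
  proof -
    have "b = node_height x" if "x \<in> T" "has_order_type (preds T node_less x) node_less (elts (val b))" for x
    proof -
      have "elts (val b) = elts (val (node_height x))"
        by (rule has_order_type_unique[OF that(2) ot[OF that(1)] trans_val trans_val])
      then show ?thesis using elts_inject val_inject by metis
    qed
    then show ?thesis unfolding level_def L_def using ot by blast
  qed
  have L_eq: "\<exists>H\<in>\<H>. val b \<in> H \<and> x = node H b" if "x \<in> L b" for x b
    using that T_cases unfolding L_def by blast
  have L_nonempty: "L b \<noteq> {}" if "b < w2" for b
    using unbounded[OF that] nodeT[OF _ that] node_height_node[OF good that] unfolding L_def by blast
  have no_top: "level T node_less (omega2 :: 'v set) = {}"
  proof -
    have "L w2 = {}" unfolding L_def using T_cases by fastforce
    then show ?thesis using level[of w2] unfolding elts_w2 by simp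
  qed
  have L_le: "L b \<lesssim> {..<w1}" if b: "w1 \<le> b" "b < w2" for b
  proof -
    \<comment> \<open>These are the hits of a model, read off from the node alone. By
      \<open>node_eqI\<close> different nodes have hits with nonstationary intersection, so the
      level is bounded by saturation.\<close>
    define U where "U x = {d. d < w1 \<and> (\<exists>w\<in>elts x. elts w = val ` e b ` {..<d})}" for x
    have U: "U (node H b) = hits H b" if "H \<in> \<H>" for H
    proof -
      have "w \<in> elts (node H b)" if "d < w1" "w \<in> H" "elts w = val ` e b ` {..<d}" for d w
        unfolding elts_node[OF good[OF \<open>H \<in> \<H>\<close>]]
        using that countable_e_image[OF that(1)] e_image_subset[OF b, of d] by simp
      moreover have "w \<in> H" if "w \<in> elts (node H b)" for w
        using that unfolding elts_node[OF good[OF \<open>H \<in> \<H>\<close>]] by blast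
      ultimately show ?thesis unfolding U_def hits_def by blast
    qed
    have eq: "x = y" if "x \<in> L b" "y \<in> L b" "stat (U x \<inter> U y)" for x y
    proof -
      obtain H where H: "H \<in> \<H>" "val b \<in> H" "x = node H b" using L_eq[OF \<open>x \<in> L b\<close>] by blast
      obtain H' where H': "H' \<in> \<H>" "val b \<in> H'" "y = node H' b" using L_eq[OF \<open>y \<in> L b\<close>] by blast
      show ?thesis
        using node_eqI[OF good[OF H(1)] good[OF H'(1)] b H(2) H'(2)] \<open>stat (U x \<inter> U y)\<close>
        unfolding H(3) H'(3) U[OF H(1)] U[OF H'(1)] by blast
    qed
    have st: "stat (U x)" if "x \<in> L b" for x
    proof -
      obtain H where H: "H \<in> \<H>" "val b \<in> H" "x = node H b" using L_eq[OF \<open>x \<in> L b\<close>] by blast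
      show ?thesis unfolding H(3) U[OF H(1)] using good_model_stat[OF good[OF H(1)] b H(2)] .
    qed
    have "U ` L b \<lesssim> {..<w1}"
    proof (rule antichain_lepoll[OF SRP])
      show "stat X" if "X \<in> U ` L b" for X using that st by blast
      show "X = Y" if "X \<in> U ` L b" "Y \<in> U ` L b" "stat (X \<inter> Y)" for X Y using that eq by blast
    qed
    moreover have "inj_on U (L b)"
    proof (rule inj_onI)
      fix x y assume "x \<in> L b" "y \<in> L b" "U x = U y"
      then show "x = y" using eq[of x y] st[of y] by simp
    qed
    ultimately show ?thesis by (simp only: inj_on_image_lepoll_1)
  qed
  have L_small: "L b \<prec> (omega2 :: 'v set)" if b: "b < w2" for b
  proof -
    have "L b \<lesssim> {..<w1}"
    proof (cases "w1 \<le> b")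
      case True then show ?thesis using L_le b by blast
    next
      case False
      \<comment> \<open>Restriction to b maps the level of \<open>w1\<close> onto the level of b,
        because every good model contains \<open>w1\<close>.\<close>
      define F where "F y = the_set {z \<in> elts y. elts z \<subseteq> elts (val b)}" for y
      have "x \<in> F ` L w1" if "x \<in> L b" for x
      proof -
        from L_eq[OF that] obtain H where H: "H \<in> \<H>" "x = node H b" by blast
        have w1H: "val w1 \<in> H" using good[OF H(1)] unfolding good_model_def by blast
        have "node H w1 \<in> L w1"
          using nodeT[OF H(1) w1_less_w2 w1H] node_height_node[OF good[OF H(1)] w1_less_w2 w1H] unfolding L_def by blast
        moreover have "elts (val b) \<subseteq> elts (val w1)" using False trans_val[of "val b" w1] by simp
        then have "elts (F (node H w1)) = elts x"
          unfolding F_def H(2) using elts_the_set[of _ "node H w1"] elts_node[OF good[OF H(1)]]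
          by (subst elts_the_set[of _ "node H w1"]) auto
        then have "x = F (node H w1)" using elts_inject by metis
        ultimately show ?thesis by blast
      qed
      then have "L b \<subseteq> F ` L w1" by blast
      then have "L b \<lesssim> L w1" by (rule subset_image_lepoll)
      then show ?thesis using L_le[OF order_refl w1_less_w2] lepoll_trans by blast
    qed
    also have "{..<w1} \<lesssim> (omega1 :: 'v set)"
      unfolding omega1_eq by (meson inj_on_image_lepoll_2 inj_on_subset inj_val lepoll_refl top_greatest)
    finally show ?thesis by (rule lesspoll_omega2)
  qed
  have "\<exists>B\<subseteq>T. (\<forall>x\<in>B. \<forall>y\<in>B. x = y \<or> node_less x y \<or> node_less y x) \<and> (\<forall>x\<in>B. preds T node_less x \<subseteq> B) \<and>
     (\<forall>\<alpha>\<in>(omega2 :: 'v set). B \<inter> level T node_less (elts \<alpha>) \<noteq> {})"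
    using TP[unfolded tree_property_omega2_def, rule_format, of T node_less] tree no_top L_nonempty L_small
    unfolding omega2_eq by (auto simp: level)
  then obtain B where B: "B \<subseteq> T" "\<And>x y. x \<in> B \<Longrightarrow> y \<in> B \<Longrightarrow> x = y \<or> node_less x y \<or> node_less y x"
    "\<And>b. b < w2 \<Longrightarrow> B \<inter> L b \<noteq> {}"
    unfolding omega2_eq by (auto simp: level)
  \<comment> \<open>The members of all nodes on the branch. At height g the branch node comes from a
    good model containing g, whose hits witness stationarity.\<close>
  define F where "F = {val -` elts z |z x. x \<in> B \<and> z \<in> elts x}"
  have F: "stat {x. x < w1 \<and> e g ` {..<x} \<in> F}" if g: "w1 \<le> g" "g < w2" for g
  proof -
    obtain x where x: "x \<in> B" "x \<in> L g" using B(3)[OF g(2)] by blast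
    obtain H where H: "H \<in> \<H>" "val g \<in> H" "x = node H g" using L_eq[OF x(2)] by blast
    show ?thesis
    proof (rule stat_mono[OF good_model_stat[OF good[OF H(1)] g H(2)]])
      show "hits H g \<subseteq> {x. x < w1 \<and> e g ` {..<x} \<in> F}"
        unfolding hits_def
      proof clarify
        fix d w assume d: "d < w1" "w \<in> H" "elts w = val ` e g ` {..<d}"
        have "w \<in> elts x" unfolding H(3) elts_node[OF good[OF H(1)]]
          using d countable_e_image[OF d(1)] e_image_subset[OF g, of d] by simp
        moreover have "val -` elts w = e g ` {..<d}" unfolding d(3) using inj_val by (rule inj_vimage_image_eq)
        ultimately show "e g ` {..<d} \<in> F" unfolding F_def using x(1) by blast
      qed
    qed blast
  qed
  have "r \<in> R" for r
  proof -
    obtain h X Y Z where hXYZ: "h < w2" "X \<in> F" "Y \<in> F" "Z \<in> F" "decode h X Y Z = r"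
      using decode_surj[OF SRP F, of r] by blast
    obtain x1 z1 x2 z2 x3 z3 where z: "x1 \<in> B" "z1 \<in> elts x1" "X = val -` elts z1"
      "x2 \<in> B" "z2 \<in> elts x2" "Y = val -` elts z2" "x3 \<in> B" "z3 \<in> elts x3" "Z = val -` elts z3"
      using hXYZ(2-4) unfolding F_def by blast
    have hB: "node_height x < w2" if "x \<in> B" for x using T_cases B(1) that by blast
    \<comment> \<open>The branch node of height b lies above the three nodes and includes them.
      Hence one model contains \<open>h\<close> and all three sets, and its decodings are in
      \<open>R\<close>.\<close>
    obtain b where b: "b < w2" "\<forall>c\<in>{h, node_height x1, node_height x2, node_height x3}. c < b"
      using bounded_w2_countable[of "{h, node_height x1, node_height x2, node_height x3}"] hXYZ(1) hB z by auto
    obtain x where x: "x \<in> B" "x \<in> L b" using B(3)[OF b(1)] by blast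
    obtain H where H: "H \<in> \<H>" "val b \<in> H" "x = node H b" using L_eq[OF x(2)] by blast
    have hx: "node_height x = b" using x(2) unfolding L_def by blast
    have sub: "elts x' \<subseteq> elts x" if "x' \<in> B" "node_height x' < b" for x'
    proof -
      have "node_less x' x" using B(2)[OF that(1) x(1)] that(2) hx unfolding node_less_def by auto
      then show ?thesis unfolding node_less_def by blast
    qed
    have zx: "z1 \<in> elts x" "z2 \<in> elts x" "z3 \<in> elts x"
      using sub[of x1] sub[of x2] sub[of x3] z b(2) by auto
    have zH: "z' \<in> H \<and> countable (elts z') \<and> elts z' \<subseteq> Collect Ord" if "z' \<in> elts x" for z'
      using that unfolding H(3) elts_node[OF good[OF H(1)]] elts_val by auto
    have hH: "val h \<in> H" using good_model_ord[OF good[OF H(1)] H(2), of h] b(2) by (simp add: less_imp_le)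
    have "decode h (val -` elts z1) (val -` elts z2) (val -` elts z3) \<in> R"
      using good[OF H(1)] hH zH[OF zx(1)] zH[OF zx(2)] zH[OF zx(3)] unfolding good_model_def by simp
    then show ?thesis using hXYZ(5) z by simp
  qed
  then show ?thesis by blast
qed

end

section \<open>Normal ideals\<close>

definition almost_all :: "'v::set_universe \<Rightarrow> 'v set set set \<Rightarrow> ('v set \<Rightarrow> bool) \<Rightarrow> bool" where
  "almost_all \<theta> I P \<longleftrightarrow> {M \<in> small_subsets \<theta>. \<not> P M} \<in> I"

lemma dual_filter_iff:
  "A \<in> dual_filter \<theta> I \<longleftrightarrow> A \<subseteq> small_subsets \<theta> \<and> almost_all \<theta> I (\<lambda>M. M \<in> A)"
proof -
  have "small_subsets \<theta> - A = {M \<in> small_subsets \<theta>. M \<notin> A}" by blast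
  then show ?thesis unfolding dual_filter_def almost_all_def by simp
qed

locale normal_ideal =
  fixes \<theta> :: "'v::set_universe" and I :: "'v set set set"
  assumes ideal: "normal_fine_ideal \<theta> I"
begin

lemma ideal_subset: "S \<in> I \<Longrightarrow> S' \<subseteq> S \<Longrightarrow> S' \<in> I"
  using ideal unfolding normal_fine_ideal_def by simp

lemma ideal_empty: "{} \<in> I"
  using ideal unfolding normal_fine_ideal_def by simp

lemma ideal_proper: "small_subsets \<theta> \<notin> I"
  using ideal unfolding normal_fine_ideal_def by simp

lemma ideal_countable_Union: "J \<subseteq> I \<Longrightarrow> countable J \<Longrightarrow> \<Union>J \<in> I"
  using ideal unfolding normal_fine_ideal_def by simp

lemma ideal_fine: "b \<in> hered (elts \<theta>) \<Longrightarrow> {M \<in> small_subsets \<theta>. b \<notin> M} \<in> I"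
  using ideal unfolding normal_fine_ideal_def by simp

lemma ideal_normal:
  assumes "S \<subseteq> small_subsets \<theta>" "S \<notin> I" "\<And>M. M \<in> S \<Longrightarrow> g M \<in> M"
  shows "\<exists>S'\<subseteq>S. S' \<notin> I \<and> (\<exists>c. \<forall>M\<in>S'. g M = c)"
proof -
  have "\<forall>S g. S \<subseteq> small_subsets \<theta> \<and> S \<notin> I \<and> (\<forall>M\<in>S. g M \<in> M) \<longrightarrow>
        (\<exists>S'\<subseteq>S. S' \<notin> I \<and> (\<exists>c. \<forall>M\<in>S'. g M = c))"
    using ideal unfolding normal_fine_ideal_def by (elim conjE)
  from this[THEN spec, of S, THEN spec, of g] show ?thesis using assms by simp
qed

lemma almost_all_mono: "almost_all \<theta> I P \<Longrightarrow> (\<And>M. M \<in> small_subsets \<theta> \<Longrightarrow> P M \<Longrightarrow> Q M) \<Longrightarrow> almost_all \<theta> I Q"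
  unfolding almost_all_def by (erule ideal_subset) blast

lemma almost_all_countable:
  assumes "countable A" "\<And>a. a \<in> A \<Longrightarrow> almost_all \<theta> I (P a)"
  shows "almost_all \<theta> I (\<lambda>M. \<forall>a\<in>A. P a M)"
proof -
  have "\<Union> ((\<lambda>a. {M \<in> small_subsets \<theta>. \<not> P a M}) ` A) \<in> I"
    using assms unfolding almost_all_def by (intro ideal_countable_Union) auto
  then show ?thesis unfolding almost_all_def by (rule ideal_subset) blast
qed

lemma almost_all_conj: "almost_all \<theta> I P \<Longrightarrow> almost_all \<theta> I Q \<Longrightarrow> almost_all \<theta> I (\<lambda>M. P M \<and> Q M)"
proof -
  assume "almost_all \<theta> I P" "almost_all \<theta> I Q"
  then have "almost_all \<theta> I (\<lambda>M. \<forall>b\<in>{True, False}. (if b then P else Q) M)"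
    by (intro almost_all_countable) auto
  then show ?thesis
  proof (rule almost_all_mono)
    fix M assume "\<forall>b\<in>{True, False}. (if b then P else Q) M"
    from bspec[OF this, of True] bspec[OF this, of False] show "P M \<and> Q M" by simp
  qed
qed

lemma almost_all_ex: "almost_all \<theta> I P \<Longrightarrow> \<exists>M\<in>small_subsets \<theta>. P M"
proof (rule ccontr)
  assume "almost_all \<theta> I P" "\<not> (\<exists>M\<in>small_subsets \<theta>. P M)"
  then have "{M \<in> small_subsets \<theta>. \<not> P M} = small_subsets \<theta>" by blast
  then show False using \<open>almost_all \<theta> I P\<close> ideal_proper unfolding almost_all_def by simp
qed

text \<open>Induction on the arity: on a positive set of counterexamples normality makes the first
  argument constant, which leaves an operation with one argument less. Countable completeness
  combines the arities.\<close>

lemma almost_all_closed: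
  fixes h :: "'v list \<Rightarrow> 'v"
  shows "almost_all \<theta> I (\<lambda>M. \<forall>l. set l \<subseteq> M \<and> h l \<in> hered (elts \<theta>) \<longrightarrow> h l \<in> M)"
proof -
  have len: "{M \<in> small_subsets \<theta>. \<exists>l. length l = n \<and> set l \<subseteq> M \<and> h l \<in> hered (elts \<theta>) \<and> h l \<notin> M} \<in> I"
    for n and h :: "'v list \<Rightarrow> 'v"
  proof (induction n arbitrary: h)
    case 0
    show ?case
    proof (cases "h [] \<in> hered (elts \<theta>)")
      case True
      then show ?thesis using ideal_fine[of "h []"] by simp
    qed (simp add: ideal_empty)
  next
    case (Suc n)
    define S where "S = {M \<in> small_subsets \<theta>. \<exists>l. length l = Suc n \<and> set l \<subseteq> M \<and> h l \<in> hered (elts \<theta>) \<and> h l \<notin> M}"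
    have "\<forall>M\<in>S. \<exists>x. x \<in> M \<and> (\<exists>l. length l = n \<and> set l \<subseteq> M \<and> h (x # l) \<in> hered (elts \<theta>) \<and> h (x # l) \<notin> M)"
    proof
      fix M assume "M \<in> S"
      then obtain l where l: "length l = Suc n" "set l \<subseteq> M" "h l \<in> hered (elts \<theta>)" "h l \<notin> M"
        unfolding S_def by blast
      then show "\<exists>x. x \<in> M \<and> (\<exists>l. length l = n \<and> set l \<subseteq> M \<and> h (x # l) \<in> hered (elts \<theta>) \<and> h (x # l) \<notin> M)"
        by (cases l) auto
    qed
    then obtain g where g: "\<And>M. M \<in> S \<Longrightarrow> g M \<in> M"
      "\<And>M. M \<in> S \<Longrightarrow> \<exists>l. length l = n \<and> set l \<subseteq> M \<and> h (g M # l) \<in> hered (elts \<theta>) \<and> h (g M # l) \<notin> M"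
      by metis
    have "S \<in> I"
    proof (rule ccontr)
      assume "S \<notin> I"
      then obtain S' c where S': "S' \<subseteq> S" "S' \<notin> I" "\<forall>M\<in>S'. g M = c"
        using ideal_normal[of S g] g(1) unfolding S_def by blast
      have "S' \<subseteq> {M \<in> small_subsets \<theta>. \<exists>l. length l = n \<and> set l \<subseteq> M \<and>
          h (c # l) \<in> hered (elts \<theta>) \<and> h (c # l) \<notin> M}"
        using S'(1,3) g(2) unfolding S_def by fastforce
      then show False using Suc.IH[of "\<lambda>l. h (c # l)"] S'(2) ideal_subset by blast
    qed
    then show ?case unfolding S_def .
  qed
  have "\<Union> (range (\<lambda>n. {M \<in> small_subsets \<theta>. \<exists>l. length l = n \<and> set l \<subseteq> M \<and> h l \<in> hered (elts \<theta>) \<and> h l \<notin> M})) \<in> I"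
    using len by (intro ideal_countable_Union) auto
  then show ?thesis unfolding almost_all_def by (rule ideal_subset) auto
qed

end

section \<open>The completeness of the ideal and the final contradiction\<close>

context omega_2_exists begin

definition ops_closed :: "'v set \<Rightarrow> 'v set \<Rightarrow> bool" where
  "ops_closed K M \<longleftrightarrow> (\<forall>h\<in>ops. \<forall>l. set l \<subseteq> M \<and> h l \<in> K \<longrightarrow> h l \<in> M)"

lemma Hw2_subset_hered: "omega2 \<subseteq> elts \<theta> \<Longrightarrow> Hw2 \<subseteq> hered (elts \<theta>)"
  unfolding hered_def by (auto intro: lesspoll_trans2 subset_imp_lepoll)

text \<open>If \<mu> exceeded omega2, the sets of those M omitting b, for b below omega2, would have
  their union in the ideal; but no small M contains omega2, so they cover everything. If \<mu> were
  below omega2, then \<delta>, being outside \<open>M\<close>, is at least omega1, so the cardinal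
  \<mu> exceeds omega1, which is impossible.\<close>

lemma completeness_eq:
  assumes I: "normal_ideal \<theta> I" and \<theta>: "omega2 \<subseteq> elts \<theta>" and \<mu>: "has_completeness I \<mu>"
    and M: "M \<in> small_subsets \<theta>" "omega1 \<subseteq> M" "\<delta> \<in> elts \<mu>" "elts \<delta> = M \<inter> elts \<mu>"
  shows "\<mu> = val w2"
proof -
  interpret normal_ideal \<theta> I by (rule I)
  have C: "Card \<mu>" and small: "\<And>J. J \<subseteq> I \<Longrightarrow> J \<prec> elts \<mu> \<Longrightarrow> \<Union>J \<in> I"
    using \<mu> unfolding has_completeness_def by auto
  have O: "Ord \<mu>" using C unfolding Card_def by blast
  have "val w2 \<notin> elts \<mu>"
  proof
    assume "val w2 \<in> elts \<mu>"
    then have lt: "(omega2 :: 'v set) \<prec> elts \<mu>" using C unfolding Card_def elts_w2[symmetric] by blast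
    define J where "J = (\<lambda>b. {M \<in> small_subsets \<theta>. b \<notin> M}) ` (omega2 :: 'v set)"
    have "J \<lesssim> (omega2 :: 'v set)" unfolding J_def by (rule image_lepoll)
    then have "J \<prec> elts \<mu>" using lt by (rule lesspoll_trans1)
    moreover have "J \<subseteq> I"
    proof -
      have "omega2 \<subseteq> hered (elts \<theta>)"
        using emb_subset Hw2_subset_hered[OF \<theta>] unfolding omega2_eq by blast
      then show ?thesis unfolding J_def using ideal_fine by blast
    qed
    ultimately have "\<Union>J \<in> I" by (intro small)
    moreover have "small_subsets \<theta> \<subseteq> \<Union>J"
    proof
      fix M assume M: "M \<in> small_subsets \<theta>"
      then have "M \<prec> (omega2 :: 'v set)" unfolding small_subsets_def by blast
      then have "\<not> omega2 \<subseteq> M" using subset_imp_lepoll lesspoll_trans2 lesspoll_not_refl by blast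
      then show "M \<in> \<Union>J" unfolding J_def using M by blast
    qed
    ultimately show False using ideal_proper ideal_subset by blast
  qed
  moreover have "\<mu> \<notin> elts (val w2)"
  proof
    assume m: "\<mu> \<in> elts (val w2)"
    then have le: "elts \<mu> \<lesssim> (omega1 :: 'v set)" unfolding elts_w2 omega2_def by blast
    have "\<delta> \<notin> M" using M(3,4) elts_irrefl by blast
    then have "\<delta> \<notin> elts (val w1)" using M(2) unfolding elts_w1 by blast
    moreover have "Ord \<delta>" using Ord_elt[OF O M(3)] .
    ultimately have "val w1 = \<delta> \<or> val w1 \<in> elts \<delta>" using Ord_trichotomy[of \<delta> "val w1"] by auto
    then have "val w1 \<in> elts \<mu>" using M(3) Ord_elts_subset[OF O M(3)] by blast
    then have "(omega1 :: 'v set) \<prec> elts \<mu>" using C unfolding Card_def elts_w1[symmetric] by blast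
    then show False using le lesspoll_trans2 lesspoll_not_refl by blast
  qed
  ultimately show ?thesis using Ord_trichotomy[OF O Ord_val[of w2]] by blast
qed

lemma nice_modelI:
  assumes SRP: "SRP_omega2 TYPE('v)" and \<theta>: "omega2 \<subseteq> elts \<theta>"
    and M: "M \<in> small_subsets \<theta>" "M \<in> GIS_omega1"
    and closed: "ops_closed (hered (elts \<theta>)) M"
    and a: "M \<inter> omega2 = val ` {..<a}"
  shows "\<exists>\<pi>. nice_model w1 w2 M (hered (elts \<theta>)) \<pi> a"
proof -
  have "M \<in> G_omega1" "M \<in> IS_omega1" using M(2) unfolding GIS_omega1_def by auto
  then have G: "omega1_guessing M" "M \<approx> (omega1 :: 'v set)" "omega1 \<subseteq> M"
    and ZF: "models_ZF_minus M"
    and IS: "stationary_in M {Y \<in> ctbl_subsets M. \<exists>x\<in>M. elts x = Y}"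
    unfolding G_omega1_def IS_omega1_def by auto
  obtain H where H: "transitive_collapse M H" "omega1_approximation_property H"
    using G(1) unfolding omega1_guessing_def by (elim conjE exE)
  obtain \<pi> where \<pi>: "\<forall>x\<in>M. elts (\<pi> x) = \<pi> ` (elts x \<inter> M)" "H = \<pi> ` M"
    using H(1) unfolding transitive_collapse_def by blast
  have ext: "\<forall>x\<in>M. \<forall>y\<in>M. (\<forall>z\<in>M. z \<in> elts x \<longleftrightarrow> z \<in> elts y) \<longrightarrow> x = y"
    using ZF unfolding models_ZF_minus_def by (elim conjE)
  have "nice_model w1 w2 M (hered (elts \<theta>)) \<pi> a"
  proof
    show "Hw2 \<subseteq> hered (elts \<theta>)" by (rule Hw2_subset_hered[OF \<theta>])
    show "y \<in> hered (elts \<theta>)" if "x \<in> hered (elts \<theta>)" "elts y \<subseteq> elts x" for x y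
      using hered_subset[OF order_trans[OF that(2) elts_subset_trcl] that(1)] .
    show "y \<in> hered (elts \<theta>)" if "x \<in> hered (elts \<theta>)" "y \<in> elts x" for x y
      using hered_elt[OF that(2,1)] .
    show "M \<subseteq> hered (elts \<theta>)" using M(1) unfolding small_subsets_def by blast
    show "x = y" if "x \<in> M" "y \<in> M" "elts x \<inter> M = elts y \<inter> M" for x y
      using ext that by blast
    show "real_index ` {..<w2} = UNIV" by (rule real_index_surj[OF SRP])
    show "h l \<in> M" if "h \<in> ops" "set l \<subseteq> M" "h l \<in> hered (elts \<theta>)" for h l
      using closed that unfolding ops_closed_def by blast
  qed (use G \<pi> IS a H(2) in auto)
  then show ?thesis by blast
qed

theorem no_bounding_ideal:
  fixes \<theta> :: 'v
  assumes SRP: "SRP_omega2 TYPE('v)" and TP: "tree_property_omega2 TYPE('v)"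
    and \<theta>: "omega2 \<subseteq> elts \<theta>" and I: "normal_fine_ideal \<theta> I"
    and conc: "concentrates_on \<theta> I GIS_omega1" and bound: "bounds_completeness \<theta> I"
  shows False
proof -
  interpret normal_ideal \<theta> I by unfold_locales (rule I)
  obtain \<mu> where \<mu>: "has_completeness I \<mu>"
    and bd: "\<And>f. f ` elts \<mu> \<subseteq> elts \<mu> \<Longrightarrow>
           {M \<in> small_subsets \<theta>. \<exists>\<delta>\<in>elts \<mu>. \<exists>\<tau>. elts \<delta> = M \<inter> elts \<mu> \<and>
              Ord \<tau> \<and> has_order_type (M \<inter> Collect Ord) mem (elts \<tau>) \<and> f \<delta> \<in> elts \<tau>}
           \<in> dual_filter \<theta> I"
    using bound unfolding bounds_completeness_def by auto
  have height: "almost_all \<theta> I (\<lambda>M. \<exists>\<delta>\<in>elts \<mu>. \<exists>\<tau>. elts \<delta> = M \<inter> elts \<mu> \<and>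
      Ord \<tau> \<and> has_order_type (M \<inter> Collect Ord) mem (elts \<tau>) \<and> f \<delta> \<in> elts \<tau>)"
    if "f ` elts \<mu> \<subseteq> elts \<mu>" for f
    using bd[OF that] unfolding dual_filter_iff by (elim conjE almost_all_mono) simp
  have "countable ops" unfolding ops_def by simp
  then have "almost_all \<theta> I (\<lambda>M :: 'v set. ops_closed (hered (elts \<theta>)) M)"
    unfolding ops_closed_def by (rule almost_all_countable) (rule almost_all_closed)
  moreover have "almost_all \<theta> I (\<lambda>M. M \<in> GIS_omega1)"
  proof -
    obtain A where "A \<subseteq> GIS_omega1" "almost_all \<theta> I (\<lambda>M. M \<in> A)"
      using conc unfolding concentrates_on_def dual_filter_iff by blast
    then show ?thesis by (auto elim: almost_all_mono)
  qed
  ultimately have A: "almost_all \<theta> I (\<lambda>M. ops_closed (hered (elts \<theta>)) M \<and> M \<in> GIS_omega1)"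
    by (rule almost_all_conj)
  have "\<mu> = val w2"
  proof -
    \<comment> \<open>The identity serves as a sample function: the bounding hypothesis then
      supplies one M whose trace on \<mu> is an element of \<mu>.\<close>
    have "id ` elts \<mu> \<subseteq> elts \<mu>" by simp
    from almost_all_ex[OF almost_all_conj[OF A height[OF this]]]
    obtain M \<delta> where "M \<in> small_subsets \<theta>" "M \<in> GIS_omega1" "\<delta> \<in> elts \<mu>" "elts \<delta> = M \<inter> elts \<mu>"
      by (elim bexE exE conjE)
    moreover from this have "omega1 \<subseteq> M" unfolding GIS_omega1_def G_omega1_def by blast
    ultimately show ?thesis using completeness_eq[OF _ \<theta> \<mu>] normal_ideal_axioms by blast
  qed
  define tall :: "'v set \<Rightarrow> 'v ordinal \<Rightarrow> 'v ordinal \<Rightarrow> bool"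
    where "tall M a c \<longleftrightarrow> M \<in> small_subsets \<theta> \<and> M \<in> GIS_omega1 \<and>
      ops_closed (hered (elts \<theta>)) M \<and> M \<inter> omega2 = val ` {..<a} \<and>
      (\<exists>\<tau>. Ord \<tau> \<and> has_order_type (M \<inter> Collect Ord) mem (elts \<tau>) \<and> val c \<in> elts \<tau>)" for M a c
  \<comment> \<open>Otherwise each a has some \<open>F a\<close> below \<open>w2\<close> that no
    model with trace a reaches. The bounding hypothesis for \<open>F\<close> gives a model reaching
    \<open>F a\<close> for its own trace a.\<close>
  have "\<exists>a<w2. \<forall>c<w2. \<exists>M. tall M a c"
  proof (rule ccontr)
    assume "\<not> ?thesis"
    then have "\<forall>a. \<exists>c. a < w2 \<longrightarrow> c < w2 \<and> (\<forall>M. \<not> tall M a c)" by meson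
    then obtain F where F: "\<And>a. a < w2 \<Longrightarrow> F a < w2" "\<And>a M. a < w2 \<Longrightarrow> \<not> tall M a (F a)" by metis
    define f where "f x = val (F (the_inv val x))" for x
    have "f ` elts \<mu> \<subseteq> elts \<mu>"
      unfolding \<open>\<mu> = val w2\<close> elts_val f_def using F(1) by (auto simp: the_inv_f_f[OF inj_val])
    from almost_all_ex[OF almost_all_conj[OF A height[OF this]]]
    obtain M \<delta> \<tau> where M: "M \<in> small_subsets \<theta>" "M \<in> GIS_omega1"
        "ops_closed (hered (elts \<theta>)) M"
        "\<delta> \<in> elts \<mu>" "elts \<delta> = M \<inter> elts \<mu>" "Ord \<tau>" "has_order_type (M \<inter> Collect Ord) mem (elts \<tau>)" "f \<delta> \<in> elts \<tau>"
      by (elim bexE exE conjE)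
    obtain a where a: "a < w2" "\<delta> = val a" using M(4) unfolding \<open>\<mu> = val w2\<close> elts_val by blast
    have "M \<inter> omega2 = val ` {..<a}"
      using M(5) unfolding \<open>\<mu> = val w2\<close> elts_w2 a(2) elts_val[of a] by simp
    moreover have "f \<delta> = val (F a)" unfolding f_def a(2) the_inv_f_f[OF inj_val] ..
    ultimately have "val (F a) \<in> elts \<tau>" "M \<inter> omega2 = val ` {..<a}" using M(8) by simp_all
    then have "tall M a (F a)" unfolding tall_def using M(1,2,3,6,7) by (intro conjI exI[of _ \<tau>])
    then show False using F(2)[OF a(1)] by blast
  qed
  then obtain a where a: "a < w2" "\<And>c. c < w2 \<Longrightarrow> \<exists>M. tall M a c" by blast
  define \<H> where "\<H> = {\<pi> ` M |M \<pi>. nice_model w1 w2 M (hered (elts \<theta>)) \<pi> a}"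
  have "real_index ` {..<a} = UNIV"
  proof (rule unbounded_good_models[OF SRP TP])
    fix H assume "H \<in> \<H>"
    then obtain M \<pi> where H: "nice_model w1 w2 M (hered (elts \<theta>)) \<pi> a" "H = \<pi> ` M" unfolding \<H>_def by blast
    show "good_model (real_index ` {..<a}) H"
      using nice_model.good_model_H[OF H(1)] unfolding nice_model.R_def[OF H(1)] H(2) .
  next
    fix c assume "c < w2"
    then obtain M where M: "tall M a c" using a(2) by blast
    then obtain \<pi> where \<pi>: "nice_model w1 w2 M (hered (elts \<theta>)) \<pi> a"
      using nice_modelI[OF SRP \<theta>, of M a] unfolding tall_def by blast
    obtain \<tau> where "Ord \<tau>" "has_order_type (M \<inter> Collect Ord) mem (elts \<tau>)" "val c \<in> elts \<tau>"
      using M unfolding tall_def by blast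
    then have "val c \<in> \<pi> ` M" using nice_model.ordinals_H[OF \<pi>] by blast
    then show "\<exists>H\<in>\<H>. val c \<in> H" unfolding \<H>_def using \<pi> by blast
  qed
  moreover obtain M \<pi> where "nice_model w1 w2 M (hered (elts \<theta>)) \<pi> a"
  proof -
    obtain M where "tall M a w1" using a(2)[OF w1_less_w2] by blast
    then show ?thesis using that nice_modelI[OF SRP \<theta>, of M a] unfolding tall_def by blast
  qed
  note nm = this
  have "real_index ` {..<a} \<noteq> UNIV"
    using nice_model.R_not_UNIV[OF nm] unfolding nice_model.R_def[OF nm] .
  ultimately show False by simp
qed

end

theorem theorem27:
  assumes "SRP_omega2 TYPE('v::set_universe)"
    and "tree_property_omega2 TYPE('v)"
  shows "\<not> (\<exists>(\<theta> :: 'v) I. regular_cardinal \<theta> \<and> omega2 \<subseteq> elts \<theta> \<and>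
            normal_fine_ideal \<theta> I \<and> concentrates_on \<theta> I GIS_omega1 \<and> bounds_completeness \<theta> I)"
proof
  assume "\<exists>(\<theta> :: 'v) I. regular_cardinal \<theta> \<and> omega2 \<subseteq> elts \<theta> \<and>
            normal_fine_ideal \<theta> I \<and> concentrates_on \<theta> I GIS_omega1 \<and> bounds_completeness \<theta> I"
  then obtain \<theta> :: 'v and I where \<theta>: "omega2 \<subseteq> elts \<theta>" "normal_fine_ideal \<theta> I"
    "concentrates_on \<theta> I GIS_omega1" "bounds_completeness \<theta> I" by blast
  have sub: "elts y \<subseteq> elts x" if "Ord x" "y \<in> elts x" for x y :: 'v
    using that Ord_elts_subset by blast
  \<comment> \<open>Separation inside \<theta> makes omega2 an element of the universe, and omega1
    is then separated from it.\<close>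
  obtain u2 :: 'v where u2: "elts u2 = omega2" using ex_elts_subset[OF \<theta>(1)] by blast
  have "Ord u2"
  proof (rule OrdI_subset)
    fix y assume y: "y \<in> elts u2"
    then have O: "Ord y" "elts y \<lesssim> (omega1 :: 'v set)" unfolding u2 omega2_def by auto
    show "Ord y" by (rule O(1))
    show "elts y \<subseteq> elts u2"
      unfolding u2 omega2_def
      using O(2) Ord_elt[OF O(1)] sub[OF O(1)] by (auto intro: lepoll_trans[OF subset_imp_lepoll])
  qed
  then obtain w2 where w2: "u2 = val w2" using ex_ordinal by blast
  have "omega1 \<subseteq> elts u2"
    unfolding u2
  proof
    fix x :: 'v assume x: "x \<in> omega1"
    have "elts x \<subseteq> omega1"
      using x Ord_elt countable_subset[OF sub] unfolding omega1_def by blast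
    then show "x \<in> omega2" using x unfolding omega2_def omega1_def by (auto intro: subset_imp_lepoll)
  qed
  then obtain u1 :: 'v where u1: "elts u1 = omega1" using ex_elts_subset by blast
  have "Ord u1"
  proof (rule OrdI_subset)
    fix y assume y: "y \<in> elts u1"
    then have O: "Ord y" "countable (elts y)" unfolding u1 omega1_def by auto
    show "Ord y" by (rule O(1))
    show "elts y \<subseteq> elts u1"
      unfolding u1 omega1_def using O(2) Ord_elt[OF O(1)] sub[OF O(1)] by (auto intro: countable_subset)
  qed
  then obtain w1 where w1: "u1 = val w1" using ex_ordinal by blast
  interpret omega_2_exists w1 w2 by unfold_locales (use u1 u2 w1 w2 in auto)
  show False using no_bounding_ideal[OF assms \<theta>] .
qed

end
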